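(* Assume $\Sigma_1\Sigma_2+\Sigma_1\Sigma_3+\Sigma_2\Sigma_3>0$ and $\Sigma_i+\Sigma_j>0$ for all $i\neq j$. Let $(c_1,c_2,c_3,U)^n$ be given with $c_1^n+c_2^n+c_3^n=1$, and let $(c_1,c_2,c_3,\mu_1,\mu_2,\mu_3,U)^{n+1}$ solve the first order scheme $$\frac{c_i^{n+1}-c_i^n}{\delta t}=\frac{M_0}{\Sigma_i}\Delta\mu_i^{n+1},\quad i=1,2,3,$$ $$\mu_i^{n+1}=-\frac34\epsilon\Sigma_i\Delta c_i^{n+1}+\frac{24}{\epsilon}H_i^nU^{n+1}+\beta^{n+1},\quad i=1,2,3,$$ $$U^{n+1}-U^n=H_1^n(c_1^{n+1}-c_1^n)+H_2^n(c_2^{n+1}-c_2^n)+H_3^n(c_3^{n+1}-c_3^n).$$ Then the scheme is unconditionally energy stable: for every $\delta t>0$, $$\frac1{\delta t}\big(E_{1st}^{n+1}-E_{1st}^n\big)\le-M_0\underline{\Sigma}\Big(\frac{\|\nabla\mu_1^{n+1}\|^2}{\Sigma_1^2}+\frac{\|\nabla\mu_2^{n+1}\|^2}{\Sigma_2^2}+\frac{\|\nabla\mu_3^{n+1}\|^2}{\Sigma_3^2}\Big),$$ where $$E_{1st}^n=\frac38\Sigma_1\epsilon\|\nabla c_1^n\|^2+\frac38\Sigma_2\epsilon\|\nabla c_2^n\|^2+\frac38\Sigma_3\epsilon\|\nabla c_3^n\|^2+\frac{12}{\epsilon}\|U^n\|^2-\frac{12}{\epsilon}B|\Omega|.$$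
   Context: Let $d\in\{2,3\}$ and let $\Omega\subset\mathbb{R}^d$ be a smooth, open, bounded, connected domain (a rectangular box when periodic boundary conditions are used). $(f,g)=\int_\Omega fg\,dx$, $\|f\|=\sqrt{(f,f)}$. Parameters: $\epsilon>0$, $M_0>0$, $\Lambda\ge0$, time step $\delta t>0$; surface tensions $\sigma_{12},\sigma_{13},\sigma_{23}>0$ (with $\sigma_{ij}=\sigma_{ji}$); $\Sigma_i=\sigma_{ij}+\sigma_{ik}-\sigma_{jk}$ for $\{i,j,k\}=\{1,2,3\}$, which may be negative but are assumed nonzero with $\frac1{\Sigma_1}+\frac1{\Sigma_2}+\frac1{\Sigma_3}\ne0$; $\Sigma_T$ is defined by $\frac{3}{\Sigma_T}=\frac1{\Sigma_1}+\frac1{\Sigma_2}+\frac1{\Sigma_3}$. Under the assumed conditions on the $\Sigma_i$, there exists a constant $\underline\Sigma>0$ such that $\Sigma_1|\xi_1|^2+\Sigma_2|\xi_2|^2+\Sigma_3|\xi_3|^2\ge\underline\Sigma(|\xi_1|^2+|\xi_2|^2+|\xi_3|^2)$ whenever $\xi_1+\xi_2+\xi_3=0$; $\underline\Sigma$ denotes such a constant. $F(c_1,c_2,c_3)=\sum_{i=1}^3\frac{\Sigma_i}{2}c_i^2(1-c_i)^2+3\Lambda c_1^2c_2^2c_3^2$, and $B$ is a constant such that $F+B>0$ on the hyperplane $S=\{c\in\mathbb{R}^3:c_1+c_2+c_3=1\}$. For $c\in S$ and $\{i,j,k\}=\{1,2,3\}$ set $$\mathcal{H}_i(c)=\frac12\,\frac{\Sigma_i(c_i-c_i^2)(1-2c_i)+6\Lambda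 c_ic_j^2c_k^2}{\sqrt{F(c)+B}},$$ and $H_i^n=\mathcal{H}_i(c_1^n,c_2^n,c_3^n)$, $\beta^{n+1}=-\frac{8}{\epsilon}\Sigma_T\big(\frac{H_1^n}{\Sigma_1}+\frac{H_2^n}{\Sigma_2}+\frac{H_3^n}{\Sigma_3}\big)U^{n+1}$. Boundary conditions (at every time level): either (i) all variables are periodic, or (ii) $\partial_{\mathbf n}c_i=\partial_{\mathbf n}\mu_i=0$ on $\partial\Omega$, $i=1,2,3$. Regularity: the functions $c_i,\mu_i$ lie in $H^2(\Omega)$ (periodic in case (i)), $U\in L^2(\Omega)$, and the equations hold almost everywhere. *)

theory Defs
  imports "HOL-Analysis.Analysis"
begin

section \<open>Smooth functions and smooth domains\<close>

definition partial_deriv :: "'a::euclidean_space \<Rightarrow> ('a \<Rightarrow> real) \<Rightarrow> 'a \<Rightarrow> real" where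
  "partial_deriv b f x = frechet_derivative f (at x) b"

definition gradient :: "('a::euclidean_space \<Rightarrow> real) \<Rightarrow> 'a \<Rightarrow> 'a" where
  "gradient f x = (\<Sum>b\<in>Basis. partial_deriv b f x *\<^sub>R b)"

primrec Ck_on :: "nat \<Rightarrow> 'a::euclidean_space set \<Rightarrow> ('a \<Rightarrow> real) \<Rightarrow> bool" where
  "Ck_on 0 S f \<longleftrightarrow> continuous_on S f"
| "Ck_on (Suc k) S f \<longleftrightarrow>
     (\<forall>x\<in>S. f differentiable (at x)) \<and> (\<forall>b\<in>Basis. Ck_on k S (partial_deriv b f))"

(* only used for open S *)
definition smooth_on :: "'a::euclidean_space set \<Rightarrow> ('a \<Rightarrow> real) \<Rightarrow> bool" where
  "smooth_on S f \<longleftrightarrow> (\<forall>k. Ck_on k S f)"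

definition local_defining_function ::
  "'a::euclidean_space set \<Rightarrow> 'a \<Rightarrow> 'a set \<Rightarrow> ('a \<Rightarrow> real) \<Rightarrow> bool" where
  "local_defining_function \<Omega> p W \<rho> \<longleftrightarrow>
     open W \<and> p \<in> W \<and> smooth_on W \<rho> \<and> (\<forall>x\<in>W. gradient \<rho> x \<noteq> 0) \<and>
     \<Omega> \<inter> W = {x \<in> W. \<rho> x < 0}"

definition smooth_bounded_domain :: "'a::euclidean_space set \<Rightarrow> bool" where
  "smooth_bounded_domain \<Omega> \<longleftrightarrow>
     open \<Omega> \<and> bounded \<Omega> \<and> connected \<Omega> \<and> \<Omega> \<noteq> {} \<and>
     (\<forall>p\<in>frontier \<Omega>. \<exists>W \<rho>. local_defining_function \<Omega> p W \<rho>)"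

(* The vector does not depend on the choice of the defining function. *)
definition outward_normal :: "'a::euclidean_space set \<Rightarrow> 'a \<Rightarrow> 'a" where
  "outward_normal \<Omega> p =
     (SOME \<nu>. \<exists>W \<rho>. local_defining_function \<Omega> p W \<rho> \<and>
                    \<nu> = gradient \<rho> p /\<^sub>R norm (gradient \<rho> p))"


section \<open>Surface measure\<close>

(* Hausdorff measure of integer dimension s \<ge> 1, normalised so that it is the usual
   s-dimensional area. Boundedness is required because diameter is a junk value on
   unbounded sets. *)
definition hausdorff_premeasure :: "nat \<Rightarrow> real \<Rightarrow> 'a::euclidean_space set \<Rightarrow> ennreal" where
  "hausdorff_premeasure s \<delta> A =
     (INF C \<in> {C :: nat \<Rightarrow> 'a set. A \<subseteq> (\<Union>n. C n) \<and>
                                 (\<forall>n. bounded (C n) \<and> diameter (C n) \<le> \<delta>)}.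
        (\<Sum>n. ennreal (unit_ball_vol (real s) * (diameter (C n) / 2) ^ s)))"

definition hausdorff_outer :: "nat \<Rightarrow> 'a::euclidean_space set \<Rightarrow> ennreal" where
  "hausdorff_outer s A = (SUP \<delta>\<in>{0<..}. hausdorff_premeasure s \<delta> A)"

(* hausdorff_outer is a metric outer measure, hence countably additive on Borel sets. *)
definition hausdorff_measure :: "nat \<Rightarrow> 'a::euclidean_space measure" where
  "hausdorff_measure s = measure_of UNIV (sets borel) (hausdorff_outer s)"

definition surface_measure :: "'a::euclidean_space set \<Rightarrow> 'a measure" where
  "surface_measure \<Omega> = restrict_space (hausdorff_measure (DIM('a) - 1)) (frontier \<Omega>)"


section \<open>Square-integrable functions and weak derivatives\<close>

definition L2 :: "'a::euclidean_space set \<Rightarrow> ('a \<Rightarrow> real) \<Rightarrow> bool" where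
  "L2 \<Omega> f \<longleftrightarrow> f \<in> borel_measurable (lebesgue_on \<Omega>) \<and>
              integrable (lebesgue_on \<Omega>) (\<lambda>x. (f x)\<^sup>2)"

definition L2norm :: "'a::euclidean_space set \<Rightarrow> ('a \<Rightarrow> 'b::real_normed_vector) \<Rightarrow> real" where
  "L2norm \<Omega> f = sqrt (integral\<^sup>L (lebesgue_on \<Omega>) (\<lambda>x. (norm (f x))\<^sup>2))"

definition test_function :: "'a::euclidean_space set \<Rightarrow> ('a \<Rightarrow> real) \<Rightarrow> bool" where
  "test_function \<Omega> \<phi> \<longleftrightarrow>
     smooth_on UNIV \<phi> \<and> (\<exists>K. compact K \<and> K \<subseteq> \<Omega> \<and> (\<forall>x. x \<notin> K \<longrightarrow> \<phi> x = 0))"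

definition has_weak_partial ::
  "'a::euclidean_space set \<Rightarrow> 'a \<Rightarrow> ('a \<Rightarrow> real) \<Rightarrow> ('a \<Rightarrow> real) \<Rightarrow> bool" where
  "has_weak_partial \<Omega> b u g \<longleftrightarrow>
     (\<forall>\<phi>. test_function \<Omega> \<phi> \<longrightarrow>
        integral\<^sup>L (lebesgue_on \<Omega>) (\<lambda>x. u x * partial_deriv b \<phi> x) =
        - integral\<^sup>L (lebesgue_on \<Omega>) (\<lambda>x. g x * \<phi> x))"

(* a representative; unique up to null sets *)
definition weak_partial :: "'a::euclidean_space set \<Rightarrow> 'a \<Rightarrow> ('a \<Rightarrow> real) \<Rightarrow> 'a \<Rightarrow> real" where
  "weak_partial \<Omega> b u = (SOME g. L2 \<Omega> g \<and> has_weak_partial \<Omega> b u g)"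

definition H1 :: "'a::euclidean_space set \<Rightarrow> ('a \<Rightarrow> real) \<Rightarrow> bool" where
  "H1 \<Omega> u \<longleftrightarrow> L2 \<Omega> u \<and> (\<forall>b\<in>Basis. \<exists>g. L2 \<Omega> g \<and> has_weak_partial \<Omega> b u g)"

definition H2 :: "'a::euclidean_space set \<Rightarrow> ('a \<Rightarrow> real) \<Rightarrow> bool" where
  "H2 \<Omega> u \<longleftrightarrow> H1 \<Omega> u \<and> (\<forall>b\<in>Basis. H1 \<Omega> (weak_partial \<Omega> b u))"

definition weak_gradient :: "'a::euclidean_space set \<Rightarrow> ('a \<Rightarrow> real) \<Rightarrow> 'a \<Rightarrow> 'a" where
  "weak_gradient \<Omega> u x = (\<Sum>b\<in>Basis. weak_partial \<Omega> b u x *\<^sub>R b)"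

definition weak_laplacian :: "'a::euclidean_space set \<Rightarrow> ('a \<Rightarrow> real) \<Rightarrow> 'a \<Rightarrow> real" where
  "weak_laplacian \<Omega> u x = (\<Sum>b\<in>Basis. weak_partial \<Omega> b (weak_partial \<Omega> b u) x)"


section \<open>Boundary conditions\<close>

(* Convergence in H2(\<Omega>), for bounded \<Omega>, of restrictions of smooth functions on the whole
   space; for these the weak derivatives are the classical ones. *)
definition smooth_tendsto_H2 ::
  "'a::euclidean_space set \<Rightarrow> (nat \<Rightarrow> 'a \<Rightarrow> real) \<Rightarrow> ('a \<Rightarrow> real) \<Rightarrow> bool" where
  "smooth_tendsto_H2 \<Omega> v u \<longleftrightarrow>
     (\<forall>k. smooth_on UNIV (v k)) \<and>
     (\<lambda>k. L2norm \<Omega> (\<lambda>x. v k x - u x)) \<longlonglongrightarrow> 0 \<and>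
     (\<forall>b\<in>Basis. (\<lambda>k. L2norm \<Omega> (\<lambda>x. partial_deriv b (v k) x - weak_partial \<Omega> b u x))
                  \<longlonglongrightarrow> 0) \<and>
     (\<forall>b\<in>Basis. \<forall>b'\<in>Basis.
        (\<lambda>k. L2norm \<Omega> (\<lambda>x. partial_deriv b' (partial_deriv b (v k)) x
                             - weak_partial \<Omega> b' (weak_partial \<Omega> b u) x)) \<longlonglongrightarrow> 0)"

(* The normal derivative of u \<in> H2(\<Omega>) is the trace h \<in> L2(\<partial>\<Omega>): the trace map is the
   extension by continuity, from functions smooth up to the boundary to H2(\<Omega>), of the
   pointwise normal derivative on the boundary. *)
definition has_normal_derivative ::
  "'a::euclidean_space set \<Rightarrow> ('a \<Rightarrow> real) \<Rightarrow> ('a \<Rightarrow> real) \<Rightarrow> bool" where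
  "has_normal_derivative \<Omega> u h \<longleftrightarrow>
     h \<in> borel_measurable (surface_measure \<Omega>) \<and>
     integrable (surface_measure \<Omega>) (\<lambda>x. (h x)\<^sup>2) \<and>
     (\<exists>v. smooth_tendsto_H2 \<Omega> v u \<and>
        (\<lambda>k. \<integral>\<^sup>+ x. ennreal ((gradient (v k) x \<bullet> outward_normal \<Omega> x - h x)\<^sup>2)
               \<partial>surface_measure \<Omega>) \<longlonglongrightarrow> 0)"

definition neumann_bc :: "'a::euclidean_space set \<Rightarrow> ('a \<Rightarrow> real) \<Rightarrow> bool" where
  "neumann_bc \<Omega> u \<longleftrightarrow> has_normal_derivative \<Omega> u (\<lambda>_. 0)"

(* Periodic Sobolev space on a box: the closure in H2 of the smooth functions on the whole
   space having the box as period cell. *)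
definition box_periodic :: "'a::euclidean_space \<Rightarrow> 'a \<Rightarrow> ('a \<Rightarrow> real) \<Rightarrow> bool" where
  "box_periodic p q v \<longleftrightarrow> (\<forall>x. \<forall>b\<in>Basis. v (x + ((q - p) \<bullet> b) *\<^sub>R b) = v x)"

definition periodic_bc :: "'a::euclidean_space \<Rightarrow> 'a \<Rightarrow> ('a \<Rightarrow> real) \<Rightarrow> bool" where
  "periodic_bc p q u \<longleftrightarrow>
     (\<exists>v. smooth_tendsto_H2 (box p q) v u \<and> (\<forall>k. box_periodic p q (v k)))"


section \<open>The three-phase model\<close>

(* The three phases are indexed by the type 3, on which addition is cyclic: for every i the
   indices i, i + 1, i + 2 are the three phases, so that j = i + 1, k = i + 2 below. *)

definition potential :: "(3 \<Rightarrow> real) \<Rightarrow> real \<Rightarrow> (3 \<Rightarrow> real) \<Rightarrow> real" where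
  "potential \<Sigma> \<Lambda> c =
     (\<Sum>i\<in>UNIV. \<Sigma> i / 2 * (c i)\<^sup>2 * (1 - c i)\<^sup>2) + 3 * \<Lambda> * (c 1)\<^sup>2 * (c 2)\<^sup>2 * (c 3)\<^sup>2"

definition Hfun :: "(3 \<Rightarrow> real) \<Rightarrow> real \<Rightarrow> real \<Rightarrow> 3 \<Rightarrow> (3 \<Rightarrow> real) \<Rightarrow> real" where
  "Hfun \<Sigma> \<Lambda> B i c =
     1 / 2 * ((\<Sigma> i * (c i - (c i)\<^sup>2) * (1 - 2 * c i)
               + 6 * \<Lambda> * c i * (c (i + 1))\<^sup>2 * (c (i + 2))\<^sup>2)
              / sqrt (potential \<Sigma> \<Lambda> c + B))"

definition Sigma_T :: "(3 \<Rightarrow> real) \<Rightarrow> real" where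
  "Sigma_T \<Sigma> = 3 / (1 / \<Sigma> 1 + 1 / \<Sigma> 2 + 1 / \<Sigma> 3)"

definition beta :: "(3 \<Rightarrow> real) \<Rightarrow> real \<Rightarrow> (3 \<Rightarrow> real) \<Rightarrow> real \<Rightarrow> real" where
  "beta \<Sigma> \<epsilon> H U = - (8 / \<epsilon>) * Sigma_T \<Sigma> * (H 1 / \<Sigma> 1 + H 2 / \<Sigma> 2 + H 3 / \<Sigma> 3) * U"

definition energy_1st ::
  "'a::euclidean_space set \<Rightarrow> (3 \<Rightarrow> real) \<Rightarrow> real \<Rightarrow> real \<Rightarrow> (3 \<Rightarrow> 'a \<Rightarrow> real) \<Rightarrow> ('a \<Rightarrow> real) \<Rightarrow> real"
where
  "energy_1st \<Omega> \<Sigma> \<epsilon> B c U =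
     (\<Sum>i\<in>UNIV. 3 / 8 * \<Sigma> i * \<epsilon> * (L2norm \<Omega> (weak_gradient \<Omega> (c i)))\<^sup>2)
     + 12 / \<epsilon> * (L2norm \<Omega> U)\<^sup>2 - 12 / \<epsilon> * B * measure lebesgue \<Omega>"

end

theory Submission
  imports Defs
begin

text \<open>
  The energy law comes from testing the \<open>i\<close>-th mass balance with \<open>\<mu>\<^sub>i\<close> and the \<open>i\<close>-th equation for the
  chemical potential with the increment of \<open>c\<^sub>i\<close>. With \<open>d\<^sub>i\<close> that increment, Green's formula gives
  on one side \<open>- M\<^sub>0 \<delta>t \<Sum> |\<nabla>\<mu>\<^sub>i|\<^sup>2 / \<Sigma>\<^sub>i\<close>, on the other side the terms
  \<open>3/4 \<epsilon> \<Sigma>\<^sub>i (\<nabla>c\<^sub>i, \<nabla>d\<^sub>i)\<close>, which by polarisation are the change of the gradient energy plus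
  \<open>3/8 \<epsilon> \<Sigma>\<^sub>i |\<nabla>d\<^sub>i|\<^sup>2\<close>, and the terms with \<open>U\<close>, which the update rule for \<open>U\<close> turns into
  \<open>24/\<epsilon> (U, U - U\<^sub>o\<^sub>l\<^sub>d)\<close>, that is, the change of \<open>12/\<epsilon> |U|\<^sup>2\<close> plus a square. Individual \<open>\<Sigma>\<^sub>i\<close> may be
  negative, so the sums \<open>\<Sum> \<Sigma>\<^sub>i |\<nabla>d\<^sub>i|\<^sup>2\<close> and \<open>\<Sum> \<Sigma>\<^sub>i |\<nabla>\<mu>\<^sub>i / \<Sigma>\<^sub>i|\<^sup>2\<close> are bounded below by the
  coercivity assumption, which speaks about triples with vanishing sum.

  That these triples do sum to zero is a consequence of the choice of \<open>\<beta>\<close>. Put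
  \<open>D = \<Sum> d\<^sub>i\<close> and \<open>\<Theta> = \<Sum> \<mu>\<^sub>i / \<Sigma>\<^sub>i\<close>. The mass balances add up to \<open>D = \<delta>t M\<^sub>0 \<Delta>\<Theta>\<close>, and the
  equations for the potentials to \<open>\<Theta> = - 3/4 \<epsilon> \<Delta>S\<close> with \<open>S\<close> the new total concentration,
  because \<open>\<beta>\<close> cancels the contribution of the \<open>H\<^sub>i\<close>. Computing \<open>(D, \<Theta>)\<close> in both ways shows
  \<open>3/4 \<epsilon> |\<nabla>D|\<^sup>2 + \<delta>t M\<^sub>0 |\<nabla>\<Theta>|\<^sup>2 = 0\<close>; both gradients vanish, and then \<open>D = 0\<close> as well.
  This is \<open>three_phase_energy_decay\<close>.

  The analytic ingredient is Green's formula for \<open>H\<^sup>2\<close> functions that satisfy the boundary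
  conditions as limits of smooth functions. It passes to the limit from smooth \<open>v\<^sub>k\<close> and \<open>w\<close> once
  \<open>\<integral>\<^sub>\<Omega> div (w \<nabla>v\<^sub>k)\<close> tends to zero as \<open>k\<close> grows with \<open>w\<close> held fixed. In the periodic
  case this integral is zero, since it is a limit of difference quotients over a period cell.
  In the Neumann case it is controlled by the \<open>L\<^sup>2\<close> norm of the normal derivative with respect
  to Hausdorff measure (\<open>weighted_flux_tendsto_0\<close>). Near a boundary point the field \<open>w \<nabla>v\<close> is
  written as \<open>g e + T\<close>, with \<open>e\<close> a coordinate direction transversal to the boundary and \<open>T\<close>
  tangential to the level sets of the defining function. The divergence of \<open>T\<close> integrates to
  zero (\<open>integral_divergence_tangential\<close>), because the characteristic function of \<open>\<Omega>\<close> is a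
  limit of functions of the defining function. The integral of \<open>\<partial>\<^sub>e g\<close> is a limit of difference
  quotients, hence of \<open>1/s\<close> times the integral of \<open>g\<close> over the thin region between \<open>\<Omega>\<close> and its
  translate by \<open>s e\<close>. This region projects along \<open>e\<close> to the boundary, and the part above
  a boundary piece \<open>A\<close> has volume at most a constant times \<open>s\<close> times the Hausdorff measure of \<open>A\<close>,
  since a set of diameter \<open>d\<close> sweeps out a box of volume of order \<open>d\<^sup>n\<^sup>-\<^sup>1 s\<close>
  (\<open>slab_projection\<close>, \<open>transversal_flux_bound\<close>). A compactness argument puts the local estimates
  together.
\<close>

section \<open>Functions with continuous gradient\<close>

text \<open>
  Differentiability at every point is part of the definition because \<open>gradient\<close> has a junk
  value where the function is not differentiable.
\<close>
definition C1_on :: "'a::euclidean_space set \<Rightarrow> ('a \<Rightarrow> real) \<Rightarrow> bool" where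
  "C1_on S f \<longleftrightarrow> (\<forall>x\<in>S. f differentiable (at x)) \<and> continuous_on S (gradient f)"

lemma gradient_inner_Basis: "b \<in> Basis \<Longrightarrow> gradient f x \<bullet> b = partial_deriv b f x"
  by (simp add: gradient_def inner_sum_left inner_Basis if_distrib cong: if_cong)

text \<open>
  The gradient is assembled from the values of the derivative on the basis, so by linearity it
  represents the derivative.
\<close>
lemma has_derivative_gradient:
  assumes "f differentiable (at x)"
  shows "(f has_derivative (\<lambda>h. gradient f x \<bullet> h)) (at x)"
proof -
  have d: "(f has_derivative frechet_derivative f (at x)) (at x)"
    using assms frechet_derivative_works by blast
  then have l: "linear (frechet_derivative f (at x))"
    by (rule has_derivative_linear)
  have "frechet_derivative f (at x) h = gradient f x \<bullet> h" for h
  proof -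
    have "frechet_derivative f (at x) h = frechet_derivative f (at x) (\<Sum>b\<in>Basis. (h \<bullet> b) *\<^sub>R b)"
      by (simp only: euclidean_representation)
    also have "\<dots> = (\<Sum>b\<in>Basis. (h \<bullet> b) * frechet_derivative f (at x) b)"
      by (simp only: linear_sum[OF l] linear_scale[OF l] real_scaleR_def)
    also have "\<dots> = gradient f x \<bullet> h"
      unfolding gradient_def partial_deriv_def inner_sum_left
      by (intro sum.cong) (simp_all add: inner_commute)
    finally show ?thesis .
  qed
  then have "frechet_derivative f (at x) = (\<lambda>h. gradient f x \<bullet> h)" by (rule ext)
  then show ?thesis using d by simp
qed

lemma gradient_eqI:
  assumes "(f has_derivative (\<lambda>h. g \<bullet> h)) (at x)"
  shows "gradient f x = g"
proof -
  have "frechet_derivative f (at x) = (\<lambda>h. g \<bullet> h)"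
    by (rule frechet_derivative_at[OF assms, symmetric])
  then show ?thesis
    unfolding gradient_def partial_deriv_def by (simp add: euclidean_representation)
qed

lemma C1_onI:
  assumes "\<And>x. x \<in> S \<Longrightarrow> (f has_derivative (\<lambda>h. g x \<bullet> h)) (at x)" and "continuous_on S g"
  shows "C1_on S f"
proof -
  have "gradient f x = g x" if "x \<in> S" for x
    by (rule gradient_eqI[OF assms(1)[OF that]])
  then have "continuous_on S (gradient f)"
    using assms(2) by (simp cong: continuous_on_cong)
  then show ?thesis using assms(1) unfolding C1_on_def differentiable_def by blast
qed

lemma C1_onD:
  assumes "C1_on S f" "x \<in> S"
  shows "(f has_derivative (\<lambda>h. gradient f x \<bullet> h)) (at x)"
  by (rule has_derivative_gradient) (use assms in \<open>simp add: C1_on_def\<close>)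

lemma C1_on_gradient: "C1_on S f \<Longrightarrow> continuous_on S (gradient f)"
  by (simp add: C1_on_def)

lemma C1_on_continuous: "C1_on S f \<Longrightarrow> continuous_on S f"
  by (auto simp: C1_on_def intro!: continuous_at_imp_continuous_on differentiable_imp_continuous_within)

lemma C1_on_subset: "C1_on S f \<Longrightarrow> T \<subseteq> S \<Longrightarrow> C1_on T f"
  by (auto simp: C1_on_def intro: continuous_on_subset)

lemma gradient_cong_open:
  assumes "open S" "\<And>x. x \<in> S \<Longrightarrow> f x = g x" "x \<in> S"
  shows "gradient f x = gradient g x"
proof -
  have "(f has_derivative D) (at x) \<longleftrightarrow> (g has_derivative D) (at x)" for D
  proof
    show "(f has_derivative D) (at x) \<Longrightarrow> (g has_derivative D) (at x)"
      by (erule has_derivative_transform_within_open[of _ _ _ _ S]) (use assms in auto)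
    show "(g has_derivative D) (at x) \<Longrightarrow> (f has_derivative D) (at x)"
      by (erule has_derivative_transform_within_open[of _ _ _ _ S]) (use assms in auto)
  qed
  then show ?thesis
    by (simp add: gradient_def partial_deriv_def frechet_derivative_def)
qed

lemma C1_on_cong_open:
  assumes "C1_on S g" "open S" "\<And>x. x \<in> S \<Longrightarrow> f x = g x"
  shows "C1_on S f"
proof (rule C1_onI[where g = "gradient g"])
  fix x assume "x \<in> S"
  show "(f has_derivative (\<lambda>h. gradient g x \<bullet> h)) (at x)"
    by (rule has_derivative_transform_within_open[OF C1_onD[OF assms(1) \<open>x \<in> S\<close>], of S])
       (use assms \<open>x \<in> S\<close> in auto)
qed (use assms C1_on_gradient in auto)

lemma C1_on_Un:
  assumes "C1_on S f" "C1_on T f" "open S" "open T"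
  shows "C1_on (S \<union> T) f"
  using assms unfolding C1_on_def by (auto intro: continuous_on_open_Un)

lemma C1_on_const [simp]: "C1_on S (\<lambda>x. c)"
  by (rule C1_onI[where g = "\<lambda>x. 0"]) auto

text \<open>
  This is how quantities that are meaningful only near a boundary point become global: after
  multiplication by a cutoff they vanish outside \<open>K\<close>, and \<open>W\<close> and the complement of \<open>K\<close> are
  open sets that cover the space.
\<close>
lemma C1_on_extend_zero:
  assumes "C1_on W f" "open W" "closed K" "K \<subseteq> W" "\<And>x. x \<notin> K \<Longrightarrow> f x = 0"
  shows "C1_on UNIV f"
proof -
  have "C1_on (- K) f"
    by (rule C1_on_cong_open[of _ "\<lambda>x. 0"]) (use assms in auto)
  then have "C1_on (W \<union> - K) f" using assms by (intro C1_on_Un) auto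
  moreover have "W \<union> - K = UNIV" using assms by blast
  ultimately show ?thesis by simp
qed

lemma gradient_zero_outside:
  assumes "closed K" "\<And>x. x \<notin> K \<Longrightarrow> f x = 0" "x \<notin> K"
  shows "gradient f x = 0"
proof -
  have "gradient f x = gradient (\<lambda>x. 0) x"
    by (rule gradient_cong_open[of "- K"]) (use assms in auto)
  also have "\<dots> = 0" by (rule gradient_eqI) simp
  finally show ?thesis .
qed

lemma has_derivative_inner_compose:
  assumes "(f has_derivative (\<lambda>h. g \<bullet> h)) (at x)" "(\<phi> has_real_derivative d) (at (f x))"
  shows "((\<lambda>x. \<phi> (f x)) has_derivative (\<lambda>h. (d *\<^sub>R g) \<bullet> h)) (at x)"
proof -
  have "(\<phi> has_derivative (*) d) (at (f x))"
    using assms(2) by (simp add: has_field_derivative_def)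
  from has_derivative_compose[OF assms(1) this] show ?thesis by simp
qed

lemma
  assumes "C1_on S f" "C1_on S g"
  shows C1_on_add: "C1_on S (\<lambda>x. f x + g x)"
    and C1_on_diff: "C1_on S (\<lambda>x. f x - g x)"
    and C1_on_mult: "C1_on S (\<lambda>x. f x * g x)"
    and gradient_add: "x \<in> S \<Longrightarrow> gradient (\<lambda>x. f x + g x) x = gradient f x + gradient g x"
    and gradient_diff: "x \<in> S \<Longrightarrow> gradient (\<lambda>x. f x - g x) x = gradient f x - gradient g x"
    and gradient_mult: "x \<in> S \<Longrightarrow> gradient (\<lambda>x. f x * g x) x = g x *\<^sub>R gradient f x + f x *\<^sub>R gradient g x"
proof -
  note d = C1_onD[OF assms(1)] C1_onD[OF assms(2)]
  note c = C1_on_continuous[OF assms(1)] C1_on_continuous[OF assms(2)]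
    C1_on_gradient[OF assms(1)] C1_on_gradient[OF assms(2)]
  have a: "((\<lambda>x. f x + g x) has_derivative (\<lambda>h. (gradient f x + gradient g x) \<bullet> h)) (at x)" if "x \<in> S" for x
    using has_derivative_add[OF d(1)[OF that] d(2)[OF that]] by (simp add: inner_add_left)
  have m: "((\<lambda>x. f x - g x) has_derivative (\<lambda>h. (gradient f x - gradient g x) \<bullet> h)) (at x)" if "x \<in> S" for x
    using has_derivative_diff[OF d(1)[OF that] d(2)[OF that]] by (simp add: inner_diff_left)
  have p: "((\<lambda>x. f x * g x) has_derivative (\<lambda>h. (g x *\<^sub>R gradient f x + f x *\<^sub>R gradient g x) \<bullet> h)) (at x)" if "x \<in> S" for x
    using has_derivative_mult[OF d(1)[OF that] d(2)[OF that]] by (simp add: inner_add_left algebra_simps)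
  show "C1_on S (\<lambda>x. f x + g x)"
    by (rule C1_onI[OF a]) (auto intro!: continuous_intros c)
  show "C1_on S (\<lambda>x. f x - g x)"
    by (rule C1_onI[OF m]) (auto intro!: continuous_intros c)
  show "C1_on S (\<lambda>x. f x * g x)"
    by (rule C1_onI[OF p]) (auto intro!: continuous_intros c)
  show "x \<in> S \<Longrightarrow> gradient (\<lambda>x. f x + g x) x = gradient f x + gradient g x"
    "x \<in> S \<Longrightarrow> gradient (\<lambda>x. f x - g x) x = gradient f x - gradient g x"
    "x \<in> S \<Longrightarrow> gradient (\<lambda>x. f x * g x) x = g x *\<^sub>R gradient f x + f x *\<^sub>R gradient g x"
    by (rule gradient_eqI[OF a] gradient_eqI[OF m] gradient_eqI[OF p], assumption)+
qed

lemma C1_on_compose: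
  assumes "C1_on S f" "\<And>x. x \<in> S \<Longrightarrow> (\<phi> has_real_derivative \<phi>' (f x)) (at (f x))"
    "continuous_on (f ` S) \<phi>'"
  shows "C1_on S (\<lambda>x. \<phi> (f x))"
    and "x \<in> S \<Longrightarrow> gradient (\<lambda>x. \<phi> (f x)) x = \<phi>' (f x) *\<^sub>R gradient f x"
proof -
  note d = has_derivative_inner_compose[OF C1_onD[OF assms(1)] assms(2)]
  have "continuous_on S (\<lambda>x. \<phi>' (f x))"
    using continuous_on_compose[OF C1_on_continuous[OF assms(1)] assms(3)] by (simp add: o_def)
  then show "C1_on S (\<lambda>x. \<phi> (f x))"
    by (intro C1_onI[OF d] continuous_intros C1_on_gradient[OF assms(1)])
  show "x \<in> S \<Longrightarrow> gradient (\<lambda>x. \<phi> (f x)) x = \<phi>' (f x) *\<^sub>R gradient f x"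
    by (rule gradient_eqI[OF d])
qed

lemma C1_on_divide:
  assumes "C1_on S f" "C1_on S g" "\<And>x. x \<in> S \<Longrightarrow> g x \<noteq> 0"
  shows "C1_on S (\<lambda>x. f x / g x)"
proof -
  have "C1_on S (\<lambda>x. inverse (g x))"
  proof (rule C1_on_compose(1)[OF assms(2), where \<phi> = inverse and \<phi>' = "\<lambda>t. - inverse (t ^ Suc (Suc 0))"])
    show "(inverse has_real_derivative - inverse (g x ^ Suc (Suc 0))) (at (g x))" if "x \<in> S" for x
      using DERIV_inverse[OF assms(3)[OF that]] by (simp add: power2_eq_square)
    show "continuous_on (g ` S) (\<lambda>t. - inverse (t ^ Suc (Suc 0)))"
      by (intro continuous_intros) (use assms(3) in auto)
  qed
  then show ?thesis using C1_on_mult[OF assms(1)] by (simp add: divide_inverse)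
qed

lemma C1_on_sum:
  assumes "\<And>i. i \<in> I \<Longrightarrow> C1_on S (f i)"
  shows "C1_on S (\<lambda>x. \<Sum>i\<in>I. f i x)"
  using assms by (induction I rule: infinite_finite_induct) (auto intro!: C1_on_add)

lemma smooth_on_C1: "smooth_on S f \<Longrightarrow> C1_on S f"
proof -
  assume "smooth_on S f"
  then have "Ck_on (Suc 0) S f" by (simp add: smooth_on_def del: Ck_on.simps)
  then show ?thesis
    unfolding C1_on_def gradient_def by (auto intro!: continuous_intros)
qed

lemma smooth_on_partial_deriv: "smooth_on S f \<Longrightarrow> b \<in> Basis \<Longrightarrow> smooth_on S (partial_deriv b f)"
  unfolding smooth_on_def
proof
  fix k assume "\<forall>k. Ck_on k S f" and b: "b \<in> Basis"
  then have "Ck_on (Suc k) S f" by blast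
  then show "Ck_on k S (partial_deriv b f)" using b by simp
qed

text \<open>
  The square of the positive part is the building block of all cutoff functions below: it has
  a continuous derivative and is constant on a half-line.
\<close>
lemma DERIV_max_square: "((\<lambda>t::real. (max 0 t)\<^sup>2) has_real_derivative 2 * max 0 s) (at s)"
proof (cases "s = 0")
  case True
  have "((\<lambda>h::real. max 0 h) \<longlongrightarrow> max 0 0) (at 0)"
    by (intro tendsto_max tendsto_const tendsto_ident_at)
  then have "((\<lambda>h::real. ((max 0 (0 + h))\<^sup>2 - (max 0 0)\<^sup>2) / h) \<longlongrightarrow> 0) (at 0)"
    by (rule Lim_transform_eventually[THEN tendsto_eq_rhs])
       (auto simp: eventually_at_filter max_def power2_eq_square)
  then show ?thesis using True by (simp add: DERIV_def)
next
  case False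
  then consider "s > 0" | "s < 0" by linarith
  then show ?thesis
  proof cases
    case 1
    have "((\<lambda>t::real. t\<^sup>2) has_real_derivative 2 * s) (at s)"
      by (auto intro!: derivative_eq_intros)
    then have "((\<lambda>t::real. (max 0 t)\<^sup>2) has_real_derivative 2 * s) (at s)"
      by (rule has_field_derivative_transform_within_open[where S = "{0<..}"]) (use 1 in auto)
    then show ?thesis using 1 by simp
  next
    case 2
    have "((\<lambda>t::real. 0) has_real_derivative 0) (at s)" by simp
    then have "((\<lambda>t::real. (max 0 t)\<^sup>2) has_real_derivative 0) (at s)"
      by (rule has_field_derivative_transform_within_open[where S = "{..<0}"]) (use 2 in auto)
    then show ?thesis using 2 by simp
  qed
qed

lemma C1_on_max_square:
  assumes "C1_on S f" shows "C1_on S (\<lambda>x. (max 0 (f x))\<^sup>2)"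
  by (rule C1_on_compose(1)[OF assms, where \<phi> = "\<lambda>t. (max 0 t)\<^sup>2" and \<phi>' = "\<lambda>t. 2 * max 0 t"])
     (auto intro!: DERIV_max_square continuous_intros)

text \<open>
  The quotient \<open>f / (f + g)\<close> works, where \<open>f\<close> and \<open>g\<close> are squared positive parts of
  \<open>R\<^sup>2 - |x - p|\<^sup>2\<close> and \<open>|x - p|\<^sup>2 - r\<^sup>2\<close>: they never vanish together.
\<close>
lemma ex_bump:
  fixes p :: "'a::euclidean_space"
  assumes "0 < r" "r < R"
  obtains \<psi> where "C1_on UNIV \<psi>" "\<And>x. x \<in> cball p r \<Longrightarrow> \<psi> x = 1"
    "\<And>x. x \<notin> cball p R \<Longrightarrow> \<psi> x = 0" "\<And>x. 0 \<le> \<psi> x"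
proof -
  define q where "q = (\<lambda>x. (x - p) \<bullet> (x - p))"
  have q: "C1_on UNIV q"
  proof (rule C1_onI[where g = "\<lambda>x. 2 *\<^sub>R (x - p)"])
    fix x
    have "((\<lambda>x. x - p) has_derivative (\<lambda>h. h)) (at x)"
      by (auto intro: derivative_eq_intros)
    from has_derivative_inner[OF this this]
    show "(q has_derivative (\<lambda>h. (2 *\<^sub>R (x - p)) \<bullet> h)) (at x)"
      unfolding q_def by (simp add: inner_commute[of _ "x - p"])
  qed (intro continuous_intros)
  define f where "f x = (max 0 (R\<^sup>2 - q x))\<^sup>2" for x
  define g where "g x = (max 0 (q x - r\<^sup>2))\<^sup>2" for x
  have f: "C1_on UNIV f" and g: "C1_on UNIV g"
    unfolding f_def g_def by (intro C1_on_max_square C1_on_diff C1_on_const q)+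
  have rR: "r\<^sup>2 < R\<^sup>2" using assms by (simp add: power_strict_mono)
  have pos: "f x + g x > 0" for x
  proof (cases "q x < R\<^sup>2")
    case True then have "f x > 0" by (simp add: f_def)
    moreover have "g x \<ge> 0" by (simp add: g_def)
    ultimately show ?thesis by simp
  next
    case False then have "g x > 0" using rR by (simp add: g_def)
    moreover have "f x \<ge> 0" by (simp add: f_def)
    ultimately show ?thesis by simp
  qed
  have qn: "q x = (dist p x)\<^sup>2" for x
    unfolding q_def dist_norm norm_minus_commute[of p x] power2_norm_eq_inner ..
  show thesis
  proof (rule that[of "\<lambda>x. f x / (f x + g x)"])
    show "C1_on UNIV (\<lambda>x. f x / (f x + g x))"
      by (intro C1_on_divide C1_on_add f g) (rule less_imp_neq[OF pos, symmetric])
    show "f x / (f x + g x) = 1" if "x \<in> cball p r" for x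
    proof -
      have "q x \<le> r\<^sup>2" using that power_mono[of "dist p x" r 2] unfolding qn by simp
      then have "g x = 0" by (simp add: g_def)
      then show ?thesis using pos[of x] by simp
    qed
    show "f x / (f x + g x) = 0" if "x \<notin> cball p R" for x
    proof -
      have "R\<^sup>2 \<le> q x" using that assms power_mono[of R "dist p x" 2] unfolding qn by simp
      then show ?thesis by (simp add: f_def)
    qed
    show "0 \<le> f x / (f x + g x)" for x
      using pos[of x] by (simp add: f_def)
  qed
qed

lemma C1_lipschitz_near:
  fixes f :: "'a::euclidean_space \<Rightarrow> real"
  assumes f: "C1_on UNIV f" and "bounded A"
  obtains L where "L \<ge> 0" "\<And>x y. x \<in> A \<Longrightarrow> dist x y \<le> d \<Longrightarrow> \<bar>f y - f x\<bar> \<le> L * dist x y"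
proof -
  obtain r where "\<forall>x\<in>A. norm x \<le> r"
    using assms(2) unfolding bounded_iff by (rule exE)
  then have r: "A \<subseteq> cball 0 r" by auto
  define C where "C = cball (0::'a) (r + \<bar>d\<bar>)"
  have "compact (gradient f ` C)"
    unfolding C_def
    by (rule compact_continuous_image[OF continuous_on_subset[OF C1_on_gradient[OF f]]]) auto
  then have "bounded (gradient f ` C)" by (rule compact_imp_bounded)
  then obtain L where L: "L > 0" "\<And>x. x \<in> C \<Longrightarrow> norm (gradient f x) \<le> L"
    unfolding bounded_pos by auto
  have AC: "A \<subseteq> C" unfolding C_def by (rule order_trans[OF r subset_cball]) simp
  have lip: "\<bar>f y - f x\<bar> \<le> L * dist x y" if "x \<in> A" "dist x y \<le> d" for x y
  proof -
    have xy: "x \<in> C" "y \<in> C"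
    proof -
      show "x \<in> C" using that AC by blast
      have "norm y \<le> norm x + dist x y" using dist_triangle[of 0 y x] by simp
      moreover have "norm x \<le> r" using that(1) r by auto
      ultimately show "y \<in> C" using that(2) unfolding C_def by simp
    qed
    have "norm (f y - f x) \<le> L * norm (y - x)"
    proof (rule differentiable_bound[where f' = "\<lambda>x h. gradient f x \<bullet> h" and S = C])
      show "convex C" by (simp add: C_def)
      show "(f has_derivative (\<lambda>h. gradient f x \<bullet> h)) (at x within C)" if "x \<in> C" for x
        by (rule has_derivative_at_withinI[OF C1_onD[OF f]]) simp
      show "onorm (\<lambda>h. gradient f x \<bullet> h) \<le> L" if "x \<in> C" for x
      proof (rule onorm_le)
        fix h
        have "norm (gradient f x \<bullet> h) \<le> norm (gradient f x) * norm h"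
          by (simp add: Cauchy_Schwarz_ineq2)
        also have "\<dots> \<le> L * norm h" using L that by (simp add: mult_right_mono)
        finally show "norm (gradient f x \<bullet> h) \<le> L * norm h" .
      qed
    qed (use xy in auto)
    then show ?thesis by (simp add: dist_norm norm_minus_commute)
  qed
  show thesis
  proof (rule that[of L])
    show "L \<ge> 0" using L(1) by simp
    show "\<bar>f y - f x\<bar> \<le> L * dist x y" if "x \<in> A" "dist x y \<le> d" for x y
      using lip that .
  qed
qed

lemma integrable_indicator_bounded_continuous:
  fixes f :: "'a::euclidean_space \<Rightarrow> real"
  assumes "continuous_on UNIV f" "bounded A" "A \<in> sets borel"
  shows "integrable lborel (\<lambda>x. indicator A x * f x)"
proof -
  obtain r where "\<forall>x\<in>A. norm x \<le> r"
    using assms(2) unfolding bounded_iff by (rule exE)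
  then have r: "A \<subseteq> cball 0 r" by auto
  have "integrable lborel (\<lambda>x. indicator (cball 0 r) x *\<^sub>R f x)"
    by (rule borel_integrable_compact) (auto intro: continuous_on_subset[OF assms(1)])
  then show ?thesis
  proof (rule Bochner_Integration.integrable_bound)
    show "(\<lambda>x. indicator A x * f x) \<in> borel_measurable lborel"
      using borel_measurable_continuous_onI[OF assms(1)] assms(3) by measurable
    show "AE x in lborel. norm (indicator A x * f x) \<le> norm (indicator (cball 0 r) x *\<^sub>R f x)"
      by (rule AE_I2) (use r in \<open>auto simp: indicator_def simp del: mem_cball\<close>)
  qed
qed


section \<open>Difference quotients under the integral\<close>

text \<open>
  Every integration by parts below goes back to this limit: the integral of a directional
  derivative is obtained from integrals of translates, which translation invariance evaluates.
  The quotients are dominated by a Lipschitz constant on the bounded set \<open>A\<close>.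
\<close>
lemma difference_quotient_integral:
  fixes f :: "'a::euclidean_space \<Rightarrow> real"
  assumes f: "C1_on UNIV f" and A: "bounded A" "A \<in> sets borel"
  shows "(\<lambda>n. LINT x|lborel. indicator A x * ((f (x + inverse (real (Suc n)) *\<^sub>R e) - f x) * real (Suc n)))
    \<longlonglongrightarrow> (LINT x|lborel. indicator A x * (gradient f x \<bullet> e))"
proof -
  have cf: "continuous_on UNIV f" "continuous_on UNIV (gradient f)"
    using f C1_on_continuous C1_on_gradient by blast+
  obtain L where L: "L \<ge> 0" "\<And>x y. x \<in> A \<Longrightarrow> dist x y \<le> norm e \<Longrightarrow> \<bar>f y - f x\<bar> \<le> L * dist x y"
    by (rule C1_lipschitz_near[OF f A(1), of "norm e"]) blast
  show ?thesis
  proof (rule integral_dominated_convergence[where w = "\<lambda>x. indicator A x * (L * norm e)"])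
    show "(\<lambda>x. indicator A x * (gradient f x \<bullet> e)) \<in> borel_measurable lborel"
      using borel_measurable_continuous_onI[OF cf(2)] A by measurable
    have [measurable]: "f \<in> borel_measurable borel" using borel_measurable_continuous_onI[OF cf(1)] .
    show "(\<lambda>x. indicator A x * ((f (x + inverse (real (Suc n)) *\<^sub>R e) - f x) * real (Suc n))) \<in> borel_measurable lborel" for n
      using A by measurable
    show "integrable lborel (\<lambda>x. indicator A x * (L * norm e))"
      by (rule integrable_indicator_bounded_continuous) (use A in auto)
    show "AE x in lborel. norm (indicator A x * ((f (x + inverse (real (Suc n)) *\<^sub>R e) - f x) * real (Suc n)))
       \<le> indicator A x * (L * norm e)" for n
    proof (rule AE_I2)
      fix x
      show "norm (indicator A x * ((f (x + inverse (real (Suc n)) *\<^sub>R e) - f x) * real (Suc n)))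
       \<le> indicator A x * (L * norm e)"
      proof (cases "x \<in> A")
        case True
        let ?y = "x + inverse (real (Suc n)) *\<^sub>R e"
        have d: "dist x ?y = inverse (real (Suc n)) * norm e" by (simp add: dist_norm)
        also have "\<dots> \<le> 1 * norm e" by (intro mult_right_mono) (auto simp: field_simps)
        finally have "\<bar>f ?y - f x\<bar> \<le> L * dist x ?y" using L(2) True by simp
        then have "\<bar>f ?y - f x\<bar> * real (Suc n) \<le> L * (inverse (real (Suc n)) * norm e) * real (Suc n)"
          unfolding d by (intro mult_right_mono) auto
        also have "\<dots> = L * norm e" by (simp add: field_simps)
        finally show ?thesis using True by (simp add: abs_mult)
      qed simp
    qed
    show "AE x in lborel. (\<lambda>n. indicator A x * ((f (x + inverse (real (Suc n)) *\<^sub>R e) - f x) * real (Suc n)))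
       \<longlonglongrightarrow> indicator A x * (gradient f x \<bullet> e)"
    proof (intro AE_I2 tendsto_mult tendsto_const)
      fix x
      have "((\<lambda>t::real. f (x + t *\<^sub>R e)) has_derivative (\<lambda>t. gradient f x \<bullet> (t *\<^sub>R e))) (at 0)"
      proof -
        have 1: "((\<lambda>t::real. x + t *\<^sub>R e) has_derivative (\<lambda>t. t *\<^sub>R e)) (at 0)"
          by (auto intro!: derivative_eq_intros)
        have "(f has_derivative (\<lambda>h. gradient f x \<bullet> h)) (at (x + 0 *\<^sub>R e))"
          using C1_onD[OF f, of x] by simp
        from has_derivative_compose[OF 1 this] show ?thesis .
      qed
      then have "((\<lambda>t::real. f (x + t *\<^sub>R e)) has_real_derivative (gradient f x \<bullet> e)) (at 0)"
        by (simp add: has_field_derivative_def mult.commute[of _ "gradient f x \<bullet> e"])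
      then have "((\<lambda>h. (f (x + h *\<^sub>R e) - f x) / h) \<longlongrightarrow> gradient f x \<bullet> e) (at 0)"
        by (simp add: DERIV_def)
      moreover have "filterlim (\<lambda>n. inverse (real (Suc n))) (at 0) sequentially"
        using LIMSEQ_inverse_real_of_nat by (auto simp: filterlim_at)
      ultimately have "(\<lambda>n. (f (x + inverse (real (Suc n)) *\<^sub>R e) - f x) / inverse (real (Suc n))) \<longlonglongrightarrow> gradient f x \<bullet> e"
        by (rule filterlim_compose)
      then show "(\<lambda>n. (f (x + inverse (real (Suc n)) *\<^sub>R e) - f x) * real (Suc n)) \<longlonglongrightarrow> gradient f x \<bullet> e"
        by (simp add: divide_inverse)
    qed
  qed
qed


section \<open>Hausdorff measure on Borel sets\<close>

abbreviation hausdorff_cost :: "nat \<Rightarrow> 'a::euclidean_space set \<Rightarrow> ennreal" where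
  "hausdorff_cost s C \<equiv> ennreal (unit_ball_vol (real s) * (diameter C / 2) ^ s)"

lemma hausdorff_premeasure_le:
  assumes "A \<subseteq> (\<Union>n. C n)" "\<And>n. bounded (C n)" "\<And>n. diameter (C n) \<le> \<delta>"
  shows "hausdorff_premeasure s \<delta> A \<le> (\<Sum>n. hausdorff_cost s (C n))"
  unfolding hausdorff_premeasure_def by (rule INF_lower) (use assms in simp)

lemma hausdorff_premeasure_mono:
  assumes "A \<subseteq> B" "\<delta>' \<le> \<delta>"
  shows "hausdorff_premeasure s \<delta> (A :: 'a::euclidean_space set) \<le> hausdorff_premeasure s \<delta>' B"
  unfolding hausdorff_premeasure_def
proof (rule INF_superset_mono)
  show "{C :: nat \<Rightarrow> 'a set. B \<subseteq> (\<Union>n. C n) \<and> (\<forall>n. bounded (C n) \<and> diameter (C n) \<le> \<delta>')}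
      \<subseteq> {C. A \<subseteq> (\<Union>n. C n) \<and> (\<forall>n. bounded (C n) \<and> diameter (C n) \<le> \<delta>)}"
    using order_trans[OF assms(1)] order_trans[OF _ assms(2)] by (intro Collect_mono) simp
qed simp

lemma hausdorff_outer_mono: "A \<subseteq> B \<Longrightarrow> hausdorff_outer s A \<le> hausdorff_outer s B"
  unfolding hausdorff_outer_def by (rule SUP_mono') (rule hausdorff_premeasure_mono, auto)

lemma hausdorff_premeasure_le_outer:
  "\<delta> > 0 \<Longrightarrow> hausdorff_premeasure s \<delta> A \<le> hausdorff_outer s A"
  unfolding hausdorff_outer_def by (rule SUP_upper) simp

lemma hausdorff_cost_empty: "s > 0 \<Longrightarrow> hausdorff_cost s {} = 0"
  by (simp only: diameter_empty div_0 zero_power mult_zero_right ennreal_0)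

lemma hausdorff_outer_empty:
  assumes "s > 0" shows "hausdorff_outer s ({} :: 'a::euclidean_space set) = 0"
proof -
  have "hausdorff_premeasure s \<delta> ({} :: 'a set) \<le> 0" if "\<delta> > 0" for \<delta> :: real
  proof -
    have "hausdorff_premeasure s \<delta> ({} :: 'a set) \<le> (\<Sum>n. hausdorff_cost s ({} :: 'a set))"
      by (rule hausdorff_premeasure_le) (use that in simp_all)
    also have "\<dots> = 0" by (simp only: hausdorff_cost_empty[OF assms] suminf_zero)
    finally show ?thesis .
  qed
  then have "hausdorff_outer s ({} :: 'a set) \<le> 0"
    unfolding hausdorff_outer_def by (intro SUP_least) (simp only: greaterThan_iff)
  then show ?thesis by (simp only: le_zero_eq)
qed

text \<open>
  Covers of the sets that are optimal up to \<open>e / 2\<^sup>n\<close> are merged into a single sequence.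
\<close>
lemma hausdorff_premeasure_UN_le:
  "hausdorff_premeasure s \<delta> (\<Union>n. A n) \<le> (\<Sum>n. hausdorff_premeasure s \<delta> (A n))"
    (is "_ \<le> (\<Sum>n. ?h (A n))")
proof (rule ennreal_le_epsilon)
  fix e :: real assume e: "0 < e" and fin: "(\<Sum>n. ?h (A n)) < top"
  have less: "?h (A n) < ?h (A n) + e * (1/2) ^ Suc n" for n
    using fin e by (auto simp: less_top dest!: ennreal_suminf_lessD)
  have "\<exists>C. A n \<subseteq> (\<Union>i. C i) \<and> (\<forall>i. bounded (C i) \<and> diameter (C i) \<le> \<delta>) \<and>
          (\<Sum>i. hausdorff_cost s (C i)) < ?h (A n) + e * (1/2) ^ Suc n" for n
    using less[of n] unfolding hausdorff_premeasure_def[of s \<delta> "A n"] INF_less_iff by auto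
  then obtain C where C: "\<And>n. A n \<subseteq> (\<Union>i. C n i)"
      "\<And>n i. bounded (C n i) \<and> diameter (C n i) \<le> \<delta>"
      "\<And>n. (\<Sum>i. hausdorff_cost s (C n i)) < ?h (A n) + e * (1/2) ^ Suc n"
    by metis
  define D where "D = case_prod C \<circ> prod_decode"
  have cover: "(\<Union>n. A n) \<subseteq> (\<Union>i. D i)"
  proof
    fix x assume "x \<in> (\<Union>n. A n)"
    then obtain n i where "x \<in> C n i" using C(1) by blast
    then have "x \<in> D (prod_encode (n, i))" by (simp add: D_def)
    then show "x \<in> (\<Union>i. D i)" by blast
  qed
  have "?h (\<Union>n. A n) \<le> (\<Sum>i. hausdorff_cost s (D i))"
    by (rule hausdorff_premeasure_le[OF cover]) (use C(2) in \<open>auto simp: D_def split: prod.split\<close>)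
  also have "\<dots> = (\<Sum>n. \<Sum>i. hausdorff_cost s (C n i))"
    unfolding D_def comp_def
    using suminf_ennreal_2dimen[of "\<lambda>n. \<Sum>i. hausdorff_cost s (C n i)" "\<lambda>p. hausdorff_cost s (case_prod C p)"]
    by simp
  also have "\<dots> \<le> (\<Sum>n. ?h (A n) + e * (1/2) ^ Suc n)"
    by (intro suminf_le summableI less_imp_le C(3))
  also have "\<dots> = (\<Sum>n. ?h (A n)) + (\<Sum>n. ennreal e * ennreal ((1/2) ^ Suc n))"
    using e by (subst suminf_add[symmetric])
      (auto simp del: ennreal_suminf_cmult simp add: ennreal_mult[symmetric])
  also have "\<dots> = (\<Sum>n. ?h (A n)) + e"
    unfolding ennreal_suminf_cmult
    by (subst suminf_ennreal_eq[OF zero_le_power power_half_series]) auto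
  finally show "?h (\<Union>n. A n) \<le> (\<Sum>n. ?h (A n)) + ennreal e" .
qed

lemma hausdorff_outer_UN_le:
  "hausdorff_outer s (\<Union>n::nat. A n) \<le> (\<Sum>n. hausdorff_outer s (A n))"
  unfolding hausdorff_outer_def[of s "\<Union>n. A n"]
proof (rule SUP_least)
  fix \<delta> :: real assume d: "\<delta> \<in> {0<..}"
  have "hausdorff_premeasure s \<delta> (\<Union>n. A n) \<le> (\<Sum>n. hausdorff_premeasure s \<delta> (A n))"
    by (rule hausdorff_premeasure_UN_le)
  also have "\<dots> \<le> (\<Sum>n. hausdorff_outer s (A n))"
    by (intro suminf_le summableI hausdorff_premeasure_le_outer) (use d in auto)
  finally show "hausdorff_premeasure s \<delta> (\<Union>n. A n) \<le> (\<Sum>n. hausdorff_outer s (A n))" .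
qed

lemma hausdorff_outer_Un_le:
  assumes "s > 0"
  shows "hausdorff_outer s (A \<union> B) \<le> hausdorff_outer s A + hausdorff_outer s B"
proof -
  let ?A = "\<lambda>n::nat. if n = 0 then A else if n = 1 then B else {}"
  have "A \<union> B = (\<Union>n. ?A n)"
  proof
    have "A = ?A 0" "B = ?A 1" by simp_all
    then show "A \<union> B \<subseteq> (\<Union>n. ?A n)" by blast
  qed (auto split: if_splits)
  then have "hausdorff_outer s (A \<union> B) \<le> (\<Sum>n. hausdorff_outer s (?A n))"
    using hausdorff_outer_UN_le[of s ?A] by simp
  also have "\<dots> = (\<Sum>n\<in>{0,1}. hausdorff_outer s (?A n))"
    by (rule suminf_finite) (simp_all add: hausdorff_outer_empty[OF assms])
  also have "\<dots> = hausdorff_outer s A + hausdorff_outer s B" by simp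
  finally show ?thesis .
qed

text \<open>
  A set of diameter less than \<open>d\<close> meets at most one of \<open>A\<close> and \<open>B\<close>, so a fine cover of the
  union splits into a cover of \<open>A\<close> and a cover of \<open>B\<close> without increasing the cost.
\<close>
lemma hausdorff_outer_separated:
  assumes "s > 0" "d > 0" and sep: "\<And>x y. x \<in> A \<Longrightarrow> y \<in> B \<Longrightarrow> d \<le> dist x y"
  shows "hausdorff_outer s A + hausdorff_outer s B \<le> hausdorff_outer s (A \<union> B)"
proof -
  have small: "hausdorff_premeasure s \<delta> A + hausdorff_premeasure s \<delta> B \<le> hausdorff_premeasure s \<delta> (A \<union> B)"
    if "\<delta> < d" for \<delta>
    unfolding hausdorff_premeasure_def[of s \<delta> "A \<union> B"]
  proof (rule INF_greatest, clarify)
    fix C :: "nat \<Rightarrow> 'a set"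
    assume C: "A \<union> B \<subseteq> (\<Union>n. C n)" and bd: "\<forall>n. bounded (C n) \<and> diameter (C n) \<le> \<delta>"
    define CA where "CA n = (if C n \<inter> A = {} then {} else C n)" for n
    define CB where "CB n = (if C n \<inter> B = {} then {} else C n)" for n
    have nn: "0 \<le> \<delta>" using bd diameter_ge_0 order_trans by blast
    have "hausdorff_premeasure s \<delta> A \<le> (\<Sum>n. hausdorff_cost s (CA n))"
    proof (rule hausdorff_premeasure_le)
      show "A \<subseteq> (\<Union>n. CA n)"
      proof
        fix x assume "x \<in> A"
        moreover then obtain n where "x \<in> C n" using C by blast
        ultimately have "x \<in> CA n" by (auto simp: CA_def)
        then show "x \<in> (\<Union>n. CA n)" by blast
      qed
    qed (use bd nn in \<open>auto simp: CA_def\<close>)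
    moreover have "hausdorff_premeasure s \<delta> B \<le> (\<Sum>n. hausdorff_cost s (CB n))"
    proof (rule hausdorff_premeasure_le)
      show "B \<subseteq> (\<Union>n. CB n)"
      proof
        fix x assume "x \<in> B"
        moreover then obtain n where "x \<in> C n" using C by blast
        ultimately have "x \<in> CB n" by (auto simp: CB_def)
        then show "x \<in> (\<Union>n. CB n)" by blast
      qed
    qed (use bd nn in \<open>auto simp: CB_def\<close>)
    ultimately have "hausdorff_premeasure s \<delta> A + hausdorff_premeasure s \<delta> B
        \<le> (\<Sum>n. hausdorff_cost s (CA n)) + (\<Sum>n. hausdorff_cost s (CB n))"
      by (rule add_mono)
    also have "\<dots> = (\<Sum>n. hausdorff_cost s (CA n) + hausdorff_cost s (CB n))"
      by (rule suminf_add) auto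
    also have "\<dots> \<le> (\<Sum>n. hausdorff_cost s (C n))"
    proof (intro suminf_le summableI)
      fix n
      have "C n \<inter> A = {} \<or> C n \<inter> B = {}"
      proof (rule ccontr)
        assume "\<not> ?thesis"
        then obtain x y where xy: "x \<in> C n" "x \<in> A" "y \<in> C n" "y \<in> B" by blast
        then have "dist x y \<le> diameter (C n)" using bd diameter_bounded_bound by blast
        then show False using sep[of x y] xy bd that by (smt (verit))
      qed
      then show "hausdorff_cost s (CA n) + hausdorff_cost s (CB n) \<le> hausdorff_cost s (C n)"
        by (auto simp only: CA_def CB_def hausdorff_cost_empty[OF assms(1)] add_0 add_0_right
            if_True if_False zero_le order_refl split: if_split)
    qed
    finally show "hausdorff_premeasure s \<delta> A + hausdorff_premeasure s \<delta> B \<le> (\<Sum>n. hausdorff_cost s (C n))" .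
  qed
  have pair: "hausdorff_premeasure s \<delta> A + hausdorff_premeasure s \<delta>' B \<le> hausdorff_outer s (A \<union> B)"
    if "\<delta> > 0" "\<delta>' > 0" for \<delta> \<delta>' :: real
  proof -
    let ?d = "min (min \<delta> \<delta>') (d / 2)"
    have "hausdorff_premeasure s \<delta> A + hausdorff_premeasure s \<delta>' B
        \<le> hausdorff_premeasure s ?d A + hausdorff_premeasure s ?d B"
      by (intro add_mono hausdorff_premeasure_mono) auto
    also have "\<dots> \<le> hausdorff_premeasure s ?d (A \<union> B)" using assms(2) by (intro small) auto
    also have "\<dots> \<le> hausdorff_outer s (A \<union> B)"
      using that assms(2) by (intro hausdorff_premeasure_le_outer) auto
    finally show ?thesis .
  qed
  have "hausdorff_outer s A + hausdorff_premeasure s \<delta>' B \<le> hausdorff_outer s (A \<union> B)"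
    if "\<delta>' > 0" for \<delta>' :: real
  proof -
    have "hausdorff_outer s A + hausdorff_premeasure s \<delta>' B
        = (SUP \<delta>\<in>{0<..}. hausdorff_premeasure s \<delta> A + hausdorff_premeasure s \<delta>' B)"
      unfolding hausdorff_outer_def by (rule ennreal_SUP_add_left[symmetric]) simp
    also have "\<dots> \<le> hausdorff_outer s (A \<union> B)"
      by (intro SUP_least pair that) simp
    finally show ?thesis .
  qed
  moreover have "hausdorff_outer s A + hausdorff_outer s B
      = (SUP \<delta>'\<in>{0<..}. hausdorff_outer s A + hausdorff_premeasure s \<delta>' B)"
    unfolding hausdorff_outer_def[of s B] by (rule ennreal_SUP_add_right) simp
  ultimately show ?thesis by (simp only:) (rule SUP_least, simp)
qed

lemma ennreal_suminf_tail_le: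
  fixes f :: "nat \<Rightarrow> ennreal"
  assumes "suminf f < top" "0 < (e::real)"
  obtains m where "(\<Sum>k. f (k + m)) \<le> ennreal e"
proof (cases "suminf f = 0")
  case True
  then have "(\<Sum>k. f (k + 0)) \<le> ennreal e" by simp
  then show thesis by (rule that)
next
  case False
  have "suminf f - ennreal e < suminf f"
    using False assms by (intro ennreal_between) (auto simp: zero_less_iff_neq_zero)
  then have "suminf f - ennreal e < (SUP n. \<Sum>i<n. f i)" by (simp add: suminf_eq_SUP)
  then obtain m where m: "suminf f - ennreal e < (\<Sum>i<m. f i)" by (auto simp: less_SUP_iff)
  have split: "suminf f = (\<Sum>i<m. f i) + (\<Sum>k. f (k + m))"
    using suminf_offset[of f m] by auto
  have fin: "(\<Sum>i<m. f i) < top" using assms(1) split by (metis ennreal_add_eq_top less_top)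
  have "suminf f \<le> (\<Sum>i<m. f i) + ennreal e"
    using less_imp_le[OF m] unfolding ennreal_minus_le_iff by (simp add: add.commute)
  then have "(\<Sum>i<m. f i) + (\<Sum>k. f (k + m)) \<le> (\<Sum>i<m. f i) + ennreal e" using split by simp
  then have "(\<Sum>k. f (k + m)) \<le> ennreal e"
    using less_imp_neq[OF fin] by (simp only: ennreal_add_left_cancel_le infinity_ennreal_def simp_thms)
  then show thesis by (rule that)
qed

text \<open>
  Caratheodory's criterion for closed sets. The part of \<open>A\<close> at distance at least \<open>r n\<close> from \<open>F\<close>
  is separated from \<open>F\<close>. What is missing from \<open>A - F\<close> lies in the shells \<open>R k\<close>. Shells whose
  indices differ by at least two are separated from each other, hence the measures of the even
  shells are summable, and likewise those of the odd ones, and their tails are small.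
\<close>
lemma hausdorff_outer_closed_split:
  fixes F A :: "'a::euclidean_space set"
  assumes s: "s > 0" and F: "closed F"
  shows "hausdorff_outer s (A \<inter> F) + hausdorff_outer s (A - F) \<le> hausdorff_outer s A"
proof (cases "F = {} \<or> hausdorff_outer s A = top")
  case True
  then show ?thesis using hausdorff_outer_empty[OF s] by (auto simp: top_unique)
next
  case False
  let ?H = "hausdorff_outer s :: 'a set \<Rightarrow> ennreal"
  define r where "r n = 1 / real (Suc n)" for n
  have r_less: "m < n \<Longrightarrow> r n < r m" for m n
    by (simp add: r_def frac_less2)
  have r_pos: "0 < r n" for n by (simp add: r_def)
  have infdist_le: "infdist x F \<le> infdist y F + dist x y" for x y
    using infdist_triangle by blast
  define R where "R k = {x \<in> A. r (Suc k) \<le> infdist x F \<and> infdist x F < r k}" for k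
  define A' where "A' n = {x \<in> A. r n \<le> infdist x F}" for n
  have partial: "(\<Sum>k<N. ?H (R (2 * k + j))) \<le> ?H (\<Union>k<N. R (2 * k + j))" for N j
  proof (induction N)
    case (Suc N)
    let ?U = "\<Union>k<N. R (2 * k + j)"
    have "(\<Sum>k<Suc N. ?H (R (2 * k + j))) \<le> ?H ?U + ?H (R (2 * N + j))"
      using Suc by (simp add: add_right_mono)
    also have "\<dots> \<le> ?H (?U \<union> R (2 * N + j))"
    proof (cases "N = 0")
      case True then show ?thesis by (simp add: hausdorff_outer_empty[OF s])
    next
      case False
      show ?thesis
      proof (rule hausdorff_outer_separated[OF s])
        show "0 < r (2 * N + j - 1) - r (2 * N + j)"
          using False r_less[of "2 * N + j - 1" "2 * N + j"] by simp
        fix x y assume "x \<in> ?U" and y: "y \<in> R (2 * N + j)"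
        then obtain k where k: "k < N" "x \<in> R (2 * k + j)" by blast
        then have "r (Suc (2 * k + j)) \<le> infdist x F" by (simp add: R_def)
        moreover have "r (2 * N + j - 1) \<le> r (Suc (2 * k + j))"
        proof (cases "Suc (2 * k + j) = 2 * N + j - 1")
          case ne: False
          have "Suc (2 * k + j) \<le> 2 * N + j - 1" using k(1) by linarith
          then show ?thesis using ne by (intro less_imp_le[OF r_less]) linarith
        qed simp
        moreover have "infdist y F < r (2 * N + j)" using y by (simp add: R_def)
        ultimately show "r (2 * N + j - 1) - r (2 * N + j) \<le> dist x y"
          using infdist_le[of x y] by linarith
      qed
    qed
    also have "?U \<union> R (2 * N + j) = (\<Union>k<Suc N. R (2 * k + j))"
      by (auto simp: lessThan_Suc)
    finally show ?case .
  qed simp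
  have finite_sum: "(\<Sum>k. ?H (R (2 * k + j))) < top" for j
  proof -
    have "(\<Sum>k<N. ?H (R (2 * k + j))) \<le> ?H A" for N
      by (rule order_trans[OF partial hausdorff_outer_mono]) (auto simp: R_def)
    then have "(\<Sum>k. ?H (R (2 * k + j))) \<le> ?H A"
      by (intro suminf_le_const summableI)
    moreover have "?H A < top" using False by (simp add: less_top)
    ultimately show ?thesis by (rule le_less_trans)
  qed
  show ?thesis
  proof (rule ennreal_le_epsilon)
    fix e :: real assume "0 < e"
    then have e2: "0 < e / 2" by simp
    \<comment> \<open>\<open>m0\<close> and \<open>m1\<close> cut off the tails of the even and the odd shells.\<close>
    obtain m0 where m0: "(\<Sum>k. ?H (R (2 * (k + m0) + 0))) \<le> ennreal (e / 2)"
      by (rule ennreal_suminf_tail_le[OF finite_sum e2])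
    obtain m1 where m1: "(\<Sum>k. ?H (R (2 * (k + m1) + 1))) \<le> ennreal (e / 2)"
      by (rule ennreal_suminf_tail_le[OF finite_sum e2])
    let ?n = "2 * max m0 m1"
    let ?U0 = "\<Union>k. R (2 * (k + m0) + 0)" and ?U1 = "\<Union>k. R (2 * (k + m1) + 1)"
    have "A - F \<subseteq> A' ?n \<union> (?U0 \<union> ?U1)"
    proof
      fix x assume x: "x \<in> A - F"
      then have pos: "0 < infdist x F"
        using False F by (intro infdist_pos_not_in_closed) auto
      show "x \<in> A' ?n \<union> (?U0 \<union> ?U1)"
      proof (cases "r ?n \<le> infdist x F")
        case True then show ?thesis using x by (simp add: A'_def)
      next
        case nle: False
        obtain N where "inverse (real (Suc N)) < infdist x F"
          using reals_Archimedean[OF pos] by (rule exE)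
        then have N: "r N \<le> infdist x F" by (simp add: r_def inverse_eq_divide)
        \<comment> \<open>The least index \<open>l\<close> places \<open>x\<close> in the shell with index \<open>l - 1\<close>.\<close>
        define l where "l = (LEAST l. r l \<le> infdist x F)"
        have l: "r l \<le> infdist x F" unfolding l_def by (rule LeastI[of "\<lambda>l. r l \<le> infdist x F", OF N])
        have lt: "?n < l"
        proof (rule ccontr)
          assume "\<not> ?n < l"
          then have "r ?n \<le> r l" using r_less[of l ?n] by (cases "l = ?n") auto
          then show False using nle l by linarith
        qed
        then obtain k where k: "l = Suc k" "?n \<le> k" by (cases l) auto
        have "infdist x F < r k" using not_less_Least[of k "\<lambda>l. r l \<le> infdist x F"] k(1)
          by (simp add: l_def[symmetric])
        then have xR: "x \<in> R k" using x l k(1) by (simp add: R_def)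
        show ?thesis
        proof (cases "even k")
          case True
          then have "k = 2 * ((k div 2 - m0) + m0) + 0" using k(2) by auto
          then have "x \<in> R (2 * ((k div 2 - m0) + m0) + 0)" using xR by (rule subst)
          then have "x \<in> ?U0" by blast
          then show ?thesis by blast
        next
          case odd: False
          then have "k = 2 * ((k div 2 - m1) + m1) + 1" using k(2) by (auto elim!: oddE)
          then have "x \<in> R (2 * ((k div 2 - m1) + m1) + 1)" using xR by (rule subst)
          then have "x \<in> ?U1" by blast
          then show ?thesis by blast
        qed
      qed
    qed
    then have "?H (A - F) \<le> ?H (A' ?n \<union> (?U0 \<union> ?U1))" by (rule hausdorff_outer_mono)
    also have "\<dots> \<le> ?H (A' ?n) + (?H ?U0 + ?H ?U1)"
      by (rule order_trans[OF hausdorff_outer_Un_le[OF s] add_left_mono[OF hausdorff_outer_Un_le[OF s]]])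
    also have "\<dots> \<le> ?H (A' ?n) + (ennreal (e / 2) + ennreal (e / 2))"
      by (intro add_mono order_refl order_trans[OF hausdorff_outer_UN_le m0]
          order_trans[OF hausdorff_outer_UN_le m1])
    also have "ennreal (e / 2) + ennreal (e / 2) = ennreal e"
      using e2 by (subst ennreal_plus[symmetric]) auto
    finally have "?H (A \<inter> F) + ?H (A - F) \<le> (?H (A \<inter> F) + ?H (A' ?n)) + ennreal e"
      by (simp add: add.assoc add_left_mono)
    also have "?H (A \<inter> F) + ?H (A' ?n) \<le> ?H (A \<inter> F \<union> A' ?n)"
    proof (rule hausdorff_outer_separated[OF s r_pos[of ?n]])
      fix x y assume "x \<in> A \<inter> F" "y \<in> A' ?n"
      then show "r ?n \<le> dist x y"
        using infdist_le[of y x] by (simp add: A'_def dist_commute)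
    qed
    also have "\<dots> \<le> ?H A" by (rule hausdorff_outer_mono) (auto simp: A'_def)
    finally show "?H (A \<inter> F) + ?H (A - F) \<le> ?H A + ennreal e" by (simp add: add_right_mono)
  qed
qed

text \<open>
  Without countable additivity on Borel sets \<open>measure_of\<close> would return the zero measure, so this is
  the point where the surface measure acquires its meaning.
\<close>
lemma
  assumes s: "s > 0"
  shows sets_hausdorff_measure [simp]: "sets (hausdorff_measure s :: 'a::euclidean_space measure) = sets borel"
    and space_hausdorff_measure [simp]: "space (hausdorff_measure s :: 'a measure) = UNIV"
    and emeasure_hausdorff_measure:
      "A \<in> sets borel \<Longrightarrow> emeasure (hausdorff_measure s) (A :: 'a set) = hausdorff_outer s A"
proof -
  let ?H = "hausdorff_outer s :: 'a set \<Rightarrow> ennreal"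
  have P: "sigma_algebra (UNIV :: 'a set) (Pow UNIV)" by (rule sigma_algebra_Pow)
  have "outer_measure_space (Pow UNIV) ?H"
    unfolding outer_measure_space_def positive_def increasing_def countably_subadditive_def
    by (intro conjI ballI allI impI hausdorff_outer_empty[OF s] hausdorff_outer_mono hausdorff_outer_UN_le)
  then have ms: "measure_space UNIV (lambda_system UNIV (Pow UNIV) ?H) ?H"
    by (rule sigma_algebra.caratheodory_lemma[OF P])
  have cl: "F \<in> lambda_system UNIV (Pow UNIV) ?H" if "closed F" for F
    unfolding lambda_system_def
  proof (intro CollectI conjI ballI antisym)
    show "F \<in> Pow UNIV" by simp
    fix X :: "'a set"
    have "?H (F \<inter> X) + ?H ((UNIV - F) \<inter> X) = ?H (X \<inter> F) + ?H (X - F)"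
      by (intro arg_cong2[where f = "(+)"] arg_cong[where f = ?H]) auto
    then show "?H (F \<inter> X) + ?H ((UNIV - F) \<inter> X) \<le> ?H X"
      using hausdorff_outer_closed_split[OF s that, of X] by simp
    have "?H X = ?H ((F \<inter> X) \<union> ((UNIV - F) \<inter> X))" by (rule arg_cong[where f = ?H]) auto
    then show "?H X \<le> ?H (F \<inter> X) + ?H ((UNIV - F) \<inter> X)"
      using hausdorff_outer_Un_le[OF s, of "F \<inter> X" "(UNIV - F) \<inter> X"] by simp
  qed
  have sa: "sigma_algebra UNIV (lambda_system UNIV (Pow UNIV) ?H)"
    using ms unfolding measure_space_def by simp
  have "sigma_sets UNIV (Collect closed) \<subseteq> lambda_system UNIV (Pow UNIV) ?H"
    by (rule sigma_algebra.sigma_sets_subset[OF sa]) (use cl in auto)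
  then have sub: "sets borel \<subseteq> lambda_system UNIV (Pow UNIV) ?H"
    by (simp add: borel_eq_closed)
  have sb: "sigma_algebra UNIV (sets (borel :: 'a measure))"
    using sets.sigma_algebra_axioms[of "borel :: 'a measure"] by simp
  have mb: "measure_space UNIV (sets borel) ?H"
    by (rule measure_down[OF ms sb sub])
  show "sets (hausdorff_measure s :: 'a measure) = sets borel"
    unfolding hausdorff_measure_def using sigma_algebra.sigma_sets_eq[OF sb] by simp
  show "space (hausdorff_measure s :: 'a measure) = UNIV"
    unfolding hausdorff_measure_def by (simp add: space_measure_of_conv)
  show "emeasure (hausdorff_measure s) A = ?H A" if "A \<in> sets borel"
    unfolding hausdorff_measure_def
    by (rule emeasure_measure_of_sigma) (use mb that in \<open>auto simp: measure_space_def\<close>)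
qed


section \<open>Volume of slabs over a set\<close>

definition slab :: "'a::euclidean_space set \<Rightarrow> real \<Rightarrow> 'a \<Rightarrow> 'a set" where
  "slab K t e = (\<lambda>(z, \<tau>). z + \<tau> *\<^sub>R e) ` (K \<times> {0..t})"

lemma compact_slab: "compact K \<Longrightarrow> compact (slab K t e)"
  unfolding slab_def
  by (intro compact_continuous_image compact_Times) (auto simp: split_def intro!: continuous_intros)

text \<open>
  A set of diameter \<open>d \<le> t\<close> sweeps out a part of a box with volume \<open>(2d)\<^sup>n\<^sup>-\<^sup>1 4t\<close>, while its Hausdorff
  cost is the volume of a ball of radius \<open>d/2\<close> in dimension \<open>n - 1\<close>.
\<close>
definition slab_const :: "'a::euclidean_space itself \<Rightarrow> real" where
  "slab_const _ = 4 * 4 ^ (DIM('a) - 1) / unit_ball_vol (real (DIM('a) - 1))"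

lemma slab_const_pos: "slab_const TYPE('a::euclidean_space) > 0"
  unfolding slab_const_def by simp

lemma emeasure_slab_piece_le:
  fixes C :: "'a::euclidean_space set"
  assumes e: "e \<in> Basis \<or> - e \<in> Basis" and t: "t > 0"
    and C: "bounded C" "diameter C \<le> t"
  obtains Q where "slab C t e \<subseteq> Q" "Q \<in> sets borel"
    "emeasure lborel Q \<le> ennreal (slab_const TYPE('a) * t) * hausdorff_cost (DIM('a) - 1) C"
proof (cases "C = {}")
  case True
  then have "slab C t e \<subseteq> {}" by (simp add: slab_def)
  then show thesis using that[of "{}"] by simp
next
  case False
  then obtain c where c: "c \<in> C" by blast
  define b where "b = (if e \<in> Basis then e else - e)"
  have b: "b \<in> Basis" "e = b \<or> e = - b" using e by (auto simp: b_def)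
  let ?d = "diameter C"
  have d0: "0 \<le> ?d" using C diameter_ge_0 by blast
  \<comment> \<open>The box is extended by \<open>t\<close> on both sides in the direction of \<open>b\<close>, which covers \<open>e = b\<close> and \<open>e = - b\<close>.\<close>
  define w where "w = ?d *\<^sub>R One + t *\<^sub>R b"
  have wb: "w \<bullet> i = ?d + (if i = b then t else 0)" if "i \<in> Basis" for i
    using that b by (auto simp: w_def inner_add_left inner_Basis)
  define Q where "Q = cbox (c - w) (c + w)"
  have sub: "slab C t e \<subseteq> Q"
  proof
    fix x assume "x \<in> slab C t e"
    then obtain z \<tau> where x: "x = z + \<tau> *\<^sub>R e" "z \<in> C" "0 \<le> \<tau>" "\<tau> \<le> t"
      by (auto simp: slab_def)
    have zc: "norm (z - c) \<le> ?d"
      using diameter_bounded_bound[OF C(1) x(2) c] by (simp add: dist_norm)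
    have "\<bar>(x - c) \<bullet> i\<bar> \<le> w \<bullet> i" if i: "i \<in> Basis" for i
    proof -
      have "\<bar>(z - c) \<bullet> i\<bar> \<le> ?d" using Basis_le_norm[OF i, of "z - c"] zc by linarith
      moreover have "\<bar>\<tau> * (e \<bullet> i)\<bar> \<le> (if i = b then t else 0)"
        using b i x by (auto simp: inner_Basis)
      moreover have "(x - c) \<bullet> i = (z - c) \<bullet> i + \<tau> * (e \<bullet> i)"
        by (simp add: x(1) inner_diff_left inner_add_left)
      ultimately show ?thesis unfolding wb[OF i] by linarith
    qed
    then show "x \<in> Q"
      unfolding Q_def mem_box by (auto simp: inner_diff_left inner_add_left abs_le_iff algebra_simps)
  qed
  have "emeasure lborel Q = ennreal (\<Prod>i\<in>Basis. (c + w - (c - w)) \<bullet> i)"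
  proof -
    have "\<forall>i\<in>Basis. (c - w) \<bullet> i \<le> (c + w) \<bullet> i"
      using wb d0 t by (auto simp: inner_diff_left inner_add_left)
    then show ?thesis unfolding Q_def emeasure_lborel_cbox_eq by simp
  qed
  also have "(\<Prod>i\<in>Basis. (c + w - (c - w)) \<bullet> i) = (\<Prod>i\<in>Basis. 2 * (?d + (if i = b then t else 0)))"
    by (intro prod.cong refl) (simp add: wb[symmetric] inner_diff_left inner_add_left)
  also have "\<dots> = 2 * (?d + t) * (2 * ?d) ^ (DIM('a) - 1)"
    using b(1) by (subst prod.remove[of _ b]) (auto simp: card_Diff_singleton)
  also have "\<dots> \<le> 4 * t * (2 * ?d) ^ (DIM('a) - 1)"
    using C(2) d0 by (intro mult_right_mono) auto
  also have "\<dots> = slab_const TYPE('a) * t * (unit_ball_vol (real (DIM('a) - 1)) * (?d / 2) ^ (DIM('a) - 1))"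
  proof -
    have "(2 * ?d) ^ (DIM('a) - 1) = (4 * (?d / 2)) ^ (DIM('a) - 1)" by simp
    also have "\<dots> = 4 ^ (DIM('a) - 1) * (?d / 2) ^ (DIM('a) - 1)" by (rule power_mult_distrib)
    finally have p: "(2 * ?d) ^ (DIM('a) - 1) = 4 ^ (DIM('a) - 1) * (?d / 2) ^ (DIM('a) - 1)" .
    have u: "0 < unit_ball_vol (real (DIM('a) - 1))"
      by (rule unit_ball_vol_pos) (rule of_nat_0_le_iff)
    have "4 * \<tau> * (p * q) = 4 * p / v * \<tau> * (v * q)" if "0 < v" for p q v \<tau> :: real
      using that by simp
    then show ?thesis unfolding p slab_const_def using u by blast
  qed
  finally have "emeasure lborel Q \<le> ennreal (slab_const TYPE('a) * t) * hausdorff_cost (DIM('a) - 1) C"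
    using slab_const_pos[where 'a='a] t d0 by (simp add: ennreal_mult[symmetric] ennreal_leI)
  then show thesis using that[of Q] sub by (simp add: Q_def)
qed

text \<open>
  It suffices to cover \<open>K\<close> by sets of diameter at most \<open>t\<close>: for these the height of the box is
  comparable with \<open>t\<close>, and Hausdorff premeasure at scale \<open>t\<close> is below Hausdorff measure.
\<close>
lemma emeasure_slab_le:
  fixes K S :: "'a::euclidean_space set"
  assumes e: "e \<in> Basis \<or> - e \<in> Basis" and t: "t > 0"
    and S: "S \<in> sets borel" "S \<subseteq> slab K t e"
  shows "emeasure lborel S \<le> ennreal (slab_const TYPE('a) * t) * hausdorff_outer (DIM('a) - 1) K"
proof -
  let ?\<kappa> = "ennreal (slab_const TYPE('a) * t)"
  have "emeasure lborel S \<le> ?\<kappa> * (\<Sum>n. hausdorff_cost (DIM('a) - 1) (C n))"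
    if C: "K \<subseteq> (\<Union>n. C n)" "\<And>n. bounded (C n) \<and> diameter (C n) \<le> t" for C :: "nat \<Rightarrow> 'a set"
  proof -
    have "\<exists>Q. slab (C n) t e \<subseteq> Q \<and> Q \<in> sets borel \<and>
        emeasure lborel Q \<le> ?\<kappa> * hausdorff_cost (DIM('a) - 1) (C n)" for n
      using emeasure_slab_piece_le[OF e t, of "C n"] C(2)[of n] by metis
    then obtain Q where Q: "\<And>n. slab (C n) t e \<subseteq> Q n" "\<And>n. Q n \<in> sets borel"
      "\<And>n. emeasure lborel (Q n) \<le> ?\<kappa> * hausdorff_cost (DIM('a) - 1) (C n)" by metis
    have "slab K t e \<subseteq> (\<Union>n. slab (C n) t e)" using C(1) by (fastforce simp: slab_def)
    then have "S \<subseteq> (\<Union>n. Q n)" using S(2) Q(1) by blast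
    then have "emeasure lborel S \<le> emeasure lborel (\<Union>n. Q n)"
      using Q(2) by (intro emeasure_mono) auto
    also have "\<dots> \<le> (\<Sum>n. emeasure lborel (Q n))"
      using Q(2) by (intro emeasure_subadditive_countably) auto
    also have "\<dots> \<le> (\<Sum>n. ?\<kappa> * hausdorff_cost (DIM('a) - 1) (C n))"
      by (intro suminf_le summableI Q(3))
    also have "\<dots> = ?\<kappa> * (\<Sum>n. hausdorff_cost (DIM('a) - 1) (C n))" by simp
    finally show ?thesis .
  qed
  \<comment> \<open>Dividing by the constant turns the bound for each cover into a bound for the infimum over covers.\<close>
  then have "emeasure lborel S / ?\<kappa> \<le> hausdorff_premeasure (DIM('a) - 1) t K"
    unfolding hausdorff_premeasure_def
    using slab_const_pos[where 'a='a] t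
    by (intro INF_greatest) (auto simp: divide_le_posI_ennreal mult.commute)
  also have "\<dots> \<le> hausdorff_outer (DIM('a) - 1) K"
    by (rule hausdorff_premeasure_le_outer[OF t])
  finally have "?\<kappa> * (emeasure lborel S / ?\<kappa>) \<le> ?\<kappa> * hausdorff_outer (DIM('a) - 1) K"
    by (rule mult_left_mono) simp
  moreover have "?\<kappa> * (emeasure lborel S / ?\<kappa>) = emeasure lborel S"
    using slab_const_pos[where 'a='a] t
    by (subst ennreal_times_divide, subst mult.commute, subst ennreal_mult_divide_eq) auto
  ultimately show ?thesis by simp
qed

text \<open>
  If every line in the direction \<open>e\<close> meets \<open>K\<close> at most once within distance \<open>t\<close>, the slab
  projects to \<open>K\<close>. The part of the slab above \<open>A\<close> is again a slab, so the image of
  Lebesgue measure is at most a multiple of \<open>t\<close> times Hausdorff measure on \<open>K\<close>, which carries over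
  from sets to integrals. For measurability of the projection it is enough that the preimage of a closed
  set is a slab over a compact set.
\<close>
lemma slab_projection:
  fixes K :: "'a::euclidean_space set"
  assumes dim: "DIM('a) \<ge> 2" and e: "e \<in> Basis \<or> - e \<in> Basis" and t: "t > 0"
    and K: "compact K"
    and uniq: "\<And>z \<tau>. z \<in> K \<Longrightarrow> z + \<tau> *\<^sub>R e \<in> K \<Longrightarrow> \<bar>\<tau>\<bar> \<le> t \<Longrightarrow> \<tau> = 0"
  shows "\<exists>P. P \<in> borel_measurable (restrict_space lborel (slab K t e)) \<and>
    (\<forall>x\<in>slab K t e. P x \<in> K \<and> dist x (P x) \<le> t) \<and>
    (\<forall>f\<in>borel_measurable borel.
      (\<integral>\<^sup>+x. f (P x) * indicator (slab K t e) x \<partial>lborel)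
        \<le> ennreal (slab_const TYPE('a) * t) *
            (\<integral>\<^sup>+x. f x * indicator K x \<partial>hausdorff_measure (DIM('a) - 1)))"
proof -
  let ?S = "slab K t e" and ?H = "hausdorff_measure (DIM('a) - 1) :: 'a measure"
  have s: "DIM('a) - 1 > 0" using dim by simp
  have ex: "\<exists>z\<in>K. \<exists>\<tau>. 0 \<le> \<tau> \<and> \<tau> \<le> t \<and> x = z + \<tau> *\<^sub>R e" if "x \<in> ?S" for x
    using that unfolding slab_def by fastforce
  then obtain P where P: "\<And>x. x \<in> ?S \<Longrightarrow> P x \<in> K"
      "\<And>x. x \<in> ?S \<Longrightarrow> \<exists>\<tau>. 0 \<le> \<tau> \<and> \<tau> \<le> t \<and> x = P x + \<tau> *\<^sub>R e" by metis
  have P_eq: "P x = z" if "x = z + \<tau> *\<^sub>R e" "z \<in> K" "0 \<le> \<tau>" "\<tau> \<le> t" for x z \<tau>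
  proof -
    have xS: "x \<in> ?S" unfolding slab_def using that by force
    obtain \<tau>' where t': "0 \<le> \<tau>'" "\<tau>' \<le> t" "x = P x + \<tau>' *\<^sub>R e" using P(2)[OF xS] by blast
    have Pz: "P x = z + (\<tau> - \<tau>') *\<^sub>R e"
      using t'(3) that(1) by (simp add: algebra_simps)
    moreover have "\<tau> - \<tau>' = 0"
      by (rule uniq[OF that(2)]) (use Pz P(1)[OF xS] t' that in auto)
    ultimately show ?thesis by simp
  qed
  have norm_e: "norm e = 1" using e norm_Basis[of e] norm_Basis[of "- e"] by auto
  have preimage: "P -` A \<inter> ?S = slab (A \<inter> K) t e" for A
  proof
    show "P -` A \<inter> ?S \<subseteq> slab (A \<inter> K) t e"
    proof
      fix x assume x: "x \<in> P -` A \<inter> ?S"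
      then obtain \<tau> where "0 \<le> \<tau>" "\<tau> \<le> t" "x = P x + \<tau> *\<^sub>R e" using P(2) by blast
      moreover have "P x \<in> A \<inter> K" using x P(1) by blast
      ultimately show "x \<in> slab (A \<inter> K) t e" unfolding slab_def by force
    qed
    show "slab (A \<inter> K) t e \<subseteq> P -` A \<inter> ?S"
      using P_eq by (fastforce simp: slab_def)
  qed
  have S: "?S \<in> sets borel" using compact_slab[OF K] by (rule borel_compact)
  let ?R = "restrict_space lborel ?S"
  have spR: "space ?R = ?S" by (simp add: space_restrict_space)
  have setsR: "A \<in> sets ?R" if "A \<in> sets borel" "A \<subseteq> ?S" for A
    using that S by (simp add: sets_restrict_space_iff)
  have Pm: "P \<in> borel_measurable ?R"
  proof (rule borel_measurableI)
    fix U :: "'a set" assume "open U"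
    have "P -` U \<inter> space ?R = ?S - (P -` (- U) \<inter> ?S)" unfolding spR by auto
    moreover have "compact (- U \<inter> K)"
      by (rule closed_Int_compact[OF closed_Compl[OF \<open>open U\<close>] K])
    then have "P -` (- U) \<inter> ?S \<in> sets borel"
      unfolding preimage by (intro borel_compact compact_slab)
    ultimately show "P -` U \<inter> space ?R \<in> sets ?R"
      using S by (intro setsR) auto
  qed
  show ?thesis
  proof (rule exI[of _ P], rule conjI[OF Pm], rule conjI; rule ballI)
    fix x assume x: "x \<in> ?S"
    show "P x \<in> K \<and> dist x (P x) \<le> t"
    proof -
      obtain \<tau> where "0 \<le> \<tau>" "\<tau> \<le> t" "x = P x + \<tau> *\<^sub>R e" using P(2)[OF x] by blast
      then have "x - P x = \<tau> *\<^sub>R e" by (simp add: algebra_simps)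
      then have "norm (x - P x) = \<tau>" using norm_e \<open>0 \<le> \<tau>\<close> by simp
      then show ?thesis using P(1)[OF x] \<open>\<tau> \<le> t\<close> by (simp add: dist_norm)
    qed
  next
    fix f :: "'a \<Rightarrow> ennreal" assume f: "f \<in> borel_measurable borel"
    have Kb: "K \<in> sets borel" using K by (rule borel_compact)
    have setsH: "sets ?H = sets borel" using s by (rule sets_hausdorff_measure)
    have indK: "indicator K \<in> borel_measurable ?H"
      using Kb by (subst measurable_cong_sets[OF setsH refl]) simp
    have fH: "f \<in> borel_measurable ?H"
      using f by (subst measurable_cong_sets[OF setsH refl])
    let ?N = "scale_measure (ennreal (slab_const TYPE('a) * t)) (density ?H (indicator K))"
    have setsN: "sets (distr ?R borel P) = sets ?N"
      by (simp only: sets_distr sets_scale_measure sets_density setsH)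
    have "distr ?R borel P \<le> ?N"
      unfolding le_measure[OF setsN]
    proof
      fix A assume "A \<in> sets (distr ?R borel P)"
      then have A: "A \<in> sets borel" by simp
      have m: "P -` A \<inter> ?S \<in> sets borel"
        using measurable_sets[OF Pm A] S unfolding spR by (simp add: sets_restrict_space_iff)
      have "emeasure (distr ?R borel P) A = emeasure lborel (P -` A \<inter> ?S)"
        using S by (subst emeasure_distr[OF Pm A]) (simp add: spR emeasure_restrict_space)
      also have "\<dots> \<le> ennreal (slab_const TYPE('a) * t) * hausdorff_outer (DIM('a) - 1) (A \<inter> K)"
        by (rule emeasure_slab_le[OF e t m]) (simp add: preimage)
      also have "hausdorff_outer (DIM('a) - 1) (A \<inter> K) = emeasure ?H (A \<inter> K)"
        using A Kb by (intro emeasure_hausdorff_measure[OF s, symmetric]) auto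
      also have "\<dots> = emeasure (density ?H (indicator K)) A"
        using A Kb emeasure_restricted[of K ?H A] unfolding setsH by (simp only: Int_commute)
      finally show "emeasure (distr ?R borel P) A \<le> emeasure ?N A" by simp
    qed
    then have "nn_integral (distr ?R borel P) f \<le> nn_integral ?N f"
      by (rule nn_integral_mono_measure[OF setsN])
    also have "\<dots> = ennreal (slab_const TYPE('a) * t) * (\<integral>\<^sup>+x. f x * indicator K x \<partial>?H)"
    proof -
      have "f \<in> borel_measurable (density ?H (indicator K))" using fH by simp
      from nn_integral_scale_measure[OF this]
      show ?thesis
        by (simp only: nn_integral_density[OF indK fH] mult.commute[of "indicator K _"])
    qed
    also have "nn_integral (distr ?R borel P) f = (\<integral>\<^sup>+x. f (P x) * indicator ?S x \<partial>lborel)"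
    proof -
      have "f \<in> borel_measurable (distr ?R borel P)" using f by simp
      from nn_integral_distr[OF Pm this] show ?thesis
        using S nn_integral_restrict_space[of ?S lborel "\<lambda>x. f (P x)"] by simp
    qed
    finally show "(\<integral>\<^sup>+x. f (P x) * indicator ?S x \<partial>lborel)
        \<le> ennreal (slab_const TYPE('a) * t) * (\<integral>\<^sup>+x. f x * indicator K x \<partial>?H)" .
  qed
qed


section \<open>Integrals of divergences\<close>

lemma lborel_integral_shift:
  fixes f :: "'a::euclidean_space \<Rightarrow> real"
  assumes "f \<in> borel_measurable borel"
  shows "(LINT x|lborel. f (x + c)) = (LINT x|lborel. f x)"
proof -
  have "(LINT x|lborel. f x) = (LINT x|distr lborel borel ((+) c). f x)"
    by (simp only: lborel_distr_plus)
  also have "\<dots> = (LINT x|lborel. f (c + x))"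
    by (rule integral_distr) (use assms in auto)
  finally show ?thesis by (simp only: add.commute)
qed

lemma integrable_compact_support:
  fixes f :: "'a::euclidean_space \<Rightarrow> real"
  assumes "continuous_on UNIV f" "\<And>x. x \<notin> cball p r \<Longrightarrow> f x = 0"
  shows "integrable lborel f"
proof -
  have "integrable lborel (\<lambda>x. indicator (cball p r) x * f x)"
    by (rule integrable_indicator_bounded_continuous[OF assms(1)]) auto
  moreover have "indicator (cball p r) x * f x = f x" for x
    using assms(2)[of x] by (cases "x \<in> cball p r") auto
  ultimately show ?thesis by (simp only:)
qed

lemma gradient_zero_outside_cball:
  assumes "\<And>x. x \<notin> cball p r \<Longrightarrow> f x = 0" "x \<notin> cball p r"
  shows "gradient f x = 0"
  by (rule gradient_zero_outside[of "cball p r"]) (use assms in auto)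

lemma inverse_Suc_bounds: "0 < inverse (real (Suc n))" "inverse (real (Suc n)) \<le> 1"
  by (auto simp: field_simps)

text \<open>
  The difference quotients have integral zero by translation invariance.
\<close>
lemma integral_gradient_compact_support:
  fixes f :: "'a::euclidean_space \<Rightarrow> real"
  assumes f: "C1_on UNIV f" and supp: "\<And>x. x \<notin> cball p r \<Longrightarrow> f x = 0"
  shows "(LINT x|lborel. gradient f x \<bullet> e) = 0"
proof -
  define A where "A = cball p (r + norm e)"
  have cf: "continuous_on UNIV f" by (rule C1_on_continuous[OF f])
  then have fm: "f \<in> borel_measurable borel" by (rule borel_measurable_continuous_onI)
  have int: "integrable lborel f" by (rule integrable_compact_support[OF cf supp])
  have inA: "f (x + t *\<^sub>R e) = 0" if "x \<notin> A" "0 \<le> t" "t \<le> 1" for x t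
  proof (rule supp)
    have "dist p x \<le> dist p (x + t *\<^sub>R e) + dist (x + t *\<^sub>R e) x" by (rule dist_triangle)
    also have "dist (x + t *\<^sub>R e) x = t * norm e" using that by (simp add: dist_norm)
    also have "\<dots> \<le> 1 * norm e" using that by (intro mult_right_mono) auto
    finally show "x + t *\<^sub>R e \<notin> cball p r" using that(1) by (simp add: A_def)
  qed
  have zero: "(LINT x|lborel. indicator A x * ((f (x + inverse (real (Suc n)) *\<^sub>R e) - f x) * real (Suc n))) = 0" for n
  proof -
    let ?t = "inverse (real (Suc n))"
    have "(LINT x|lborel. indicator A x * ((f (x + ?t *\<^sub>R e) - f x) * real (Suc n)))
        = (LINT x|lborel. (f (x + ?t *\<^sub>R e) - f x) * real (Suc n))"
    proof (rule Bochner_Integration.integral_cong[OF refl])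
      fix x
      show "indicator A x * ((f (x + ?t *\<^sub>R e) - f x) * real (Suc n)) = (f (x + ?t *\<^sub>R e) - f x) * real (Suc n)"
      proof (cases "x \<in> A")
        case False
        then have "f (x + ?t *\<^sub>R e) = 0" "f (x + 0 *\<^sub>R e) = 0"
          using inverse_Suc_bounds[of n] by (intro inA; simp)+
        then show ?thesis by simp
      qed simp
    qed
    also have "\<dots> = ((LINT x|lborel. f (x + ?t *\<^sub>R e)) - (LINT x|lborel. f x)) * real (Suc n)"
    proof -
      have "integrable lborel (\<lambda>x. f (x + ?t *\<^sub>R e))"
      proof (rule integrable_compact_support[of _ p "r + norm e"])
        show "continuous_on UNIV (\<lambda>x. f (x + ?t *\<^sub>R e))"
          by (rule continuous_on_compose2[OF cf]) (auto intro!: continuous_intros)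
        show "f (x + ?t *\<^sub>R e) = 0" if "x \<notin> cball p (r + norm e)" for x
          using inverse_Suc_bounds[of n] that by (intro inA) (simp_all add: A_def)
      qed
      then show ?thesis using int by simp
    qed
    also have "\<dots> = 0" by (simp only: lborel_integral_shift[OF fm]) simp
    finally show ?thesis .
  qed
  have "(\<lambda>n. LINT x|lborel. indicator A x * ((f (x + inverse (real (Suc n)) *\<^sub>R e) - f x) * real (Suc n)))
      \<longlonglongrightarrow> (LINT x|lborel. indicator A x * (gradient f x \<bullet> e))"
    by (rule difference_quotient_integral[OF f]) (auto simp: A_def)
  then have "(LINT x|lborel. indicator A x * (gradient f x \<bullet> e)) = 0"
    unfolding zero by (simp only: LIMSEQ_const_iff)
  moreover have "indicator A x * (gradient f x \<bullet> e) = gradient f x \<bullet> e" for x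
  proof (cases "x \<in> A")
    case False
    then have "x \<notin> cball p r" unfolding A_def by (auto simp: not_le intro: le_less_trans[of _ "r + norm e"])
    then have "gradient f x = 0" using gradient_zero_outside_cball[of p r f x] supp by blast
    then show ?thesis by simp
  qed simp
  ultimately show ?thesis by simp
qed

text \<open>
  A vector field is given by its components: \<open>X b\<close> is the component in the direction of the
  basis vector \<open>b\<close>.
\<close>
definition divergence :: "('a \<Rightarrow> 'a::euclidean_space \<Rightarrow> real) \<Rightarrow> 'a \<Rightarrow> real" where
  "divergence X x = (\<Sum>b\<in>Basis. gradient (X b) x \<bullet> b)"

lemma continuous_divergence:
  "(\<And>b. b \<in> Basis \<Longrightarrow> C1_on S (X b)) \<Longrightarrow> continuous_on S (divergence X)"
  unfolding divergence_def by (intro continuous_intros C1_on_gradient)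

lemma divergence_zero_outside:
  assumes "\<And>b x. b \<in> Basis \<Longrightarrow> x \<notin> cball p r \<Longrightarrow> X b x = 0" "x \<notin> cball p r"
  shows "divergence X x = 0"
  unfolding divergence_def
proof (rule sum.neutral, rule ballI)
  fix b :: 'a assume "b \<in> Basis"
  then show "gradient (X b) x \<bullet> b = 0"
    using gradient_zero_outside_cball[of p r "X b" x] assms by simp
qed

lemma integral_divergence_compact_support:
  assumes X: "\<And>b. b \<in> Basis \<Longrightarrow> C1_on UNIV (X b)"
    and supp: "\<And>b x. b \<in> Basis \<Longrightarrow> x \<notin> cball p r \<Longrightarrow> X b x = 0"
  shows "(LINT x|lborel. divergence X x) = 0"
proof -
  have "integrable lborel (\<lambda>x. gradient (X b) x \<bullet> b)" if b: "b \<in> Basis" for b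
  proof (rule integrable_compact_support[of _ p r])
    show "continuous_on UNIV (\<lambda>x. gradient (X b) x \<bullet> b)"
      by (intro continuous_intros C1_on_gradient X b)
    show "gradient (X b) x \<bullet> b = 0" if "x \<notin> cball p r" for x
      using gradient_zero_outside_cball[of p r "X b" x] supp[OF b] that by simp
  qed
  then have "(LINT x|lborel. divergence X x) = (\<Sum>b\<in>Basis. LINT x|lborel. gradient (X b) x \<bullet> b)"
    unfolding divergence_def by (rule Bochner_Integration.integral_sum)
  also have "\<dots> = 0"
    by (intro sum.neutral ballI integral_gradient_compact_support[OF X supp])
  finally show ?thesis .
qed

text \<open>
  The functions \<open>n m / (1 + n m)\<close>, with \<open>m\<close> the squared positive part of \<open>- \<rho>\<close>, approximate the
  indicator of the sublevel set. As functions of \<open>\<rho>\<close> they have gradients parallel to that of \<open>\<rho>\<close>.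
\<close>
lemma sublevel_cutoff:
  fixes \<rho> :: "'a::euclidean_space \<Rightarrow> real"
  assumes \<rho>: "C1_on W \<rho>"
  obtains \<phi> c where "\<And>n::nat. C1_on W (\<phi> n)"
    "\<And>n x. x \<in> W \<Longrightarrow> gradient (\<phi> n) x = c n x *\<^sub>R gradient \<rho> x"
    "\<And>n x. 0 \<le> \<phi> n x" "\<And>n x. \<phi> n x \<le> 1"
    "\<And>x. (\<lambda>n. \<phi> n x) \<longlonglongrightarrow> indicator {x. \<rho> x < 0} x"
proof -
  define m where "m t = (max 0 (- t))\<^sup>2" for t :: real
  have m0: "0 \<le> m t" for t by (simp add: m_def)
  have mC: "C1_on UNIV m"
  proof -
    have "C1_on UNIV (\<lambda>t::real. - t)"
      by (rule C1_onI[where g = "\<lambda>x. - 1"]) (auto intro!: derivative_eq_intros)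
    then show ?thesis unfolding m_def by (rule C1_on_max_square)
  qed
  define h where "h n t = real n * m t / (1 + real n * m t)" for n :: nat and t
  have pos: "1 + real n * m t > 0" for n t
    using m0[of t] by (intro add_pos_nonneg mult_nonneg_nonneg) auto
  have hC: "C1_on UNIV (h n)" for n
    unfolding h_def by (intro C1_on_divide C1_on_add C1_on_mult C1_on_const mC) (use pos less_imp_neq in metis)
  have hD: "(h n has_real_derivative gradient (h n) t) (at t)" for n t
    using C1_onD[OF hC, of t n] by (simp add: has_field_derivative_def mult.commute[of _ "gradient (h n) t"] inner_real_def)
  show thesis
  proof (rule that[of "\<lambda>n x. h n (\<rho> x)" "\<lambda>n x. gradient (h n) (\<rho> x)"])
    show "C1_on W (\<lambda>x. h n (\<rho> x))" for n
      by (rule C1_on_compose(1)[OF \<rho> hD]) (rule continuous_on_subset[OF C1_on_gradient[OF hC]], simp)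
    show "gradient (\<lambda>x. h n (\<rho> x)) x = gradient (h n) (\<rho> x) *\<^sub>R gradient \<rho> x" if "x \<in> W" for n x
      by (rule C1_on_compose(2)[OF \<rho> hD _ that]) (rule continuous_on_subset[OF C1_on_gradient[OF hC]], simp)
    show "0 \<le> h n (\<rho> x)" for n x
      unfolding h_def using m0 pos[THEN less_imp_le] by (intro divide_nonneg_nonneg mult_nonneg_nonneg) auto
    show "h n (\<rho> x) \<le> 1" for n x
      unfolding h_def using pos[of n "\<rho> x"] by (simp add: divide_le_eq)
    show "(\<lambda>n. h n (\<rho> x)) \<longlonglongrightarrow> indicator {x. \<rho> x < 0} x" for x
    proof (cases "\<rho> x < 0")
      case False
      then have "m (\<rho> x) = 0" by (simp add: m_def)
      then show ?thesis using False by (simp add: h_def)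
    next
      case True
      define a where "a = m (\<rho> x)"
      have a: "a > 0" using True by (simp add: a_def m_def)
      have "(\<lambda>n. 1 - 1 / (1 + real n * a)) \<longlonglongrightarrow> 1 - 0"
      proof (intro tendsto_diff tendsto_const)
        have "filterlim (\<lambda>n. real n * a) at_top sequentially"
          by (rule filterlim_at_top_mult_tendsto_pos[OF tendsto_const a filterlim_real_sequentially])
        then have "filterlim (\<lambda>n. 1 + real n * a) at_top sequentially"
          by (intro filterlim_tendsto_add_at_top[OF tendsto_const])
        then show "(\<lambda>n. 1 / (1 + real n * a)) \<longlonglongrightarrow> 0"
          by (intro tendsto_divide_0[OF tendsto_const] filterlim_at_top_imp_at_infinity)
      qed
      moreover have "1 - 1 / (1 + real n * a) = h n (\<rho> x)" for n
        unfolding h_def a_def[symmetric] using pos[of n "\<rho> x", folded a_def] by (simp add: field_simps)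
      ultimately show ?thesis using True by simp
    qed
  qed
qed

text \<open>
  Multiplying a tangential field by a function of \<open>\<rho>\<close> multiplies its divergence by that function,
  since the additional term contains \<open>T \<bullet> \<nabla>\<rho>\<close>. The product has compact support, so its divergence
  integrates to zero, and in the limit the function of \<open>\<rho>\<close> becomes the indicator of \<open>\<Omega>\<close>.
\<close>
lemma integral_divergence_tangential:
  fixes \<rho> :: "'a::euclidean_space \<Rightarrow> real"
  assumes W: "open W" "cball p r \<subseteq> W" and \<rho>: "C1_on W \<rho>"
    and \<Omega>: "\<Omega> \<in> sets borel" "\<Omega> \<inter> W = {x \<in> W. \<rho> x < 0}"
    and T: "\<And>b. b \<in> Basis \<Longrightarrow> C1_on UNIV (T b)"
    and supp: "\<And>b x. b \<in> Basis \<Longrightarrow> x \<notin> cball p r \<Longrightarrow> T b x = 0"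
    and tang: "\<And>x. x \<in> W \<Longrightarrow> (\<Sum>b\<in>Basis. T b x * (gradient \<rho> x \<bullet> b)) = 0"
  shows "(LINT x|lborel. indicator \<Omega> x * divergence T x) = 0"
proof -
  obtain \<phi> c where \<phi>: "\<And>n::nat. C1_on W (\<phi> n)"
    "\<And>n x. x \<in> W \<Longrightarrow> gradient (\<phi> n) x = c n x *\<^sub>R gradient \<rho> x"
    "\<And>n x. 0 \<le> \<phi> n x" "\<And>n x. \<phi> n x \<le> 1"
    "\<And>x. (\<lambda>n. \<phi> n x) \<longlonglongrightarrow> indicator {x. \<rho> x < 0} x"
    by (rule sublevel_cutoff[OF \<rho>]) blast
  define F where "F n b x = \<phi> n x * T b x" for n b x
  have TW: "C1_on W (T b)" if "b \<in> Basis" for b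
    by (rule C1_on_subset[OF T[OF that]]) simp
  have FW: "C1_on UNIV (F n b)" if b: "b \<in> Basis" for n b
  proof (rule C1_on_extend_zero[OF _ W(1) closed_cball W(2)])
    show "C1_on W (F n b)" unfolding F_def by (intro C1_on_mult \<phi> TW b)
    show "F n b x = 0" if "x \<notin> cball p r" for x unfolding F_def using supp[OF b that] by simp
  qed
  have Fsupp: "F n b x = 0" if "b \<in> Basis" "x \<notin> cball p r" for n b x
    unfolding F_def using supp[OF that] by simp
  have divT0: "divergence T x = 0" if "x \<notin> cball p r" for x
    by (rule divergence_zero_outside[OF supp that])
  have divF: "divergence (F n) x = \<phi> n x * divergence T x" for n x
  proof (cases "x \<in> W")
    case True
    have "divergence (F n) x = (\<Sum>b\<in>Basis. \<phi> n x * (gradient (T b) x \<bullet> b) + c n x * (T b x * (gradient \<rho> x \<bullet> b)))"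
      unfolding divergence_def
    proof (rule sum.cong[OF refl])
      fix b :: 'a assume b: "b \<in> Basis"
      show "gradient (F n b) x \<bullet> b = \<phi> n x * (gradient (T b) x \<bullet> b) + c n x * (T b x * (gradient \<rho> x \<bullet> b))"
        unfolding F_def gradient_mult[OF \<phi>(1) TW[OF b] True] \<phi>(2)[OF True]
        by (simp add: inner_add_left)
    qed
    also have "\<dots> = \<phi> n x * divergence T x + c n x * (\<Sum>b\<in>Basis. T b x * (gradient \<rho> x \<bullet> b))"
      unfolding divergence_def sum.distrib sum_distrib_left ..
    finally show ?thesis using tang[OF True] by simp
  next
    case False
    then have x: "x \<notin> cball p r" using W(2) by blast
    show ?thesis using divergence_zero_outside[OF Fsupp x] divT0[OF x] by simp
  qed
  have cT: "continuous_on UNIV (divergence T)" by (rule continuous_divergence[OF T])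
  have iT: "integrable lborel (divergence T)" by (rule integrable_compact_support[OF cT divT0])
  have mT: "divergence T \<in> borel_measurable borel" by (rule borel_measurable_continuous_onI[OF cT])
  have zero: "(LINT x|lborel. \<phi> n x * divergence T x) = 0" for n
    using integral_divergence_compact_support[of "F n", OF FW Fsupp] unfolding divF .
  have "(\<lambda>n. LINT x|lborel. \<phi> n x * divergence T x) \<longlonglongrightarrow> (LINT x|lborel. indicator \<Omega> x * divergence T x)"
  proof (rule integral_dominated_convergence[where w = "\<lambda>x. norm (divergence T x)"])
    show "(\<lambda>x. indicator \<Omega> x * divergence T x) \<in> borel_measurable lborel"
      using mT \<Omega>(1) by measurable
    show "(\<lambda>x. \<phi> n x * divergence T x) \<in> borel_measurable lborel" for n
    proof -
      have "continuous_on UNIV (divergence (F n))" by (rule continuous_divergence[OF FW])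
      then have "divergence (F n) \<in> borel_measurable borel" by (rule borel_measurable_continuous_onI)
      then show ?thesis unfolding divF[abs_def] by simp
    qed
    show "integrable lborel (\<lambda>x. norm (divergence T x))" using iT by simp
    show "AE x in lborel. norm (\<phi> n x * divergence T x) \<le> norm (divergence T x)" for n
      by (rule AE_I2) (use \<phi>(3,4) in \<open>simp add: abs_mult mult_left_le_one_le\<close>)
    show "AE x in lborel. (\<lambda>n. \<phi> n x * divergence T x) \<longlonglongrightarrow> indicator \<Omega> x * divergence T x"
    proof (rule AE_I2)
      fix x
      have "(\<lambda>n. \<phi> n x * divergence T x) \<longlonglongrightarrow> indicator {x. \<rho> x < 0} x * divergence T x"
        by (intro tendsto_mult tendsto_const \<phi>(5))
      moreover have "indicator {x. \<rho> x < 0} x * divergence T x = indicator \<Omega> x * divergence T x"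
      proof (cases "x \<in> W")
        case True
        then have "\<rho> x < 0 \<longleftrightarrow> x \<in> \<Omega>" using \<Omega>(2) by blast
        then show ?thesis by (simp add: indicator_def)
      next
        case False
        then have "divergence T x = 0" using W(2) divT0 by blast
        then show ?thesis by simp
      qed
      ultimately show "(\<lambda>n. \<phi> n x * divergence T x) \<longlonglongrightarrow> indicator \<Omega> x * divergence T x" by simp
    qed
  qed
  then show ?thesis unfolding zero by (simp only: LIMSEQ_const_iff)
qed


section \<open>The outward normal\<close>

lemma defining_function_frontier:
  assumes \<Omega>: "open \<Omega>" and ld: "local_defining_function \<Omega> p W \<rho>" and z: "z \<in> frontier \<Omega>" "z \<in> W"
  shows "\<rho> z = 0"
proof -
  have W: "open W" "\<Omega> \<inter> W = {x \<in> W. \<rho> x < 0}" and sm: "smooth_on W \<rho>"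
    using ld unfolding local_defining_function_def by blast+
  have c: "continuous_on W \<rho>" by (rule C1_on_continuous[OF smooth_on_C1[OF sm]])
  have zn: "z \<notin> \<Omega>" "z \<in> closure \<Omega>"
    using z(1) \<Omega> by (auto simp: frontier_def interior_open)
  then have "\<rho> z \<ge> 0" using W(2) z(2) by force
  moreover have "\<not> \<rho> z > 0"
  proof
    assume pos: "\<rho> z > 0"
    have "open (W \<inter> \<rho> -` {0<..})"
      by (rule continuous_open_preimage[OF c W(1)]) simp
    moreover have "z \<in> W \<inter> \<rho> -` {0<..}" using pos z(2) by simp
    ultimately have "\<Omega> \<inter> (W \<inter> \<rho> -` {0<..}) \<noteq> {}"
      using zn(2) open_Int_closure_eq_empty[of "W \<inter> \<rho> -` {0<..}" \<Omega>] by blast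
    then show False using W(2) by force
  qed
  ultimately show ?thesis by simp
qed

lemma has_derivative_along_line:
  assumes "(f has_derivative (\<lambda>h. g \<bullet> h)) (at (x + t *\<^sub>R v))"
  shows "((\<lambda>t::real. f (x + t *\<^sub>R v)) has_real_derivative (g \<bullet> v)) (at t)"
proof -
  have "((\<lambda>t::real. x + t *\<^sub>R v) has_derivative (\<lambda>t. t *\<^sub>R v)) (at t)"
    by (auto intro!: derivative_eq_intros)
  from has_derivative_compose[OF this assms]
  show ?thesis by (simp add: has_field_derivative_def mult.commute[of _ "g \<bullet> v"])
qed

text \<open>
  Both gradients are normal to the boundary: if the unit vectors \<open>a\<close> and \<open>b\<close> differed, moving from
  \<open>p\<close> in the direction \<open>b - a\<close> would decrease \<open>\<rho>1\<close> and increase \<open>\<rho>2\<close>, so points arbitrarily close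
  to \<open>p\<close> would be inside \<open>\<Omega>\<close> for one function and outside for the other.
\<close>
lemma normal_unique:
  assumes \<Omega>: "open \<Omega>" and p: "p \<in> frontier \<Omega>"
    and 1: "local_defining_function \<Omega> p W1 \<rho>1" and 2: "local_defining_function \<Omega> p W2 \<rho>2"
  shows "gradient \<rho>1 p /\<^sub>R norm (gradient \<rho>1 p) = gradient \<rho>2 p /\<^sub>R norm (gradient \<rho>2 p)"
proof (rule ccontr)
  define a where "a = gradient \<rho>1 p /\<^sub>R norm (gradient \<rho>1 p)"
  define b where "b = gradient \<rho>2 p /\<^sub>R norm (gradient \<rho>2 p)"
  have W1: "open W1" "p \<in> W1" "\<Omega> \<inter> W1 = {x \<in> W1. \<rho>1 x < 0}" "gradient \<rho>1 p \<noteq> 0" "C1_on W1 \<rho>1"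
    using 1 unfolding local_defining_function_def by (blast intro: smooth_on_C1)+
  have W2: "open W2" "p \<in> W2" "\<Omega> \<inter> W2 = {x \<in> W2. \<rho>2 x < 0}" "gradient \<rho>2 p \<noteq> 0" "C1_on W2 \<rho>2"
    using 2 unfolding local_defining_function_def by (blast intro: smooth_on_C1)+
  have n: "norm a = 1" "norm b = 1" using W1(4) W2(4) by (simp_all add: a_def b_def)
  assume "gradient \<rho>1 p /\<^sub>R norm (gradient \<rho>1 p) \<noteq> gradient \<rho>2 p /\<^sub>R norm (gradient \<rho>2 p)"
  then have "a - b \<noteq> 0" by (simp add: a_def b_def)
  then have "0 < (a - b) \<bullet> (a - b)" by simp
  also have "(a - b) \<bullet> (a - b) = a \<bullet> a + b \<bullet> b - 2 * (a \<bullet> b)"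
    by (simp add: inner_diff_left inner_diff_right inner_commute)
  also have "\<dots> = 2 - 2 * (a \<bullet> b)" using n by (simp add: norm_eq_1)
  finally have ab: "a \<bullet> b < 1" by simp
  \<comment> \<open>Since \<open>a \<bullet> b < 1\<close> for distinct unit vectors, this direction has a negative product with \<open>a\<close> and a positive one with \<open>b\<close>.\<close>
  define v where "v = b - a"
  have "a \<bullet> v < 0" "0 < b \<bullet> v"
    using ab n by (simp_all add: v_def inner_diff_right norm_eq_1 inner_commute)
  moreover have "gradient \<rho>1 p = norm (gradient \<rho>1 p) *\<^sub>R a" "gradient \<rho>2 p = norm (gradient \<rho>2 p) *\<^sub>R b"
    using W1(4) W2(4) by (simp_all add: a_def b_def)
  then have "gradient \<rho>1 p \<bullet> v = norm (gradient \<rho>1 p) * (a \<bullet> v)"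
    "gradient \<rho>2 p \<bullet> v = norm (gradient \<rho>2 p) * (b \<bullet> v)"
    by (metis inner_scaleR_left)+
  ultimately have s: "gradient \<rho>1 p \<bullet> v < 0" "0 < gradient \<rho>2 p \<bullet> v"
    using W1(4) W2(4) by (simp_all add: mult_pos_neg)
  have d1: "((\<lambda>t::real. \<rho>1 (p + t *\<^sub>R v)) has_real_derivative (gradient \<rho>1 p \<bullet> v)) (at 0)"
    by (rule has_derivative_along_line) (use C1_onD[OF W1(5,2)] in simp)
  have d2: "((\<lambda>t::real. \<rho>2 (p + t *\<^sub>R v)) has_real_derivative (gradient \<rho>2 p \<bullet> v)) (at 0)"
    by (rule has_derivative_along_line) (use C1_onD[OF W2(5,2)] in simp)
  have z: "\<rho>1 p = 0" "\<rho>2 p = 0"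
    using defining_function_frontier[OF \<Omega> 1 p W1(2)] defining_function_frontier[OF \<Omega> 2 p W2(2)] by auto
  obtain e1 where e1: "e1 > 0" "\<And>h. 0 < h \<Longrightarrow> h < e1 \<Longrightarrow> \<rho>1 (p + h *\<^sub>R v) < 0"
    using DERIV_neg_dec_right[OF d1 s(1)] z by auto
  obtain e2 where e2: "e2 > 0" "\<And>h. 0 < h \<Longrightarrow> h < e2 \<Longrightarrow> 0 < \<rho>2 (p + h *\<^sub>R v)"
    using DERIV_pos_inc_right[OF d2 s(2)] z by auto
  have "open (W1 \<inter> W2)" "p \<in> W1 \<inter> W2" using W1 W2 by auto
  then obtain e3 where e3: "e3 > 0" "ball p e3 \<subseteq> W1 \<inter> W2" by (meson openE)
  define q where "q = e3 / (norm v + 1)"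
  define h where "h = min (min e1 e2) q / 2"
  have nv: "0 < norm v + 1" using norm_ge_zero[of v] by linarith
  have "q > 0" using e3(1) nv by (simp add: q_def)
  then have h: "0 < h" "h < e1" "h < e2" "h < q"
    using e1(1) e2(1) unfolding h_def by auto
  have "h * norm v \<le> h * (norm v + 1)" using h by (intro mult_left_mono) auto
  also have "\<dots> < e3" using h(4) nv by (simp add: q_def pos_less_divide_eq)
  finally have "p + h *\<^sub>R v \<in> ball p e3" using h(1) by (simp add: dist_norm)
  then have "p + h *\<^sub>R v \<in> W1" "p + h *\<^sub>R v \<in> W2" using e3(2) by auto
  moreover have "p + h *\<^sub>R v \<in> \<Omega>" using W1(3) e1(2)[OF h(1,2)] calculation(1) by blast
  ultimately have "\<rho>2 (p + h *\<^sub>R v) < 0" using W2(3) by blast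
  then show False using e2(2)[OF h(1,3)] by linarith
qed

lemma outward_normal_eq:
  assumes \<Omega>: "open \<Omega>" and z: "z \<in> frontier \<Omega>" "z \<in> W" and ld: "local_defining_function \<Omega> p W \<rho>"
  shows "outward_normal \<Omega> z = gradient \<rho> z /\<^sub>R norm (gradient \<rho> z)"
proof -
  have lz: "local_defining_function \<Omega> z W \<rho>"
    using ld z(2) unfolding local_defining_function_def by blast
  show ?thesis unfolding outward_normal_def
  proof (rule some_equality)
    show "\<exists>W' \<rho>'. local_defining_function \<Omega> z W' \<rho>' \<and>
        gradient \<rho> z /\<^sub>R norm (gradient \<rho> z) = gradient \<rho>' z /\<^sub>R norm (gradient \<rho>' z)"
      using lz by blast
    show "\<nu> = gradient \<rho> z /\<^sub>R norm (gradient \<rho> z)"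
      if "\<exists>W' \<rho>'. local_defining_function \<Omega> z W' \<rho>' \<and> \<nu> = gradient \<rho>' z /\<^sub>R norm (gradient \<rho>' z)" for \<nu>
      using that normal_unique[OF \<Omega> z(1) _ lz] by blast
  qed
qed


section \<open>Flux through a smooth boundary\<close>

lemma
  fixes f :: "'a::euclidean_space \<Rightarrow> real"
  assumes \<Omega>: "\<Omega> \<in> sets borel" "bounded \<Omega>"
    and f: "continuous_on UNIV f" "\<And>x. x \<notin> cball p r \<Longrightarrow> f x = 0"
  shows integrable_shift_indicator: "integrable lborel (\<lambda>x. (indicator \<Omega> (x - v) - indicator \<Omega> x) * f x)"
    and integral_shift_indicator:
      "(LINT x|lborel. indicator \<Omega> x * (f (x + v) - f x))
        = (LINT x|lborel. (indicator \<Omega> (x - v) - indicator \<Omega> x) * f x)"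
proof -
  have fm: "f \<in> borel_measurable borel" by (rule borel_measurable_continuous_onI[OF f(1)])
  have if': "integrable lborel f" by (rule integrable_compact_support[OF f])
  have m: "(\<lambda>x. indicator \<Omega> (x - v) * f x) \<in> borel_measurable borel"
    using fm \<Omega>(1) by measurable
  have i1: "integrable lborel (\<lambda>x. indicator \<Omega> (x - v) * f x)"
    by (rule Bochner_Integration.integrable_bound[OF if']) (use m in \<open>auto simp: indicator_def\<close>)
  have i2: "integrable lborel (\<lambda>x. indicator \<Omega> x * f x)"
    by (rule integrable_indicator_bounded_continuous[OF f(1) \<Omega>(2,1)])
  have cv: "continuous_on UNIV (\<lambda>x. f (x + v))"
    by (rule continuous_on_compose2[OF f(1)]) (auto intro!: continuous_intros)
  have i3: "integrable lborel (\<lambda>x. indicator \<Omega> x * f (x + v))"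
    by (rule integrable_indicator_bounded_continuous[OF cv \<Omega>(2,1)])
  have e: "(LINT x|lborel. indicator \<Omega> x * f (x + v)) = (LINT x|lborel. indicator \<Omega> (x - v) * f x)"
    using lborel_integral_shift[OF m, of v] by simp
  show "integrable lborel (\<lambda>x. (indicator \<Omega> (x - v) - indicator \<Omega> x) * f x)"
    using i1 i2 by (simp add: left_diff_distrib)
  show "(LINT x|lborel. indicator \<Omega> x * (f (x + v) - f x))
        = (LINT x|lborel. (indicator \<Omega> (x - v) - indicator \<Omega> x) * f x)"
    unfolding left_diff_distrib right_diff_distrib
    using i1 i2 i3 e by simp
qed

text \<open>
  The function \<open>\<rho>\<close> increases in the direction \<open>e\<close>, so near \<open>p\<close> a translate of \<open>\<Omega>\<close> in the direction \<open>e\<close> contains \<open>\<Omega>\<close>,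
  and the difference of the two lies in the slab over the boundary. By the volume estimate the
  square of \<open>g\<close> over the slab is controlled by its square over the boundary. The parameter \<open>\<eta>\<close>
  converts the square back into \<open>|g|\<close> through \<open>|g| \<le> \<eta> + g\<^sup>2/\<eta>\<close>; the constant \<open>C\<close> bounds the
  volume of the slab divided by its thickness.
  The ball of radius \<open>6 r\<close> leaves room for all translates of the support that occur.
\<close>
lemma transversal_flux_bound:
  fixes \<rho> :: "'a::euclidean_space \<Rightarrow> real"
  assumes dim: "DIM('a) \<ge> 2" and e: "e \<in> Basis \<or> - e \<in> Basis"
    and \<Omega>: "open \<Omega>" "bounded \<Omega>" and r: "0 < r"
    and \<rho>: "\<And>x. x \<in> cball p (6 * r) \<Longrightarrow> (\<rho> has_derivative (\<lambda>h. gradient \<rho> x \<bullet> h)) (at x)"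
    and pos: "\<And>x. x \<in> cball p (6 * r) \<Longrightarrow> 0 < gradient \<rho> x \<bullet> e"
    and in\<Omega>: "\<And>x. x \<in> cball p (6 * r) \<Longrightarrow> x \<in> \<Omega> \<longleftrightarrow> \<rho> x < 0"
    and front: "\<And>z. z \<in> frontier \<Omega> \<Longrightarrow> z \<in> cball p (6 * r) \<Longrightarrow> \<rho> z = 0"
  shows "\<exists>C\<ge>0. \<forall>g \<eta> I. C1_on UNIV g \<longrightarrow> (\<forall>x. x \<notin> cball p r \<longrightarrow> g x = 0) \<longrightarrow> 0 < \<eta> \<longrightarrow> 0 \<le> I \<longrightarrow>
      (\<integral>\<^sup>+x. ennreal ((g x)\<^sup>2) * indicator (frontier \<Omega> \<inter> cball p (2 * r)) x
          \<partial>hausdorff_measure (DIM('a) - 1)) \<le> ennreal I \<longrightarrow>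
      \<bar>LINT x|lborel. indicator \<Omega> x * (gradient g x \<bullet> e)\<bar>
        \<le> C * \<eta> + slab_const TYPE('a) * I / \<eta>"
proof -
  let ?B = "cball p (6 * r)"
  define K where "K = frontier \<Omega> \<inter> cball p (2 * r)"
  have K: "compact K" unfolding K_def by (intro closed_Int_compact) auto
  have \<Omega>b: "\<Omega> \<in> sets borel" using \<Omega>(1) by simp
  have norm_e: "norm e = 1" using e norm_Basis[of e] norm_Basis[of "- e"] by auto
  have near: "x + t *\<^sub>R e \<in> cball p (a + b)" if "x \<in> cball p a" "\<bar>t\<bar> \<le> b" for x t a b
  proof -
    have "dist p (x + t *\<^sub>R e) \<le> dist p x + dist x (x + t *\<^sub>R e)" by (rule dist_triangle)
    moreover have "dist x (x + t *\<^sub>R e) = \<bar>t\<bar>" by (simp add: dist_norm norm_e)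
    ultimately show ?thesis using that by simp
  qed
  have mono: "\<rho> x < \<rho> (x + t *\<^sub>R e)" if "x \<in> ?B" "x + t *\<^sub>R e \<in> ?B" "0 < t" for x t
  proof -
    have "\<rho> (x + 0 *\<^sub>R e) < \<rho> (x + t *\<^sub>R e)"
    proof (rule DERIV_pos_imp_increasing[OF that(3)])
      fix u assume u: "0 \<le> u" "u \<le> t"
      have "(1 - u / t) *\<^sub>R x + (u / t) *\<^sub>R (x + t *\<^sub>R e) \<in> ?B"
        by (rule convexD_alt[OF convex_cball that(1,2)]) (use u that(3) in auto)
      moreover have "(1 - u / t) *\<^sub>R x + (u / t) *\<^sub>R (x + t *\<^sub>R e) = x + u *\<^sub>R e"
        using that(3) by (simp add: algebra_simps)
      ultimately have B: "x + u *\<^sub>R e \<in> ?B" by simp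
      show "\<exists>y. ((\<lambda>t. \<rho> (x + t *\<^sub>R e)) has_real_derivative y) (at u) \<and> 0 < y"
        using has_derivative_along_line[OF \<rho>[OF B]] pos[OF B] by blast
    qed
    then show ?thesis by simp
  qed
  have mono': "\<rho> (x - t *\<^sub>R e) < \<rho> x" if "x \<in> ?B" "x - t *\<^sub>R e \<in> ?B" "0 < t" for x t
    using mono[OF that(2) _ that(3)] that(1) by simp
  have KB: "z \<in> ?B" "\<rho> z = 0" "z \<in> cball p (2 * r)" if "z \<in> K" for z
  proof -
    show "z \<in> ?B" using that r unfolding K_def by auto
    then show "\<rho> z = 0" using that front unfolding K_def by blast
    show "z \<in> cball p (2 * r)" using that unfolding K_def by blast
  qed
  have uniq: "t = 0" if "z \<in> K" "z + t *\<^sub>R e \<in> K" for z t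
  proof (rule ccontr)
    assume "t \<noteq> 0"
    then consider "0 < t" | "0 < - t" by linarith
    then show False
    proof cases
      case 1
      then show False using mono[OF KB(1)[OF that(1)] KB(1)[OF that(2)]] KB(2)[OF that(1)] KB(2)[OF that(2)] by simp
    next
      case 2
      have "\<rho> (z + t *\<^sub>R e) < \<rho> (z + t *\<^sub>R e + (- t) *\<^sub>R e)"
        by (rule mono[OF KB(1)[OF that(2)] _ 2]) (use KB(1)[OF that(1)] in simp)
      then show False using KB(2)[OF that(1)] KB(2)[OF that(2)] by simp
    qed
  qed
  obtain \<psi> where \<psi>: "C1_on UNIV \<psi>" "\<And>x. x \<in> cball p (3 * r) \<Longrightarrow> \<psi> x = 1"
      "\<And>x. x \<notin> cball p (4 * r) \<Longrightarrow> \<psi> x = 0" "\<And>x. 0 \<le> \<psi> x"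
    by (rule ex_bump[of "3 * r" "4 * r" p]) (use r in auto)
  have c\<psi>: "continuous_on UNIV \<psi>" by (rule C1_on_continuous[OF \<psi>(1)])
  obtain L where L: "L \<ge> 0" "\<And>x y. x \<in> \<Omega> \<Longrightarrow> dist x y \<le> 2 * r \<Longrightarrow> \<bar>\<psi> y - \<psi> x\<bar> \<le> L * dist x y"
    by (rule C1_lipschitz_near[OF \<psi>(1) \<Omega>(2), of "2 * r"]) blast
  \<comment> \<open>The bump function \<open>\<psi>\<close> localises the translate by \<open>2 s\<close>: its difference quotient bounds the volume of the slab.\<close>
  define C where "C = 2 * L * measure lborel \<Omega>"
  have C0: "0 \<le> C" unfolding C_def using L(1) by simp
  have slab_measure: "emeasure lborel (slab K s e) \<le> ennreal (C * s)" if s: "0 < s" "s \<le> r" for s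
  proof -
    let ?S = "slab K s e" and ?v = "(2 * s) *\<^sub>R e"
    have cS: "compact ?S" by (rule compact_slab[OF K])
    have Sb: "?S \<in> sets borel" using cS by (rule borel_compact)
    have Sfin: "emeasure lborel ?S < \<infinity>" by (rule emeasure_lborel_cbox_finite[THEN le_less_trans[rotated]] emeasure_compact_finite[OF cS])
    \<comment> \<open>Points of the slab are outside \<open>\<Omega>\<close>, and moving them back by \<open>2 s\<close>, more than the thickness \<open>s\<close>, puts them into \<open>\<Omega>\<close>.\<close>
    have point: "indicator ?S x \<le> (indicator \<Omega> (x - ?v) - indicator \<Omega> x) * \<psi> x" for x
    proof (cases "x \<in> cball p (4 * r)")
      case False
      have "x \<notin> ?S"
      proof
        assume "x \<in> ?S"
        then obtain z t where z: "z \<in> K" "0 \<le> t" "t \<le> s" "x = z + t *\<^sub>R e" unfolding slab_def by auto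
        then have "x \<in> cball p (2 * r + s)" using near[OF KB(3)[OF z(1)], of t s] by simp
        then show False using False s by simp
      qed
      then show ?thesis using \<psi>(3)[OF False] by simp
    next
      case True
      have xB: "x \<in> ?B" using True r by simp
      have "x + (- (2 * s)) *\<^sub>R e \<in> cball p (4 * r + 2 * s)" by (rule near[OF True]) (use s in simp)
      then have xvB: "x - ?v \<in> ?B" using s by simp
      have lt: "\<rho> (x - ?v) < \<rho> x" by (rule mono'[OF xB xvB]) (use s in simp)
      show ?thesis
      proof (cases "x \<in> ?S")
        case False
        have "x \<in> \<Omega> \<Longrightarrow> x - ?v \<in> \<Omega>" using lt in\<Omega>[OF xB] in\<Omega>[OF xvB] by linarith
        then show ?thesis using False \<psi>(4)[of x] by (auto simp: indicator_def)
      next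
        case S: True
        then obtain z t where z: "z \<in> K" "0 \<le> t" "t \<le> s" "x = z + t *\<^sub>R e" unfolding slab_def by auto
        have "x \<in> cball p (2 * r + s)" unfolding z(4) by (rule near[OF KB(3)[OF z(1)]]) (use z in simp)
        then have "x \<in> cball p (3 * r)" using s by simp
        then have "\<psi> x = 1" by (rule \<psi>(2))
        moreover have "x \<notin> \<Omega>"
        proof (cases "t = 0")
          case True
          then show ?thesis using in\<Omega>[OF xB] KB(2)[OF z(1)] z(4) by simp
        next
          case False
          then have "\<rho> z < \<rho> x" using mono[OF KB(1)[OF z(1)], of t] z xB by simp
          then show ?thesis using in\<Omega>[OF xB] KB(2)[OF z(1)] by linarith
        qed
        moreover have "x - ?v \<in> \<Omega>"
        proof -
          have eq: "x - ?v = z - (2 * s - t) *\<^sub>R e" using z(4) by (simp add: algebra_simps)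
          have "\<rho> (z - (2 * s - t) *\<^sub>R e) < \<rho> z"
            using xvB z(3) s(1) unfolding eq by (intro mono'[OF KB(1)[OF z(1)]]) simp_all
          then show ?thesis using in\<Omega>[OF xvB] KB(2)[OF z(1)] eq by simp
        qed
        ultimately show ?thesis by simp
      qed
    qed
    have "measure lborel ?S = (LINT x|lborel. indicator ?S x)" using Sb by simp
    also have "\<dots> \<le> (LINT x|lborel. (indicator \<Omega> (x - ?v) - indicator \<Omega> x) * \<psi> x)"
    proof (rule integral_mono)
      show "integrable lborel (indicator ?S :: 'a \<Rightarrow> real)" using Sb Sfin by simp
      show "integrable lborel (\<lambda>x. (indicator \<Omega> (x - ?v) - indicator \<Omega> x) * \<psi> x)"
        by (rule integrable_shift_indicator[OF \<Omega>b \<Omega>(2) c\<psi> \<psi>(3)])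
    qed (rule point)
    also have "\<dots> = (LINT x|lborel. indicator \<Omega> x * (\<psi> (x + ?v) - \<psi> x))"
      by (rule integral_shift_indicator[OF \<Omega>b \<Omega>(2) c\<psi> \<psi>(3), symmetric])
    also have "\<dots> \<le> (LINT x|lborel. indicator \<Omega> x * (L * (2 * s)))"
    proof (rule integral_mono)
      show "integrable lborel (\<lambda>x. indicator \<Omega> x * (\<psi> (x + ?v) - \<psi> x))"
        by (rule integrable_indicator_bounded_continuous[OF _ \<Omega>(2) \<Omega>b])
           (intro continuous_intros continuous_on_compose2[OF c\<psi>], auto)
      show "integrable lborel (\<lambda>x. indicator \<Omega> x * (L * (2 * s)))"
        by (rule integrable_indicator_bounded_continuous[OF _ \<Omega>(2) \<Omega>b]) auto
      show "indicator \<Omega> x * (\<psi> (x + ?v) - \<psi> x) \<le> indicator \<Omega> x * (L * (2 * s))" for x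
      proof (cases "x \<in> \<Omega>")
        case True
        have d: "dist x (x + ?v) = 2 * s" using s norm_e by (simp add: dist_norm)
        have "\<bar>\<psi> (x + ?v) - \<psi> x\<bar> \<le> L * dist x (x + ?v)" by (rule L(2)[OF True]) (use d s in simp)
        then show ?thesis using True d by simp
      qed simp
    qed
    also have "\<dots> = C * s" using \<Omega>b by (simp add: C_def)
    finally have "measure lborel ?S \<le> C * s" .
    then show ?thesis using Sfin by (simp add: emeasure_eq_ennreal_measure less_top ennreal_leI)
  qed
  show ?thesis
  proof (intro exI[of _ C] conjI allI impI C0)
    fix g \<eta> I
    assume g: "C1_on UNIV g" and supp': "\<forall>x. x \<notin> cball p r \<longrightarrow> g x = 0"
      and \<eta>: "0 < (\<eta> :: real)" and I: "0 \<le> (I :: real)"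
      and bound: "(\<integral>\<^sup>+x. ennreal ((g x)\<^sup>2) * indicator (frontier \<Omega> \<inter> cball p (2 * r)) x
          \<partial>hausdorff_measure (DIM('a) - 1)) \<le> ennreal I"
    let ?\<kappa> = "slab_const TYPE('a)"
    have \<kappa>: "0 < ?\<kappa>" by (rule slab_const_pos)
    have supp: "g x = 0" if "x \<notin> cball p r" for x using supp' that by blast
    have cg: "continuous_on UNIV g" by (rule C1_on_continuous[OF g])
    obtain M where M: "M \<ge> 0" "\<And>x y. x \<in> cball p (3 * r) \<Longrightarrow> dist x y \<le> r \<Longrightarrow> \<bar>g y - g x\<bar> \<le> M * dist x y"
      by (rule C1_lipschitz_near[OF g bounded_cball, of p "3 * r" r]) blast
    have step: "\<bar>LINT x|lborel. indicator \<Omega> x * (g (x + s *\<^sub>R e) - g x)\<bar>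
        \<le> s * (C * (\<eta> + M * s) + ?\<kappa> * I / \<eta>)" if s: "0 < s" "s \<le> r" for s
    proof -
      let ?S = "slab K s e" and ?v = "s *\<^sub>R e"
      have Sb: "?S \<in> sets borel" using compact_slab[OF K] by (rule borel_compact)
      obtain P where P0: "P \<in> borel_measurable (restrict_space lborel ?S)"
        "\<forall>x\<in>?S. P x \<in> K \<and> dist x (P x) \<le> s"
        "\<forall>f\<in>borel_measurable borel.
          (\<integral>\<^sup>+x. f (P x) * indicator ?S x \<partial>lborel)
            \<le> ennreal (?\<kappa> * s) * (\<integral>\<^sup>+x. f x * indicator K x \<partial>hausdorff_measure (DIM('a) - 1))"
      proof (rule exE[OF slab_projection[OF dim e s(1) K]])
        show "t = 0" if "z \<in> K" "z + t *\<^sub>R e \<in> K" for z t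
          by (rule uniq[OF that])
      qed ((erule conjE)+, rule that)
      note P = P0(1) bspec[OF P0(2)] bspec[OF P0(3)]
      let ?u = "\<lambda>x. (indicator \<Omega> (x - ?v) - indicator \<Omega> x) * g x"
      \<comment> \<open>If the segment from \<open>x - s e\<close> to \<open>x\<close> leaves \<open>\<Omega>\<close>, it meets the boundary, and \<open>x\<close> lies in the slab above that point.\<close>
      have crossing: "x \<in> ?S" if "?u x \<noteq> 0" for x
      proof -
        have "g x \<noteq> 0" using that by auto
        then have xr: "x \<in> cball p r" using supp by blast
        have "x + (- s) *\<^sub>R e \<in> cball p (r + s)" by (rule near[OF xr]) (use s in simp)
        then have xvr: "x - ?v \<in> cball p (2 * r)" using s by simp
        have xr2: "x \<in> cball p (2 * r)" using xr r by simp
        have B: "x \<in> ?B" "x - ?v \<in> ?B" using xr xvr r by simp_all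
        have "\<rho> (x - ?v) < \<rho> x" by (rule mono'[OF B]) (use s in simp)
        then have imp: "x \<in> \<Omega> \<Longrightarrow> x - ?v \<in> \<Omega>" using in\<Omega>[OF B(1)] in\<Omega>[OF B(2)] by linarith
        have ne: "indicator \<Omega> (x - ?v) \<noteq> (indicator \<Omega> x :: real)" using that by auto
        then have "x \<notin> \<Omega>" "x - ?v \<in> \<Omega>"
          using imp by (cases "x \<in> \<Omega>"; cases "x - ?v \<in> \<Omega>"; simp)+
        then have "closed_segment (x - ?v) x \<inter> \<Omega> \<noteq> {}" "closed_segment (x - ?v) x - \<Omega> \<noteq> {}"
          using ends_in_segment[of "x - ?v" x] by blast+
        then have "closed_segment (x - ?v) x \<inter> frontier \<Omega> \<noteq> {}"
          by (rule connected_Int_frontier[OF connected_segment(1)])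
        then obtain z where z: "z \<in> closed_segment (x - ?v) x" "z \<in> frontier \<Omega>" by blast
        have "closed_segment (x - ?v) x \<subseteq> cball p (2 * r)"
          by (rule closed_segment_subset[OF xvr xr2 convex_cball])
        then have zK: "z \<in> K" using z unfolding K_def by blast
        obtain u where u: "0 \<le> u" "u \<le> 1" "z = (1 - u) *\<^sub>R (x - ?v) + u *\<^sub>R x"
          using z(1) unfolding in_segment by blast
        have x_eq: "x = z + ((1 - u) * s) *\<^sub>R e" unfolding u(3) by (simp add: algebra_simps)
        have "(1 - u) * s \<le> 1 * s" using u s by (intro mult_right_mono) auto
        then have "(1 - u) * s \<in> {0..s}" using u s by simp
        then have "(z, (1 - u) * s) \<in> K \<times> {0..s}" using zK by simp
        then show ?thesis unfolding slab_def by (rule rev_image_eqI) (simp only: split x_eq[symmetric])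
      qed
      have point: "ennreal (norm (?u x)) \<le> ennreal (\<eta> + M * s) * indicator ?S x
          + ennreal (1 / \<eta>) * (ennreal ((g (P x))\<^sup>2) * indicator ?S x)" for x
      proof (cases "x \<in> ?S")
        case False
        then have "?u x = 0" using crossing by blast
        then show ?thesis by (simp only:) simp
      next
        case True
        have P': "P x \<in> K" "dist x (P x) \<le> s" using P(2)[OF True] by auto
        have Pr: "P x \<in> cball p (3 * r)" using KB(3)[OF P'(1)] r by simp
        have "\<bar>g x - g (P x)\<bar> \<le> M * dist (P x) x"
          by (rule M(2)[OF Pr]) (use P'(2) s in \<open>simp add: dist_commute\<close>)
        also have "\<dots> \<le> M * s" using P'(2) M(1) by (intro mult_left_mono) (auto simp: dist_commute)
        finally have 1: "\<bar>g x\<bar> \<le> \<bar>g (P x)\<bar> + M * s" by linarith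
        have 2: "\<bar>g (P x)\<bar> \<le> \<eta> + (g (P x))\<^sup>2 / \<eta>"
        proof (cases "\<bar>g (P x)\<bar> \<le> \<eta>")
          case True
          moreover have "0 \<le> (g (P x))\<^sup>2 / \<eta>" using \<eta> by simp
          ultimately show ?thesis by linarith
        next
          case False
          then have "\<bar>g (P x)\<bar> * \<eta> \<le> \<bar>g (P x)\<bar> * \<bar>g (P x)\<bar>" by (intro mult_left_mono) auto
          then have "\<bar>g (P x)\<bar> \<le> (g (P x))\<^sup>2 / \<eta>" using \<eta>
            by (simp add: pos_le_divide_eq power2_eq_square abs_mult_self_eq)
          then show ?thesis using \<eta> by linarith
        qed
        have "\<bar>indicator \<Omega> (x - ?v) - indicator \<Omega> x :: real\<bar> \<le> 1" by (simp add: indicator_def)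
        then have "\<bar>indicator \<Omega> (x - ?v) - indicator \<Omega> x\<bar> * \<bar>g x\<bar> \<le> 1 * \<bar>g x\<bar>"
          by (rule mult_right_mono) simp
        then have "norm (?u x) \<le> \<bar>g x\<bar>" by (simp add: abs_mult)
        also have "\<dots> \<le> (\<eta> + M * s) + 1 / \<eta> * (g (P x))\<^sup>2" using 1 2 by simp
        finally have "ennreal (norm (?u x)) \<le> ennreal ((\<eta> + M * s) + 1 / \<eta> * (g (P x))\<^sup>2)"
          by (rule ennreal_leI)
        also have "\<dots> = ennreal (\<eta> + M * s) + ennreal (1 / \<eta>) * ennreal ((g (P x))\<^sup>2)"
        proof -
          have a: "0 \<le> \<eta> + M * s" "0 \<le> 1 / \<eta>" "0 \<le> (g (P x))\<^sup>2" using \<eta> M(1) s by auto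
          show ?thesis
            by (simp only: ennreal_plus[OF a(1) mult_nonneg_nonneg[OF a(2,3)]] ennreal_mult[OF a(2,3)])
        qed
        finally show ?thesis using True by simp
      qed
      have mP: "(\<lambda>x. ennreal ((g (P x))\<^sup>2) * indicator ?S x) \<in> borel_measurable lborel"
      proof -
        have "(\<lambda>x. ennreal ((g x)\<^sup>2)) \<in> borel_measurable borel"
          using borel_measurable_continuous_onI[OF cg] by measurable
        then have "(\<lambda>x. ennreal ((g (P x))\<^sup>2)) \<in> borel_measurable (restrict_space lborel ?S)"
          by (rule measurable_compose[OF P(1)])
        then show ?thesis using Sb by (subst (asm) borel_measurable_restrict_space_iff_ennreal) auto
      qed
      have iu: "integrable lborel ?u"
        by (rule integrable_shift_indicator[OF \<Omega>b \<Omega>(2) cg supp])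
      have "ennreal \<bar>LINT x|lborel. ?u x\<bar> \<le> (\<integral>\<^sup>+x. ennreal (norm (?u x)) \<partial>lborel)"
        using integral_norm_bound_ennreal[OF iu] by (simp only: real_norm_def)
      also have "\<dots> \<le> (\<integral>\<^sup>+x. ennreal (\<eta> + M * s) * indicator ?S x
          + ennreal (1 / \<eta>) * (ennreal ((g (P x))\<^sup>2) * indicator ?S x) \<partial>lborel)"
        by (intro nn_integral_mono point)
      also have "\<dots> = ennreal (\<eta> + M * s) * emeasure lborel ?S
          + ennreal (1 / \<eta>) * (\<integral>\<^sup>+x. ennreal ((g (P x))\<^sup>2) * indicator ?S x \<partial>lborel)"
        using Sb mP by (subst nn_integral_add) (auto simp: nn_integral_cmult nn_integral_cmult_indicator)
      also have "\<dots> \<le> ennreal (\<eta> + M * s) * ennreal (C * s) + ennreal (1 / \<eta>) * (ennreal (?\<kappa> * s) * ennreal I)"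
      proof (intro add_mono mult_left_mono slab_measure s)
        have "(\<integral>\<^sup>+x. ennreal ((g (P x))\<^sup>2) * indicator ?S x \<partial>lborel)
            \<le> ennreal (?\<kappa> * s) * (\<integral>\<^sup>+x. ennreal ((g x)\<^sup>2) * indicator K x \<partial>hausdorff_measure (DIM('a) - 1))"
          by (rule P(3)) (use borel_measurable_continuous_onI[OF cg] in measurable)
        also have "\<dots> \<le> ennreal (?\<kappa> * s) * ennreal I"
          using bound unfolding K_def by (intro mult_left_mono) auto
        finally show "(\<integral>\<^sup>+x. ennreal ((g (P x))\<^sup>2) * indicator ?S x \<partial>lborel) \<le> ennreal (?\<kappa> * s) * ennreal I" .
      qed auto
      also have "\<dots> = ennreal ((\<eta> + M * s) * (C * s) + 1 / \<eta> * (?\<kappa> * s * I))"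
      proof -
        have a: "0 \<le> \<eta> + M * s" "0 \<le> 1 / \<eta>" "0 \<le> C * s" "0 \<le> ?\<kappa> * s"
          using \<eta> M(1) s C0 \<kappa> by auto
        show ?thesis
          by (simp only: ennreal_plus[OF mult_nonneg_nonneg[OF a(1,3)] mult_nonneg_nonneg[OF a(2) mult_nonneg_nonneg[OF a(4) I]]]
              ennreal_mult[OF a(1,3)] ennreal_mult[OF a(2) mult_nonneg_nonneg[OF a(4) I]] ennreal_mult[OF a(4) I])
      qed
      finally have "\<bar>LINT x|lborel. ?u x\<bar> \<le> (\<eta> + M * s) * (C * s) + 1 / \<eta> * (?\<kappa> * s * I)"
        using \<eta> M(1) s C0 \<kappa> I by (subst (asm) ennreal_le_iff) auto
      also have "\<dots> = s * (C * (\<eta> + M * s) + ?\<kappa> * I / \<eta>)" by (simp add: algebra_simps)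
      finally have b: "\<bar>LINT x|lborel. ?u x\<bar> \<le> s * (C * (\<eta> + M * s) + ?\<kappa> * I / \<eta>)" .
      have "(LINT x|lborel. indicator \<Omega> x * (g (x + ?v) - g x)) = (LINT x|lborel. ?u x)"
        by (rule integral_shift_indicator[OF \<Omega>b \<Omega>(2) cg supp])
      with b show ?thesis by (simp only:)
    qed
    let ?q = "\<lambda>n. LINT x|lborel. indicator \<Omega> x * ((g (x + inverse (real (Suc n)) *\<^sub>R e) - g x) * real (Suc n))"
    have lim: "?q \<longlonglongrightarrow> (LINT x|lborel. indicator \<Omega> x * (gradient g x \<bullet> e))"
      by (rule difference_quotient_integral[OF g \<Omega>(2) \<Omega>b])
    have lim2: "(\<lambda>n. C * (\<eta> + M * inverse (real (Suc n))) + ?\<kappa> * I / \<eta>) \<longlonglongrightarrow> C * (\<eta> + M * 0) + ?\<kappa> * I / \<eta>"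
      by (intro tendsto_intros LIMSEQ_inverse_real_of_nat)
    have "eventually (\<lambda>n. inverse (real (Suc n)) < r) sequentially"
      using order_tendstoD(2)[OF LIMSEQ_inverse_real_of_nat r] .
    then have ev: "eventually (\<lambda>n. \<bar>?q n\<bar> \<le> C * (\<eta> + M * inverse (real (Suc n))) + ?\<kappa> * I / \<eta>) sequentially"
    proof (rule eventually_mono)
      fix n
      let ?s = "inverse (real (Suc n))"
      assume "?s < r"
      then have b: "\<bar>LINT x|lborel. indicator \<Omega> x * (g (x + ?s *\<^sub>R e) - g x)\<bar>
        \<le> ?s * (C * (\<eta> + M * ?s) + ?\<kappa> * I / \<eta>)"
        by (intro step) simp_all
      have "?q n = (LINT x|lborel. indicator \<Omega> x * (g (x + ?s *\<^sub>R e) - g x)) * real (Suc n)"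
        by (simp only: mult.assoc[symmetric] integral_mult_left_zero)
      then have "\<bar>?q n\<bar> = \<bar>LINT x|lborel. indicator \<Omega> x * (g (x + ?s *\<^sub>R e) - g x)\<bar> * real (Suc n)"
        by (simp only: abs_mult abs_of_nat)
      also have "\<dots> \<le> ?s * (C * (\<eta> + M * ?s) + ?\<kappa> * I / \<eta>) * real (Suc n)"
        by (rule mult_right_mono[OF b]) simp
      also have "\<dots> = C * (\<eta> + M * ?s) + ?\<kappa> * I / \<eta>"
      proof -
        have "?s * a * real (Suc n) = a" for a by (simp del: of_nat_Suc)
        then show ?thesis by blast
      qed
      finally show "\<bar>?q n\<bar> \<le> C * (\<eta> + M * ?s) + ?\<kappa> * I / \<eta>" .
    qed
    have "\<bar>LINT x|lborel. indicator \<Omega> x * (gradient g x \<bullet> e)\<bar> \<le> C * (\<eta> + M * 0) + ?\<kappa> * I / \<eta>"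
      by (rule tendsto_le[OF _ lim2 tendsto_rabs[OF lim] ev]) simp
    then show "\<bar>LINT x|lborel. indicator \<Omega> x * (gradient g x \<bullet> e)\<bar> \<le> C * \<eta> + ?\<kappa> * I / \<eta>" by simp
  qed
qed

text \<open>
  The integral of the divergence of \<open>\<phi> \<nabla>v\<close> over \<open>\<Omega>\<close>; by the divergence theorem it is the integral
  of \<open>\<phi>\<close> times the normal derivative of \<open>v\<close> over the boundary.
\<close>
definition weighted_flux :: "'a::euclidean_space set \<Rightarrow> ('a \<Rightarrow> real) \<Rightarrow> ('a \<Rightarrow> real) \<Rightarrow> real" where
  "weighted_flux \<Omega> v \<phi> = (LINT x|lborel. indicator \<Omega> x * divergence (\<lambda>b x. \<phi> x * partial_deriv b v x) x)"

definition normal_flux_sq :: "'a::euclidean_space set \<Rightarrow> ('a \<Rightarrow> real) \<Rightarrow> ennreal" where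
  "normal_flux_sq \<Omega> v = (\<integral>\<^sup>+ x. ennreal ((gradient v x \<bullet> outward_normal \<Omega> x)\<^sup>2) \<partial>surface_measure \<Omega>)"

lemma C1_on_weighted_gradient:
  assumes "C1_on UNIV \<phi>" "smooth_on UNIV v" "b \<in> Basis"
  shows "C1_on UNIV (\<lambda>x. \<phi> x * partial_deriv b v x)"
  by (intro C1_on_mult assms smooth_on_C1 smooth_on_partial_deriv)

lemma weighted_flux_interior:
  assumes "cball p r \<subseteq> \<Omega>" "C1_on UNIV \<phi>" "smooth_on UNIV v" "\<And>x. x \<notin> cball p r \<Longrightarrow> \<phi> x = 0"
  shows "weighted_flux \<Omega> v \<phi> = 0"
proof -
  let ?X = "\<lambda>b x. \<phi> x * partial_deriv b v x"
  have supp: "?X b x = 0" if "x \<notin> cball p r" for b x using assms(4)[OF that] by simp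
  have "indicator \<Omega> x * divergence ?X x = divergence ?X x" for x
  proof (cases "x \<in> \<Omega>")
    case False
    then have "x \<notin> cball p r" using assms(1) by blast
    then show ?thesis using divergence_zero_outside[of p r ?X x] supp by simp
  qed simp
  then have "weighted_flux \<Omega> v \<phi> = (LINT x|lborel. divergence ?X x)"
    unfolding weighted_flux_def by (simp only:)
  also have "\<dots> = 0"
    by (rule integral_divergence_compact_support[of _ p r])
       (use C1_on_weighted_gradient[OF assms(2,3)] supp in auto)
  finally show ?thesis .
qed

lemma weighted_flux_add:
  assumes \<Omega>: "open \<Omega>" "bounded \<Omega>" and v: "smooth_on UNIV v"
    and \<phi>: "C1_on UNIV \<phi>" "C1_on UNIV \<psi>"
  shows "weighted_flux \<Omega> v (\<lambda>x. \<phi> x + \<psi> x) = weighted_flux \<Omega> v \<phi> + weighted_flux \<Omega> v \<psi>"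
proof -
  let ?X = "\<lambda>b x. \<phi> x * partial_deriv b v x" and ?Y = "\<lambda>b x. \<psi> x * partial_deriv b v x"
  have X: "C1_on UNIV (?X b)" and Y: "C1_on UNIV (?Y b)" if "b \<in> Basis" for b
    using C1_on_weighted_gradient[OF _ v that] \<phi> by blast+
  have "divergence (\<lambda>b x. (\<phi> x + \<psi> x) * partial_deriv b v x) x = divergence ?X x + divergence ?Y x" for x
    unfolding divergence_def sum.distrib[symmetric]
  proof (rule sum.cong[OF refl])
    fix b :: 'a assume b: "b \<in> Basis"
    show "gradient (\<lambda>x. (\<phi> x + \<psi> x) * partial_deriv b v x) x \<bullet> b = gradient (?X b) x \<bullet> b + gradient (?Y b) x \<bullet> b"
      using gradient_add[OF X[OF b] Y[OF b], of x] by (simp add: distrib_right inner_add_left)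
  qed
  moreover have "integrable lborel (\<lambda>x. indicator \<Omega> x * divergence ?X x)"
    by (rule integrable_indicator_bounded_continuous[OF continuous_divergence[OF X] \<Omega>(2)]) (use \<Omega>(1) in auto)
  moreover have "integrable lborel (\<lambda>x. indicator \<Omega> x * divergence ?Y x)"
    by (rule integrable_indicator_bounded_continuous[OF continuous_divergence[OF Y] \<Omega>(2)]) (use \<Omega>(1) in auto)
  ultimately show ?thesis unfolding weighted_flux_def by (simp add: distrib_left)
qed

lemma weighted_flux_zero:
  assumes "open \<Omega>" "\<And>x. x \<in> \<Omega> \<Longrightarrow> \<phi> x = 0"
  shows "weighted_flux \<Omega> v \<phi> = 0"
proof -
  have "indicator \<Omega> x * divergence (\<lambda>b x. \<phi> x * partial_deriv b v x) x = 0" for x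
  proof (cases "x \<in> \<Omega>")
    case True
    have "gradient (\<lambda>x. \<phi> x * partial_deriv b v x) x = 0" for b
    proof -
      have "gradient (\<lambda>x. \<phi> x * partial_deriv b v x) x = gradient (\<lambda>x. 0) x"
        by (rule gradient_cong_open[OF assms(1) _ True]) (simp add: assms(2))
      also have "\<dots> = 0" by (rule gradient_eqI) simp
      finally show ?thesis .
    qed
    then show ?thesis by (simp add: divergence_def)
  qed simp
  then show ?thesis by (simp only: weighted_flux_def Bochner_Integration.integral_zero)
qed

text \<open>
  Near \<open>p\<close> the field \<open>\<phi> \<nabla>v\<close> is decomposed into a tangential part and \<open>g e\<close>. Comparing the
  products with \<open>\<nabla>\<rho>\<close> gives \<open>g = \<phi> (\<nabla>v \<bullet> \<nabla>\<rho>) / (\<nabla>\<rho> \<bullet> e)\<close>, which on the boundary is a bounded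
  multiple of the normal derivative of \<open>v\<close>, with a bound that depends on \<open>\<phi>\<close> but not on \<open>v\<close>.
\<close>
lemma weighted_flux_boundary:
  fixes \<Omega> :: "'a::euclidean_space set"
  assumes dim: "DIM('a) \<ge> 2" and \<Omega>: "smooth_bounded_domain \<Omega>" and p: "p \<in> frontier \<Omega>"
  shows "\<exists>r>0. \<forall>\<phi> v. C1_on UNIV \<phi> \<longrightarrow> (\<forall>x. x \<notin> cball p r \<longrightarrow> \<phi> x = 0) \<longrightarrow>
      (\<forall>k. smooth_on UNIV (v k)) \<longrightarrow> (\<lambda>k::nat. normal_flux_sq \<Omega> (v k)) \<longlonglongrightarrow> 0 \<longrightarrow>
      (\<lambda>k. weighted_flux \<Omega> (v k) \<phi>) \<longlonglongrightarrow> 0"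
proof -
  have op: "open \<Omega>" and bd: "bounded \<Omega>" using \<Omega> unfolding smooth_bounded_domain_def by blast+
  obtain W \<rho> where ld: "local_defining_function \<Omega> p W \<rho>"
    using \<Omega> p unfolding smooth_bounded_domain_def by blast
  then have W: "open W" "p \<in> W" "\<Omega> \<inter> W = {x \<in> W. \<rho> x < 0}" and sm: "smooth_on W \<rho>"
    and nz: "gradient \<rho> p \<noteq> 0"
    unfolding local_defining_function_def by blast+
  obtain b0 where b0: "b0 \<in> Basis" "gradient \<rho> p \<bullet> b0 \<noteq> 0"
    using nz euclidean_all_zero_iff[of "gradient \<rho> p"] by blast
  \<comment> \<open>The sign \<open>\<sigma>\<close> makes \<open>\<rho>\<close> increase in the direction \<open>e\<close>.\<close>
  define \<sigma> where "\<sigma> = sgn (gradient \<rho> p \<bullet> b0)"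
  define e where "e = \<sigma> *\<^sub>R b0"
  have \<sigma>: "\<sigma> = 1 \<or> \<sigma> = -1" using b0(2) by (auto simp: \<sigma>_def sgn_if)
  have e: "e \<in> Basis \<or> - e \<in> Basis" using \<sigma> b0(1) by (auto simp: e_def)
  define D where "D x = gradient \<rho> x \<bullet> e" for x
  have D_eq: "D = (\<lambda>x. \<sigma> * partial_deriv b0 \<rho> x)"
    unfolding D_def e_def using gradient_inner_Basis[OF b0(1)] by auto
  have C1D: "C1_on W D" unfolding D_eq
    by (intro C1_on_mult C1_on_const smooth_on_C1 smooth_on_partial_deriv sm b0)
  have "D p > 0" unfolding D_def e_def \<sigma>_def using b0(2) by (simp add: sgn_if)
  define U where "U = W \<inter> D -` {0<..}"
  have U: "open U" unfolding U_def
    by (rule continuous_open_preimage[OF C1_on_continuous[OF C1D] W(1)]) simp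
  have UW: "U \<subseteq> W" "\<And>x. x \<in> U \<Longrightarrow> 0 < D x" by (auto simp: U_def)
  have "p \<in> U" using W(2) \<open>D p > 0\<close> by (simp add: U_def)
  then obtain R where R: "R > 0" "cball p R \<subseteq> U" using U open_contains_cball by blast
  define r where "r = R / 6"
  have r: "0 < r" "cball p (6 * r) \<subseteq> U" using R by (simp_all add: r_def)
  have \<rho>C1: "C1_on U \<rho>" by (rule C1_on_subset[OF smooth_on_C1[OF sm] UW(1)])
  have \<Omega>U: "\<Omega> \<inter> U = {x \<in> U. \<rho> x < 0}" using W(3) UW(1) by blast
  have "\<exists>C\<ge>0. \<forall>g \<eta> I. C1_on UNIV g \<longrightarrow> (\<forall>x. x \<notin> cball p r \<longrightarrow> g x = 0) \<longrightarrow> 0 < \<eta> \<longrightarrow> 0 \<le> I \<longrightarrow>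
      (\<integral>\<^sup>+x. ennreal ((g x)\<^sup>2) * indicator (frontier \<Omega> \<inter> cball p (2 * r)) x
          \<partial>hausdorff_measure (DIM('a) - 1)) \<le> ennreal I \<longrightarrow>
      \<bar>LINT x|lborel. indicator \<Omega> x * (gradient g x \<bullet> e)\<bar>
        \<le> C * \<eta> + slab_const TYPE('a) * I / \<eta>"
  proof (rule transversal_flux_bound[OF dim e op bd r(1), of p \<rho>])
    show "(\<rho> has_derivative (\<lambda>h. gradient \<rho> x \<bullet> h)) (at x)" if "x \<in> cball p (6 * r)" for x
      using C1_onD[OF \<rho>C1] that r(2) by blast
    show "0 < gradient \<rho> x \<bullet> e" if "x \<in> cball p (6 * r)" for x
      using UW(2) that r(2) unfolding D_def by blast
    show "x \<in> \<Omega> \<longleftrightarrow> \<rho> x < 0" if "x \<in> cball p (6 * r)" for x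
      using \<Omega>U that r(2) by blast
    show "\<rho> z = 0" if "z \<in> frontier \<Omega>" "z \<in> cball p (6 * r)" for z
      using defining_function_frontier[OF op ld that(1)] that(2) r(2) UW(1) by blast
  qed
  then obtain C where C0: "0 \<le> C" and C1: "\<forall>g \<eta> I. C1_on UNIV g \<longrightarrow> (\<forall>x. x \<notin> cball p r \<longrightarrow> g x = 0) \<longrightarrow> 0 < \<eta> \<longrightarrow> 0 \<le> I \<longrightarrow>
      (\<integral>\<^sup>+x. ennreal ((g x)\<^sup>2) * indicator (frontier \<Omega> \<inter> cball p (2 * r)) x
          \<partial>hausdorff_measure (DIM('a) - 1)) \<le> ennreal I \<longrightarrow>
      \<bar>LINT x|lborel. indicator \<Omega> x * (gradient g x \<bullet> e)\<bar>
        \<le> C * \<eta> + slab_const TYPE('a) * I / \<eta>" by (elim exE conjE) (rule that)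
  show ?thesis
  proof (intro exI[of _ r] conjI allI impI r(1))
    fix \<phi> :: "'a \<Rightarrow> real" and v :: "nat \<Rightarrow> 'a \<Rightarrow> real"
    assume \<phi>: "C1_on UNIV \<phi>" and supp': "\<forall>x. x \<notin> cball p r \<longrightarrow> \<phi> x = 0"
      and v': "\<forall>k. smooth_on UNIV (v k)" and lim: "(\<lambda>k. normal_flux_sq \<Omega> (v k)) \<longlonglongrightarrow> 0"
    have supp: "\<phi> x = 0" if "x \<notin> cball p r" for x using supp' that by blast
    have v: "smooth_on UNIV (v k)" for k using v' by blast
    define g where "g k x = \<phi> x * (\<Sum>b\<in>Basis. partial_deriv b (v k) x * partial_deriv b \<rho> x) / D x" for k x
    have g_eq: "g k x = \<phi> x * (gradient (v k) x \<bullet> gradient \<rho> x) / D x" for k x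
      unfolding g_def by (subst euclidean_inner) (simp add: gradient_inner_Basis)
    have gsupp: "g k x = 0" if "x \<notin> cball p r" for k x using supp[OF that] by (simp add: g_def)
    have pv: "C1_on S (partial_deriv b (v k))" if "b \<in> Basis" for S b k
      by (rule C1_on_subset[OF smooth_on_C1[OF smooth_on_partial_deriv[OF v that]]]) simp
    have p\<rho>: "C1_on U (partial_deriv b \<rho>)" if "b \<in> Basis" for b
      by (rule C1_on_subset[OF smooth_on_C1[OF smooth_on_partial_deriv[OF sm that]] UW(1)])
    have \<phi>U: "C1_on U \<phi>" by (rule C1_on_subset[OF \<phi>]) simp
    have gC1: "C1_on UNIV (g k)" for k
    proof (rule C1_on_extend_zero[OF _ U closed_cball])
      show "C1_on U (g k)" unfolding g_def
        by (intro C1_on_divide C1_on_mult C1_on_sum pv p\<rho> \<phi>U C1_on_subset[OF C1D UW(1)])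
           (use UW(2) in force)+
      show "cball p r \<subseteq> U" by (rule order_trans[OF subset_cball r(2)]) (use r(1) in simp)
      show "g k x = 0" if "x \<notin> cball p r" for x by (rule gsupp[OF that])
    qed
    define X where "X k b x = \<phi> x * partial_deriv b (v k) x" for k b x
    define T where "T k b x = X k b x - g k x * (e \<bullet> b)" for k b x
    have XC1: "C1_on UNIV (X k b)" if "b \<in> Basis" for k b
      unfolding X_def by (rule C1_on_weighted_gradient[OF \<phi> v that])
    have gc: "C1_on UNIV (\<lambda>x. g k x * (e \<bullet> b))" for k b by (intro C1_on_mult gC1 C1_on_const)
    have TC1: "C1_on UNIV (T k b)" if "b \<in> Basis" for k b
      unfolding T_def by (intro C1_on_diff XC1 gc that)
    have gradgc: "gradient (\<lambda>x. g k x * (e \<bullet> b)) x = (e \<bullet> b) *\<^sub>R gradient (g k) x" for k b x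
    proof -
      have "gradient (\<lambda>x. e \<bullet> b) x = 0" by (rule gradient_eqI) simp
      then show ?thesis using gradient_mult[OF gC1 C1_on_const, of x k "e \<bullet> b"] by simp
    qed
    have div_split: "divergence (X k) x = divergence (T k) x + gradient (g k) x \<bullet> e" for k x
    proof -
      have "divergence (T k) x = (\<Sum>b\<in>Basis. gradient (X k b) x \<bullet> b - (gradient (g k) x \<bullet> b) * (e \<bullet> b))"
        unfolding divergence_def
      proof (rule sum.cong[OF refl])
        fix b :: 'a assume b: "b \<in> Basis"
        show "gradient (T k b) x \<bullet> b = gradient (X k b) x \<bullet> b - (gradient (g k) x \<bullet> b) * (e \<bullet> b)"
          unfolding T_def using gradient_diff[OF XC1[OF b] gc, of x k k b] gradgc
          by (simp add: inner_diff_left)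
      qed
      also have "\<dots> = divergence (X k) x - gradient (g k) x \<bullet> e"
        unfolding sum_subtractf divergence_def by (simp only: euclidean_inner[of "gradient (g k) x" e])
      finally show ?thesis by simp
    qed
    have Tzero: "(LINT x|lborel. indicator \<Omega> x * divergence (T k) x) = 0" for k
    proof (rule integral_divergence_tangential[OF U _ \<rho>C1 _ \<Omega>U TC1])
      show "cball p r \<subseteq> U" by (rule order_trans[OF subset_cball r(2)]) (use r(1) in simp)
      show "\<Omega> \<in> sets borel" using op by simp
      show "T k b x = 0" if "x \<notin> cball p r" for b x
        unfolding T_def X_def using supp[OF that] gsupp[OF that] by simp
      show "(\<Sum>b\<in>Basis. T k b x * (gradient \<rho> x \<bullet> b)) = 0" if x: "x \<in> U" for x
      proof -
        have "(\<Sum>b\<in>Basis. T k b x * (gradient \<rho> x \<bullet> b))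
            = (\<Sum>b\<in>Basis. \<phi> x * ((gradient (v k) x \<bullet> b) * (gradient \<rho> x \<bullet> b)) - g k x * ((e \<bullet> b) * (gradient \<rho> x \<bullet> b)))"
          by (rule sum.cong[OF refl]) (simp add: T_def X_def gradient_inner_Basis[symmetric] algebra_simps)
        also have "\<dots> = \<phi> x * (gradient (v k) x \<bullet> gradient \<rho> x) - g k x * D x"
          unfolding D_def sum_subtractf sum_distrib_left[symmetric]
            inner_commute[of "gradient \<rho> x" e]
            euclidean_inner[of "gradient (v k) x" "gradient \<rho> x", symmetric]
            euclidean_inner[of e "gradient \<rho> x", symmetric] ..
        also have "\<dots> = 0" using UW(2)[OF x] by (simp add: g_eq)
        finally show ?thesis .
      qed
    qed
    have flux_eq: "weighted_flux \<Omega> (v k) \<phi> = (LINT x|lborel. indicator \<Omega> x * (gradient (g k) x \<bullet> e))" for k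
    proof -
      have "integrable lborel (\<lambda>x. indicator \<Omega> x * divergence (T k) x)"
        by (rule integrable_indicator_bounded_continuous[OF continuous_divergence[OF TC1] bd]) (use op in auto)
      moreover have "integrable lborel (\<lambda>x. indicator \<Omega> x * (gradient (g k) x \<bullet> e))"
        by (rule integrable_indicator_bounded_continuous[OF _ bd])
           (use op in \<open>auto intro!: continuous_intros C1_on_gradient gC1\<close>)
      ultimately show ?thesis
        unfolding weighted_flux_def X_def[symmetric] using Tzero[of k]
        by (simp only: div_split distrib_left Bochner_Integration.integral_add add_0)
    qed
    \<comment> \<open>On the boundary the square of \<open>g k\<close> is \<open>q\<close> times the square of the normal derivative.\<close>
    define q where "q x = (\<phi> x * norm (gradient \<rho> x) / D x)\<^sup>2" for x
    have "continuous_on (cball p (6 * r)) q" unfolding q_def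
      using r(2) UW(2)
      by (intro continuous_intros continuous_on_subset[OF C1_on_continuous[OF \<phi>]]
          continuous_on_subset[OF C1_on_gradient[OF \<rho>C1]]
          continuous_on_subset[OF C1_on_continuous[OF C1_on_subset[OF C1D UW(1)]]]) force+
    then have "bounded (q ` cball p (6 * r))"
      by (intro compact_imp_bounded compact_continuous_image compact_cball)
    then obtain M where M: "M > 0" "\<And>x. x \<in> cball p (6 * r) \<Longrightarrow> norm (q x) \<le> M"
      unfolding bounded_pos by blast
    let ?H = "hausdorff_measure (DIM('a) - 1) :: 'a measure"
    have dim1: "DIM('a) - 1 > 0" using dim by simp
    have bound: "(\<integral>\<^sup>+x. ennreal ((g k x)\<^sup>2) * indicator (frontier \<Omega> \<inter> cball p (2 * r)) x \<partial>?H)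
        \<le> ennreal M * normal_flux_sq \<Omega> (v k)" for k
    proof -
      let ?K = "frontier \<Omega> \<inter> cball p (2 * r)"
      have point: "ennreal ((g k x)\<^sup>2 / M) * indicator ?K x
          \<le> ennreal ((gradient (v k) x \<bullet> outward_normal \<Omega> x)\<^sup>2) * indicator (frontier \<Omega>) x" for x
      proof (cases "x \<in> ?K")
        case True
        then have x: "x \<in> frontier \<Omega>" "x \<in> cball p (6 * r)" using r(1) by auto
        then have xU: "x \<in> U" using r(2) by blast
        have xW: "x \<in> W" using xU UW(1) by blast
        have n: "outward_normal \<Omega> x = gradient \<rho> x /\<^sub>R norm (gradient \<rho> x)"
          by (rule outward_normal_eq[OF op x(1) xW ld])
        have "gradient \<rho> x \<noteq> 0" using UW(2)[OF xU] unfolding D_def by auto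
        then have "g k x = \<phi> x * norm (gradient \<rho> x) / D x * (gradient (v k) x \<bullet> outward_normal \<Omega> x)"
          unfolding n g_eq by simp
        then have "(g k x)\<^sup>2 = q x * (gradient (v k) x \<bullet> outward_normal \<Omega> x)\<^sup>2"
          unfolding q_def by (simp only: power_mult_distrib)
        also have "\<dots> \<le> M * (gradient (v k) x \<bullet> outward_normal \<Omega> x)\<^sup>2"
          using M(2)[OF x(2)] by (intro mult_right_mono) auto
        finally have "(g k x)\<^sup>2 / M \<le> (gradient (v k) x \<bullet> outward_normal \<Omega> x)\<^sup>2"
          using M(1) by (simp add: pos_divide_le_eq mult.commute)
        then show ?thesis using True x(1) by (simp add: ennreal_leI)
      qed simp
      have setsH: "sets ?H = sets borel" by (rule sets_hausdorff_measure[OF dim1])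
      have Km [measurable]: "?K \<in> sets borel" by simp
      have [measurable]: "g k \<in> borel_measurable borel"
        by (rule borel_measurable_continuous_onI[OF C1_on_continuous[OF gC1]])
      have gm: "(\<lambda>x. ennreal ((g k x)\<^sup>2 / M) * indicator ?K x) \<in> borel_measurable ?H"
        by (subst measurable_cong_sets[OF setsH refl]) measurable
      \<comment> \<open>The factor \<open>M\<close> is taken out of an integral of a continuous function; the outward normal is defined by choice, and its measurability is not at hand.\<close>
      have "ennreal ((g k x)\<^sup>2) = ennreal M * ennreal ((g k x)\<^sup>2 / M)" for x
        using M(1) by (simp add: ennreal_mult[symmetric])
      then have "(\<integral>\<^sup>+x. ennreal ((g k x)\<^sup>2) * indicator ?K x \<partial>?H)
          = (\<integral>\<^sup>+x. ennreal M * (ennreal ((g k x)\<^sup>2 / M) * indicator ?K x) \<partial>?H)"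
        by (simp only: mult.assoc)
      also have "\<dots> = ennreal M * (\<integral>\<^sup>+x. ennreal ((g k x)\<^sup>2 / M) * indicator ?K x \<partial>?H)"
        by (rule nn_integral_cmult[OF gm])
      also have "\<dots> \<le> ennreal M * (\<integral>\<^sup>+x. ennreal ((gradient (v k) x \<bullet> outward_normal \<Omega> x)\<^sup>2)
          * indicator (frontier \<Omega>) x \<partial>?H)"
        by (intro mult_left_mono nn_integral_mono point) simp
      also have "(\<integral>\<^sup>+x. ennreal ((gradient (v k) x \<bullet> outward_normal \<Omega> x)\<^sup>2)
          * indicator (frontier \<Omega>) x \<partial>?H) = normal_flux_sq \<Omega> (v k)"
        unfolding normal_flux_sq_def surface_measure_def
        by (rule nn_integral_restrict_space[symmetric])
           (simp only: setsH space_hausdorff_measure[OF dim1] Int_UNIV_right borel_closed frontier_closed)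
      finally show ?thesis .
    qed
    show "(\<lambda>k. weighted_flux \<Omega> (v k) \<phi>) \<longlonglongrightarrow> 0"
    proof (rule LIMSEQ_I)
      fix \<epsilon> :: real assume \<epsilon>: "0 < \<epsilon>"
      let ?\<kappa> = "slab_const TYPE('a)"
      have \<kappa>: "0 < ?\<kappa>" by (rule slab_const_pos)
      \<comment> \<open>First \<open>\<eta>\<close> makes the term \<open>C \<eta>\<close> small, then \<open>I\<close> the term with \<open>1 / \<eta>\<close>.\<close>
      define \<eta> where "\<eta> = \<epsilon> / (2 * (C + 1))"
      have \<eta>: "0 < \<eta>" using \<epsilon> C0 by (simp add: \<eta>_def)
      have C\<eta>: "C * \<eta> \<le> \<epsilon> / 2"
      proof -
        have "C * \<eta> \<le> (C + 1) * \<eta>" using \<eta> by simp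
        also have "\<dots> = \<epsilon> / 2"
        proof -
          have "a * (\<epsilon> / (2 * a)) = \<epsilon> / 2" if "a \<noteq> 0" for a :: real using that by simp
          then show ?thesis unfolding \<eta>_def using C0 by (metis add_nonneg_pos less_irrefl zero_less_one)
        qed
        finally show ?thesis .
      qed
      define I where "I = \<epsilon> * \<eta> / (4 * ?\<kappa>)"
      have I: "0 < I" using \<epsilon> \<eta> \<kappa> by (simp add: I_def)
      have kI: "?\<kappa> * I / \<eta> = \<epsilon> / 4" using \<eta> \<kappa> by (simp add: I_def)
      have "eventually (\<lambda>k. normal_flux_sq \<Omega> (v k) < ennreal (I / M)) sequentially"
        using I M(1) by (intro order_tendstoD(2)[OF lim]) simp
      then obtain N where N: "\<And>k. k \<ge> N \<Longrightarrow> normal_flux_sq \<Omega> (v k) < ennreal (I / M)"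
        unfolding eventually_sequentially by blast
      have "norm (weighted_flux \<Omega> (v k) \<phi> - 0) < \<epsilon>" if "k \<ge> N" for k
      proof -
        have "ennreal M * normal_flux_sq \<Omega> (v k) \<le> ennreal M * ennreal (I / M)"
          using N[OF that] by (intro mult_left_mono) auto
        also have "\<dots> = ennreal I" using M(1) I by (simp add: ennreal_mult[symmetric])
        finally have "ennreal M * normal_flux_sq \<Omega> (v k) \<le> ennreal I" .
        then have "(\<integral>\<^sup>+x. ennreal ((g k x)\<^sup>2) * indicator (frontier \<Omega> \<inter> cball p (2 * r)) x \<partial>?H) \<le> ennreal I"
          by (rule order_trans[OF bound])
        then have "\<bar>weighted_flux \<Omega> (v k) \<phi>\<bar> \<le> C * \<eta> + ?\<kappa> * I / \<eta>"
          unfolding flux_eq using C1 gC1[of k] gsupp[of _ k] \<eta> less_imp_le[OF I] by blast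
        then have "\<bar>weighted_flux \<Omega> (v k) \<phi>\<bar> \<le> C * \<eta> + \<epsilon> / 4" unfolding kI .
        then have "\<bar>weighted_flux \<Omega> (v k) \<phi>\<bar> < \<epsilon>" using C\<eta> \<epsilon> by linarith
        then show ?thesis unfolding real_norm_def diff_0_right .
      qed
      then show "\<exists>N. \<forall>k\<ge>N. norm (weighted_flux \<Omega> (v k) \<phi> - 0) < \<epsilon>" by blast
    qed
  qed
qed

text \<open>
  Finitely many of the small balls cover the closure of \<open>\<Omega>\<close>. Splitting off one bump function
  at a time, \<open>\<phi> = \<phi> \<psi> + \<phi> (1 - \<psi>)\<close>, leaves after the last ball a function that vanishes on \<open>\<Omega>\<close>.
\<close>
lemma weighted_flux_tendsto_0:
  fixes \<Omega> :: "'a::euclidean_space set"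
  assumes dim: "DIM('a) \<ge> 2" and \<Omega>: "smooth_bounded_domain \<Omega>"
    and v: "\<And>k::nat. smooth_on UNIV (v k)" and lim: "(\<lambda>k. normal_flux_sq \<Omega> (v k)) \<longlonglongrightarrow> 0"
    and \<phi>: "C1_on UNIV \<phi>"
  shows "(\<lambda>k. weighted_flux \<Omega> (v k) \<phi>) \<longlonglongrightarrow> 0"
proof -
  have op: "open \<Omega>" and bd: "bounded \<Omega>" using \<Omega> unfolding smooth_bounded_domain_def by blast+
  have local: "\<exists>r>0. \<forall>\<phi>. C1_on UNIV \<phi> \<longrightarrow> (\<forall>x. x \<notin> cball p r \<longrightarrow> \<phi> x = 0) \<longrightarrow>
      (\<lambda>k. weighted_flux \<Omega> (v k) \<phi>) \<longlonglongrightarrow> 0" if "p \<in> closure \<Omega>" for p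
  proof (cases "p \<in> \<Omega>")
    case True
    then obtain r where "r > 0" "cball p r \<subseteq> \<Omega>" using op open_contains_cball by blast
    then show ?thesis using weighted_flux_interior[OF _ _ v, of p r \<Omega>] by (intro exI[of _ r]) simp
  next
    case False
    then have "p \<in> frontier \<Omega>" using that op by (simp add: frontier_def interior_open)
    from weighted_flux_boundary[OF dim \<Omega> this] show ?thesis using v lim by blast
  qed
  then obtain r where r: "\<And>p. p \<in> closure \<Omega> \<Longrightarrow> 0 < r p"
    "\<And>p \<phi>. p \<in> closure \<Omega> \<Longrightarrow> C1_on UNIV \<phi> \<Longrightarrow> (\<And>x. x \<notin> cball p (r p) \<Longrightarrow> \<phi> x = 0) \<Longrightarrow>
      (\<lambda>k. weighted_flux \<Omega> (v k) \<phi>) \<longlonglongrightarrow> 0"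
    by metis
  have "compact (closure \<Omega>)" using bd by (simp add: compact_closure)
  then obtain P where P: "P \<subseteq> closure \<Omega>" "finite P" "closure \<Omega> \<subseteq> (\<Union>p\<in>P. ball p (r p / 2))"
    by (rule compactE_image[of _ "closure \<Omega>" "\<lambda>p. ball p (r p / 2)"]) (use r(1) in force)+
  have "(\<lambda>k. weighted_flux \<Omega> (v k) \<phi>) \<longlonglongrightarrow> 0"
    if "finite Q" "Q \<subseteq> closure \<Omega>" "C1_on UNIV \<phi>" "\<And>x. x \<in> \<Omega> \<Longrightarrow> x \<notin> (\<Union>p\<in>Q. ball p (r p / 2)) \<Longrightarrow> \<phi> x = 0"
    for Q \<phi>
    using that
  proof (induction Q arbitrary: \<phi> rule: finite_induct)
    case empty
    then have "weighted_flux \<Omega> (v k) \<phi> = 0" for k by (intro weighted_flux_zero[OF op]) simp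
    then show ?case by simp
  next
    case (insert p Q)
    have p: "p \<in> closure \<Omega>" using insert.prems by blast
    obtain \<psi> where \<psi>: "C1_on UNIV \<psi>" "\<And>x. x \<in> cball p (r p / 2) \<Longrightarrow> \<psi> x = 1"
      "\<And>x. x \<notin> cball p (r p) \<Longrightarrow> \<psi> x = 0"
      by (rule ex_bump[of "r p / 2" "r p" p]) (use r(1)[OF p] in auto)
    have 1: "C1_on UNIV (\<lambda>x. \<phi> x * \<psi> x)" by (intro C1_on_mult insert.prems \<psi>)
    have 2: "C1_on UNIV (\<lambda>x. \<phi> x * (1 - \<psi> x))" by (intro C1_on_mult C1_on_diff C1_on_const insert.prems \<psi>)
    have "(\<lambda>k. weighted_flux \<Omega> (v k) (\<lambda>x. \<phi> x * \<psi> x)) \<longlonglongrightarrow> 0"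
    proof (rule r(2)[OF p 1])
      show "\<phi> x * \<psi> x = 0" if "x \<notin> cball p (r p)" for x using \<psi>(3)[OF that] by simp
    qed
    moreover have "(\<lambda>k. weighted_flux \<Omega> (v k) (\<lambda>x. \<phi> x * (1 - \<psi> x))) \<longlonglongrightarrow> 0"
    proof (rule insert.IH[OF _ 2])
      show "Q \<subseteq> closure \<Omega>" using insert.prems by blast
      show "\<phi> x * (1 - \<psi> x) = 0" if "x \<in> \<Omega>" "x \<notin> (\<Union>p\<in>Q. ball p (r p / 2))" for x
      proof (cases "x \<in> ball p (r p / 2)")
        case True
        then have "\<psi> x = 1" by (intro \<psi>(2)) simp
        then show ?thesis by simp
      next
        case False
        then have "\<phi> x = 0" using insert.prems(3)[OF that(1)] that(2) by simp
        then show ?thesis by simp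
      qed
    qed
    ultimately have "(\<lambda>k. weighted_flux \<Omega> (v k) (\<lambda>x. \<phi> x * \<psi> x)
        + weighted_flux \<Omega> (v k) (\<lambda>x. \<phi> x * (1 - \<psi> x))) \<longlonglongrightarrow> 0 + 0"
      by (rule tendsto_add)
    moreover have "weighted_flux \<Omega> (v k) (\<lambda>x. \<phi> x * \<psi> x) + weighted_flux \<Omega> (v k) (\<lambda>x. \<phi> x * (1 - \<psi> x))
        = weighted_flux \<Omega> (v k) \<phi>" for k
    proof -
      have "\<phi> x * \<psi> x + \<phi> x * (1 - \<psi> x) = \<phi> x" for x by (simp add: algebra_simps)
      then show ?thesis using weighted_flux_add[OF op bd v 1 2, of k] by (simp only:)
    qed
    ultimately show ?case by simp
  qed
  moreover have "x \<in> (\<Union>p\<in>P. ball p (r p / 2))" if "x \<in> \<Omega>" for x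
    using that P(3) closure_subset by blast
  ultimately show ?thesis using P(1,2) \<phi> by blast
qed


section \<open>Square integrable functions\<close>

definition sq_integrable :: "'a measure \<Rightarrow> ('a \<Rightarrow> 'b::euclidean_space) \<Rightarrow> bool" where
  "sq_integrable M f \<longleftrightarrow> f \<in> borel_measurable M \<and> integrable M (\<lambda>x. (norm (f x))\<^sup>2)"

lemma L2_iff_sq_integrable: "L2 \<Omega> f \<longleftrightarrow> sq_integrable (lebesgue_on \<Omega>) f"
  by (simp add: L2_def sq_integrable_def)

lemma sq_integrable_inner:
  fixes f g :: "'a \<Rightarrow> 'b::euclidean_space"
  assumes "sq_integrable M f" "sq_integrable M g"
  shows "integrable M (\<lambda>x. f x \<bullet> g x)"
proof (rule Bochner_Integration.integrable_bound)
  show "integrable M (\<lambda>x. (norm (f x))\<^sup>2 + (norm (g x))\<^sup>2)"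
    using assms by (simp add: sq_integrable_def)
  show "(\<lambda>x. f x \<bullet> g x) \<in> borel_measurable M"
    using assms by (intro borel_measurable_inner) (simp_all add: sq_integrable_def)
  show "AE x in M. norm (f x \<bullet> g x) \<le> norm ((norm (f x))\<^sup>2 + (norm (g x))\<^sup>2)"
  proof (rule AE_I2)
    fix x
    have "\<bar>f x \<bullet> g x\<bar> \<le> norm (f x) * norm (g x)" by (rule Cauchy_Schwarz_ineq2)
    moreover have "0 \<le> (norm (f x) - norm (g x))\<^sup>2" by simp
    then have "2 * (norm (f x) * norm (g x)) \<le> (norm (f x))\<^sup>2 + (norm (g x))\<^sup>2"
      by (simp add: power2_diff)
    moreover have "0 \<le> norm (f x) * norm (g x)" by simp
    ultimately have "\<bar>f x \<bullet> g x\<bar> \<le> (norm (f x))\<^sup>2 + (norm (g x))\<^sup>2" by linarith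
    then show "norm (f x \<bullet> g x) \<le> norm ((norm (f x))\<^sup>2 + (norm (g x))\<^sup>2)" by simp
  qed
qed

lemma sq_integrable_mult:
  fixes f g :: "'a \<Rightarrow> real"
  assumes "sq_integrable M f" "sq_integrable M g"
  shows "integrable M (\<lambda>x. f x * g x)"
  using sq_integrable_inner[OF assms] by (simp add: inner_real_def)

lemma sq_integrable_combination:
  fixes f g :: "'a \<Rightarrow> 'b::euclidean_space"
  assumes f: "sq_integrable M f" and g: "sq_integrable M g"
  shows "sq_integrable M (\<lambda>x. a *\<^sub>R f x + b *\<^sub>R g x)"
proof -
  have eq: "(norm (a *\<^sub>R f x + b *\<^sub>R g x))\<^sup>2 = a\<^sup>2 * (norm (f x))\<^sup>2 + b\<^sup>2 * (norm (g x))\<^sup>2 + 2 * a * b * (f x \<bullet> g x)" for x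
    unfolding power2_norm_eq_inner
    by (simp add: inner_add_left inner_add_right inner_commute power2_eq_square algebra_simps)
  have "integrable M (\<lambda>x. a\<^sup>2 * (norm (f x))\<^sup>2 + b\<^sup>2 * (norm (g x))\<^sup>2 + 2 * a * b * (f x \<bullet> g x))"
    using f g sq_integrable_inner[OF f g]
    by (intro Bochner_Integration.integrable_add integrable_mult_right) (simp_all add: sq_integrable_def)
  moreover have "(\<lambda>x. a *\<^sub>R f x + b *\<^sub>R g x) \<in> borel_measurable M"
    using f g by (intro borel_measurable_add borel_measurable_scaleR) (simp_all add: sq_integrable_def)
  ultimately show ?thesis unfolding sq_integrable_def eq by blast
qed

lemma sq_integrable_real_combination:
  fixes f g :: "'a \<Rightarrow> real"
  assumes "sq_integrable M f" "sq_integrable M g"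
  shows "sq_integrable M (\<lambda>x. a * f x + b * g x)"
  using sq_integrable_combination[OF assms, of a b] by simp

text \<open>
  The quadratic form \<open>\<integral> (s f - t g)\<^sup>2\<close> is nonnegative, so its discriminant is not positive.
\<close>
lemma integral_mult_Cauchy_Schwarz:
  fixes f g :: "'a \<Rightarrow> real"
  assumes f: "sq_integrable M f" and g: "sq_integrable M g"
  shows "\<bar>LINT x|M. f x * g x\<bar> \<le> sqrt (LINT x|M. (f x)\<^sup>2) * sqrt (LINT x|M. (g x)\<^sup>2)"
proof -
  define A where "A = (LINT x|M. (f x)\<^sup>2)"
  define B where "B = (LINT x|M. f x * g x)"
  define C where "C = (LINT x|M. (g x)\<^sup>2)"
  have iA: "integrable M (\<lambda>x. (f x)\<^sup>2)" and iC: "integrable M (\<lambda>x. (g x)\<^sup>2)"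
    using f g by (simp_all add: sq_integrable_def)
  have iB: "integrable M (\<lambda>x. f x * g x)" by (rule sq_integrable_mult[OF f g])
  have quad: "0 \<le> s\<^sup>2 * A - 2 * s * t * B + t\<^sup>2 * C" for s t
  proof -
    have "0 \<le> (LINT x|M. (s * f x - t * g x)\<^sup>2)" by simp
    also have "\<dots> = (LINT x|M. s\<^sup>2 * (f x)\<^sup>2 - 2 * s * t * (f x * g x) + t\<^sup>2 * (g x)\<^sup>2)"
      by (rule Bochner_Integration.integral_cong) (simp_all add: power2_eq_square algebra_simps)
    also have "\<dots> = s\<^sup>2 * A - 2 * s * t * B + t\<^sup>2 * C"
      unfolding A_def B_def C_def using iA iB iC by simp
    finally show ?thesis .
  qed
  have AC: "0 \<le> A" "0 \<le> C" unfolding A_def C_def by simp_all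
  have "B\<^sup>2 \<le> A * C"
  proof (cases "C = 0")
    case True
    have "B = 0"
    proof (rule ccontr)
      assume B: "B \<noteq> 0"
      \<comment> \<open>For \<open>C = 0\<close> the form is affine in \<open>t\<close>, and this \<open>t\<close> makes it negative.\<close>
      have "0 \<le> 1\<^sup>2 * A - 2 * 1 * ((A + 1) / (2 * B)) * B + ((A + 1) / (2 * B))\<^sup>2 * C" by (rule quad)
      also have "\<dots> = A - (A + 1)" using B True by (simp add: field_simps)
      finally show False by simp
    qed
    then show ?thesis using True by simp
  next
    case False
    then have C: "0 < C" using AC by simp
    have "0 \<le> C\<^sup>2 * A - 2 * C * B * B + B\<^sup>2 * C" by (rule quad)
    also have "\<dots> = C * (A * C - B\<^sup>2)" by (simp add: power2_eq_square algebra_simps)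
    finally show ?thesis using C by (simp add: zero_le_mult_iff)
  qed
  then have "sqrt (B\<^sup>2) \<le> sqrt (A * C)" by (rule real_sqrt_le_mono)
  then show ?thesis unfolding A_def[symmetric] B_def[symmetric] C_def[symmetric]
    by (simp add: real_sqrt_mult)
qed

lemma integral_mult_tendsto:
  fixes f :: "nat \<Rightarrow> 'a \<Rightarrow> real"
  assumes f: "\<And>k. sq_integrable M (f k)" "sq_integrable M f0" and g: "sq_integrable M g"
    and lim: "(\<lambda>k. sqrt (LINT x|M. (f k x - f0 x)\<^sup>2)) \<longlonglongrightarrow> 0"
  shows "(\<lambda>k. LINT x|M. f k x * g x) \<longlonglongrightarrow> (LINT x|M. f0 x * g x)"
proof (rule LIM_zero_cancel, rule tendsto_rabs_zero_cancel, rule tendsto_sandwich)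
  let ?G = "sqrt (LINT x|M. (g x)\<^sup>2)"
  show "\<forall>\<^sub>F k in sequentially. 0 \<le> \<bar>(LINT x|M. f k x * g x) - (LINT x|M. f0 x * g x)\<bar>" by simp
  show "\<forall>\<^sub>F k in sequentially. \<bar>(LINT x|M. f k x * g x) - (LINT x|M. f0 x * g x)\<bar>
      \<le> sqrt (LINT x|M. (f k x - f0 x)\<^sup>2) * ?G"
  proof (rule always_eventually, rule allI)
    fix k
    have d: "sq_integrable M (\<lambda>x. f k x - f0 x)"
      using sq_integrable_real_combination[OF f(1)[of k] f(2), of 1 "-1"] by simp
    have "(LINT x|M. f k x * g x) - (LINT x|M. f0 x * g x) = (LINT x|M. (f k x - f0 x) * g x)"
      unfolding left_diff_distrib
      by (rule Bochner_Integration.integral_diff[symmetric]) (intro sq_integrable_mult f g)+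
    then show "\<bar>(LINT x|M. f k x * g x) - (LINT x|M. f0 x * g x)\<bar>
      \<le> sqrt (LINT x|M. (f k x - f0 x)\<^sup>2) * ?G"
      using integral_mult_Cauchy_Schwarz[OF d g] by (simp only:)
  qed
  show "(\<lambda>k. sqrt (LINT x|M. (f k x - f0 x)\<^sup>2) * ?G) \<longlonglongrightarrow> 0"
    using tendsto_mult_right[OF lim, of ?G] by simp
qed simp


section \<open>Green's formula for jets\<close>

text \<open>
  A jet carries a function together with its gradient and Laplacian as independent data. Linear
  combinations are taken in all three components at once, so that weak derivatives of sums,
  which are chosen representatives, never have to be compared with sums of weak derivatives.
\<close>
type_synonym 'a jet = "('a \<Rightarrow> real) \<times> ('a \<Rightarrow> 'a) \<times> ('a \<Rightarrow> real)"

abbreviation jval :: "'a jet \<Rightarrow> 'a \<Rightarrow> real" where "jval t \<equiv> fst t"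
abbreviation jgrad :: "'a jet \<Rightarrow> 'a \<Rightarrow> 'a" where "jgrad t \<equiv> fst (snd t)"
abbreviation jlap :: "'a jet \<Rightarrow> 'a \<Rightarrow> real" where "jlap t \<equiv> snd (snd t)"

definition jcomb :: "real \<Rightarrow> 'a::real_vector jet \<Rightarrow> real \<Rightarrow> 'a jet \<Rightarrow> 'a jet" where
  "jcomb a s b t = (\<lambda>x. a * jval s x + b * jval t x, \<lambda>x. a *\<^sub>R jgrad s x + b *\<^sub>R jgrad t x,
     \<lambda>x. a * jlap s x + b * jlap t x)"

definition regular_jet :: "'a::euclidean_space measure \<Rightarrow> 'a jet \<Rightarrow> bool" where
  "regular_jet M t \<longleftrightarrow> sq_integrable M (jval t) \<and> sq_integrable M (jgrad t) \<and> sq_integrable M (jlap t)"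

definition green_pair :: "'a::euclidean_space measure \<Rightarrow> 'a jet \<Rightarrow> 'a jet \<Rightarrow> bool" where
  "green_pair M s t \<longleftrightarrow> (LINT x|M. jlap s x * jval t x) = - (LINT x|M. jgrad s x \<bullet> jgrad t x)"

text \<open>
  The condition that Laplacians have integral zero is Green's formula against the constant one.
\<close>
definition green_family :: "'a::euclidean_space measure \<Rightarrow> 'a jet set \<Rightarrow> bool" where
  "green_family M T \<longleftrightarrow> (\<forall>t\<in>T. regular_jet M t \<and> (LINT x|M. jlap t x) = 0) \<and> (\<forall>s\<in>T. \<forall>t\<in>T. green_pair M s t)"

inductive_set jspan :: "'a::real_vector jet set \<Rightarrow> 'a jet set" for T where
  base: "t \<in> T \<Longrightarrow> t \<in> jspan T"
| comb: "s \<in> jspan T \<Longrightarrow> t \<in> jspan T \<Longrightarrow> jcomb a s b t \<in> jspan T"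

lemma regular_jcomb:
  assumes "regular_jet M s" "regular_jet M t" shows "regular_jet M (jcomb a s b t)"
  using assms unfolding regular_jet_def jcomb_def
  by (simp add: sq_integrable_combination sq_integrable_real_combination)

lemma green_pair_jcomb_left:
  assumes s: "regular_jet M s" "green_pair M s r" and t: "regular_jet M t" "green_pair M t r"
    and r: "regular_jet M r"
  shows "green_pair M (jcomb a s b t) r"
proof -
  have i: "integrable M (\<lambda>x. jlap s x * jval r x)" "integrable M (\<lambda>x. jlap t x * jval r x)"
    "integrable M (\<lambda>x. jgrad s x \<bullet> jgrad r x)" "integrable M (\<lambda>x. jgrad t x \<bullet> jgrad r x)"
    using s(1) t(1) r unfolding regular_jet_def by (blast intro: sq_integrable_mult sq_integrable_inner)+
  have "(LINT x|M. jlap (jcomb a s b t) x * jval r x)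
      = (LINT x|M. a * (jlap s x * jval r x) + b * (jlap t x * jval r x))"
    by (simp add: jcomb_def algebra_simps)
  also have "\<dots> = a * (LINT x|M. jlap s x * jval r x) + b * (LINT x|M. jlap t x * jval r x)"
    using i by simp
  also have "\<dots> = - (a * (LINT x|M. jgrad s x \<bullet> jgrad r x) + b * (LINT x|M. jgrad t x \<bullet> jgrad r x))"
    using s(2) t(2) unfolding green_pair_def by simp
  also have "\<dots> = - (LINT x|M. a * (jgrad s x \<bullet> jgrad r x) + b * (jgrad t x \<bullet> jgrad r x))"
    using i by simp
  also have "\<dots> = - (LINT x|M. jgrad (jcomb a s b t) x \<bullet> jgrad r x)"
    by (simp add: jcomb_def inner_add_left)
  finally show ?thesis unfolding green_pair_def .
qed

lemma green_pair_jcomb_right: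
  assumes s: "regular_jet M s" "green_pair M r s" and t: "regular_jet M t" "green_pair M r t"
    and r: "regular_jet M r"
  shows "green_pair M r (jcomb a s b t)"
proof -
  have i: "integrable M (\<lambda>x. jlap r x * jval s x)" "integrable M (\<lambda>x. jlap r x * jval t x)"
    "integrable M (\<lambda>x. jgrad r x \<bullet> jgrad s x)" "integrable M (\<lambda>x. jgrad r x \<bullet> jgrad t x)"
    using s(1) t(1) r unfolding regular_jet_def by (blast intro: sq_integrable_mult sq_integrable_inner)+
  have "(LINT x|M. jlap r x * jval (jcomb a s b t) x)
      = (LINT x|M. a * (jlap r x * jval s x) + b * (jlap r x * jval t x))"
    by (simp add: jcomb_def algebra_simps)
  also have "\<dots> = a * (LINT x|M. jlap r x * jval s x) + b * (LINT x|M. jlap r x * jval t x)"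
    using i by simp
  also have "\<dots> = - (a * (LINT x|M. jgrad r x \<bullet> jgrad s x) + b * (LINT x|M. jgrad r x \<bullet> jgrad t x))"
    using s(2) t(2) unfolding green_pair_def by simp
  also have "\<dots> = - (LINT x|M. a * (jgrad r x \<bullet> jgrad s x) + b * (jgrad r x \<bullet> jgrad t x))"
    using i by simp
  also have "\<dots> = - (LINT x|M. jgrad r x \<bullet> jgrad (jcomb a s b t) x)"
    by (simp add: jcomb_def inner_add_right)
  finally show ?thesis unfolding green_pair_def .
qed

text \<open>
  Green's formula is bilinear, so it passes to the span, in one argument after the other.
\<close>
lemma green_family_jspan:
  assumes fin: "finite_measure M" and T: "green_family M T"
  shows "green_family M (jspan T)"
proof -
  interpret finite_measure M by (rule fin)
  have int_lap: "integrable M (jlap t)" if "regular_jet M t" for t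
  proof -
    have "sq_integrable M (\<lambda>x. 1 :: real)" by (simp add: sq_integrable_def)
    from sq_integrable_mult[OF _ this, of "jlap t"] show ?thesis
      using that unfolding regular_jet_def by simp
  qed
  have 1: "regular_jet M t \<and> (LINT x|M. jlap t x) = 0" if "t \<in> jspan T" for t
    using that
  proof induction
    case (base t)
    then show ?case using T unfolding green_family_def by blast
  next
    case (comb s t a b)
    then show ?case using int_lap[of s] int_lap[of t] regular_jcomb[of M s t a b]
      by (simp add: jcomb_def)
  qed
  have 2: "green_pair M s t" if "s \<in> jspan T" "t \<in> T" for s t
    using that
  proof induction
    case (base s)
    then show ?case using T unfolding green_family_def by blast
  next
    case (comb s s' a b)
    show ?case
      by (rule green_pair_jcomb_left) (use comb 1 jspan.base[of t T] in blast)+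
  qed
  have 3: "green_pair M s t" if "t \<in> jspan T" "s \<in> jspan T" for s t
    using that
  proof induction
    case (base t)
    then show ?case using 2 by blast
  next
    case (comb t t' a b)
    show ?case
      by (rule green_pair_jcomb_right) (use comb 1 in blast)+
  qed
  show ?thesis unfolding green_family_def using 1 3 by blast
qed


section \<open>Flux through a period cell\<close>

lemma gradient_periodic:
  assumes "C1_on UNIV f" "\<And>x. f (x + c) = f x"
  shows "gradient f (x + c) = gradient f x"
proof -
  have "((\<lambda>x. x + c) has_derivative (\<lambda>h. h)) (at x)" by (auto intro!: derivative_eq_intros)
  from has_derivative_compose[OF this C1_onD[OF assms(1)]]
  have "(f has_derivative (\<lambda>h. gradient f (x + c) \<bullet> h)) (at x)" by (simp add: assms(2))
  then show ?thesis by (rule gradient_eqI[symmetric])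
qed

lemma box_periodic_partial_deriv:
  assumes v: "smooth_on UNIV v" "box_periodic p q v" and b: "b \<in> Basis"
  shows "box_periodic p q (partial_deriv b v)"
  unfolding box_periodic_def
proof (intro allI ballI)
  fix x :: 'a and b' :: 'a assume b': "b' \<in> Basis"
  have "gradient v (x + ((q - p) \<bullet> b') *\<^sub>R b') = gradient v x"
    by (rule gradient_periodic[OF smooth_on_C1[OF v(1)]]) (use v(2) b' in \<open>simp add: box_periodic_def\<close>)
  then show "partial_deriv b v (x + ((q - p) \<bullet> b') *\<^sub>R b') = partial_deriv b v x"
    by (simp only: gradient_inner_Basis[OF b, symmetric])
qed

text \<open>
  Moving the box by \<open>t\<close> in the direction \<open>b\<close> adds the slab \<open>T\<close> on top and removes a slab at the bottom,
  up to points on two hyperplanes. The bottom slab is \<open>T\<close> moved by one period.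
\<close>
lemma integral_periodic_shift:
  fixes f :: "'a::euclidean_space \<Rightarrow> real"
  assumes f: "continuous_on UNIV f" and per: "\<And>x. f (x + ((q - p) \<bullet> b) *\<^sub>R b) = f x"
    and b: "b \<in> Basis" and pq: "\<And>i. i \<in> Basis \<Longrightarrow> p \<bullet> i < q \<bullet> i"
    and t: "0 < t" "t < (q - p) \<bullet> b"
  shows "(LINT x|lborel. indicator (box p q) x * (f (x + t *\<^sub>R b) - f x)) = 0"
proof -
  define l where "l = (q - p) \<bullet> b"
  have l: "t < l" "l = q \<bullet> b - p \<bullet> b" using t by (simp_all add: l_def inner_diff_left)
  define T where "T = box (p + l *\<^sub>R b) (q + t *\<^sub>R b)"
  have fm: "f \<in> borel_measurable borel" by (rule borel_measurable_continuous_onI[OF f])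
  have bb: "(x + s *\<^sub>R b) \<bullet> i = x \<bullet> i + (if i = b then s else 0)"
    "(x - s *\<^sub>R b) \<bullet> i = x \<bullet> i - (if i = b then s else 0)" if "i \<in> Basis" for x s i
    using that b by (simp_all add: inner_add_left inner_diff_left inner_Basis)
  have split: "(\<forall>i\<in>Basis. P i) \<longleftrightarrow> P b \<and> (\<forall>i\<in>Basis - {b}. P i)" for P
    using b by blast
  have Q1: "x \<in> box p q \<longleftrightarrow> (p \<bullet> b < x \<bullet> b \<and> x \<bullet> b < q \<bullet> b) \<and> (\<forall>i\<in>Basis - {b}. p \<bullet> i < x \<bullet> i \<and> x \<bullet> i < q \<bullet> i)" for x
    unfolding mem_box split ..
  have Q2: "x - t *\<^sub>R b \<in> box p q \<longleftrightarrow> (p \<bullet> b + t < x \<bullet> b \<and> x \<bullet> b < q \<bullet> b + t) \<and> (\<forall>i\<in>Basis - {b}. p \<bullet> i < x \<bullet> i \<and> x \<bullet> i < q \<bullet> i)" for x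
    unfolding Q1 using b by (auto simp: bb)
  have T1: "x \<in> T \<longleftrightarrow> (q \<bullet> b < x \<bullet> b \<and> x \<bullet> b < q \<bullet> b + t) \<and> (\<forall>i\<in>Basis - {b}. p \<bullet> i < x \<bullet> i \<and> x \<bullet> i < q \<bullet> i)" for x
    unfolding T_def mem_box split using b l(2) by (auto simp: bb)
  have T2: "x + l *\<^sub>R b \<in> T \<longleftrightarrow> (p \<bullet> b < x \<bullet> b \<and> x \<bullet> b < p \<bullet> b + t) \<and> (\<forall>i\<in>Basis - {b}. p \<bullet> i < x \<bullet> i \<and> x \<bullet> i < q \<bullet> i)" for x
    unfolding T1 using b l(2) by (auto simp: bb)
  have ae: "AE x in lborel. indicator (box p q) (x - t *\<^sub>R b) * f x - indicator (box p q) x * f x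
      = indicator T x * f x - indicator T (x + l *\<^sub>R b) * f (x + l *\<^sub>R b)"
    using AE_lborel_inner_neq[OF b, of "q \<bullet> b"] AE_lborel_inner_neq[OF b, of "p \<bullet> b + t"]
  proof eventually_elim
    case (elim x)
    let ?o = "\<forall>i\<in>Basis - {b}. p \<bullet> i < x \<bullet> i \<and> x \<bullet> i < q \<bullet> i"
    have fp: "f (x + l *\<^sub>R b) = f x" unfolding l_def by (rule per)
    have ind: "indicator (box p q) (x - t *\<^sub>R b) - indicator (box p q) x
        = (indicator T x - indicator T (x + l *\<^sub>R b) :: real)"
    proof (cases ?o)
      case False
      then have "x \<notin> box p q" "x - t *\<^sub>R b \<notin> box p q" "x \<notin> T" "x + l *\<^sub>R b \<notin> T"
        using Q1[of x] Q2[of x] T1[of x] T2[of x] by (simp_all only: simp_thms)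
      then show ?thesis by simp
    next
      case True
      have cj: "A \<longleftrightarrow> B" if "A \<longleftrightarrow> B \<and> ?o" for A B using that True by blast
      have m: "x \<in> box p q \<longleftrightarrow> p \<bullet> b < x \<bullet> b \<and> x \<bullet> b < q \<bullet> b"
        "x - t *\<^sub>R b \<in> box p q \<longleftrightarrow> p \<bullet> b + t < x \<bullet> b \<and> x \<bullet> b < q \<bullet> b + t"
        "x \<in> T \<longleftrightarrow> q \<bullet> b < x \<bullet> b \<and> x \<bullet> b < q \<bullet> b + t"
        "x + l *\<^sub>R b \<in> T \<longleftrightarrow> p \<bullet> b < x \<bullet> b \<and> x \<bullet> b < p \<bullet> b + t"
        by (rule cj[OF Q1] cj[OF Q2] cj[OF T1] cj[OF T2])+
      show ?thesis unfolding indicator_def m using elim l t(1) by auto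
    qed
    show ?case unfolding fp left_diff_distrib[symmetric] ind ..
  qed
  have cs: "continuous_on UNIV (\<lambda>x. f (x + t *\<^sub>R b))"
    by (rule continuous_on_compose2[OF f]) (auto intro!: continuous_intros)
  have i1: "integrable lborel (\<lambda>x. indicator (box p q) x * f (x + t *\<^sub>R b))"
    by (rule integrable_indicator_bounded_continuous[OF cs]) auto
  have i2: "integrable lborel (\<lambda>x. indicator (box p q) x * f x)"
    by (rule integrable_indicator_bounded_continuous[OF f]) auto
  have i3: "integrable lborel (\<lambda>x. indicator T x * f x)"
    by (rule integrable_indicator_bounded_continuous[OF f]) (auto simp: T_def)
  have i4: "integrable lborel (\<lambda>x. indicator T (x + l *\<^sub>R b) * f (x + l *\<^sub>R b))"
    and e4: "(LINT x|lborel. indicator T (x + l *\<^sub>R b) * f (x + l *\<^sub>R b)) = (LINT x|lborel. indicator T x * f x)"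
    and i5: "integrable lborel (\<lambda>x. indicator (box p q) (x - t *\<^sub>R b) * f x)"
    and e5: "(LINT x|lborel. indicator (box p q) (x - t *\<^sub>R b) * f x) = (LINT x|lborel. indicator (box p q) x * f (x + t *\<^sub>R b))"
  proof -
    have shift_int: "integrable lborel (\<lambda>x. g (x + c))" if "integrable lborel g" for g :: "'a \<Rightarrow> real" and c
    proof -
      have "integrable (distr lborel borel ((+) c)) g" using that by (simp only: lborel_distr_plus)
      then have "integrable lborel (\<lambda>x. g (c + x))"
        by (subst (asm) integrable_distr_eq) (use that in auto)
      then show ?thesis by (simp only: add.commute)
    qed
    show "integrable lborel (\<lambda>x. indicator T (x + l *\<^sub>R b) * f (x + l *\<^sub>R b))"
      by (rule shift_int[OF i3])
    have m3: "(\<lambda>x. indicator T x * f x) \<in> borel_measurable borel" using i3 by simp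
    show "(LINT x|lborel. indicator T (x + l *\<^sub>R b) * f (x + l *\<^sub>R b)) = (LINT x|lborel. indicator T x * f x)"
      by (rule lborel_integral_shift[OF m3])
    show "integrable lborel (\<lambda>x. indicator (box p q) (x - t *\<^sub>R b) * f x)"
      using shift_int[OF i1, of "- (t *\<^sub>R b)"] by simp
    then have m5: "(\<lambda>x. indicator (box p q) (x - t *\<^sub>R b) * f x) \<in> borel_measurable borel" by simp
    show "(LINT x|lborel. indicator (box p q) (x - t *\<^sub>R b) * f x) = (LINT x|lborel. indicator (box p q) x * f (x + t *\<^sub>R b))"
      using lborel_integral_shift[OF m5, of "t *\<^sub>R b"] by simp
  qed
  have "(LINT x|lborel. indicator (box p q) x * (f (x + t *\<^sub>R b) - f x))
      = (LINT x|lborel. indicator (box p q) (x - t *\<^sub>R b) * f x - indicator (box p q) x * f x)"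
    unfolding right_diff_distrib using i1 i2 i5 e5 by simp
  also have "\<dots> = (LINT x|lborel. indicator T x * f x - indicator T (x + l *\<^sub>R b) * f (x + l *\<^sub>R b))"
    by (rule integral_cong_AE) (use i2 i3 i4 i5 ae in auto)
  also have "\<dots> = 0" using i3 i4 e4 by simp
  finally show ?thesis .
qed

lemma integral_gradient_periodic:
  fixes f :: "'a::euclidean_space \<Rightarrow> real"
  assumes f: "C1_on UNIV f" and per: "box_periodic p q f" and b: "b \<in> Basis" and ne: "box p q \<noteq> {}"
  shows "(LINT x|lborel. indicator (box p q) x * (gradient f x \<bullet> b)) = 0"
proof -
  let ?q = "\<lambda>n. LINT x|lborel. indicator (box p q) x * ((f (x + inverse (real (Suc n)) *\<^sub>R b) - f x) * real (Suc n))"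
  have pq: "p \<bullet> i < q \<bullet> i" if "i \<in> Basis" for i using ne that by (simp add: box_ne_empty)
  have lim: "?q \<longlonglongrightarrow> (LINT x|lborel. indicator (box p q) x * (gradient f x \<bullet> b))"
    by (rule difference_quotient_integral[OF f]) auto
  have "0 < (q - p) \<bullet> b" using pq[OF b] by (simp add: inner_diff_left)
  then have "eventually (\<lambda>n. inverse (real (Suc n)) < (q - p) \<bullet> b) sequentially"
    by (rule order_tendstoD(2)[OF LIMSEQ_inverse_real_of_nat])
  then have "eventually (\<lambda>n. ?q n = 0) sequentially"
  proof (rule eventually_mono)
    fix n assume t: "inverse (real (Suc n)) < (q - p) \<bullet> b"
    have "(LINT x|lborel. indicator (box p q) x * (f (x + inverse (real (Suc n)) *\<^sub>R b) - f x)) = 0"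
    proof (rule integral_periodic_shift[OF C1_on_continuous[OF f] _ b pq inverse_Suc_bounds(1) t])
      show "f (x + ((q - p) \<bullet> b) *\<^sub>R b) = f x" for x using per b unfolding box_periodic_def by blast
    qed
    then show "?q n = 0" by (simp only: mult.assoc[symmetric] integral_mult_left_zero mult_zero_left)
  qed
  then have "?q \<longlonglongrightarrow> 0" by (rule tendsto_eventually)
  then show ?thesis using lim LIMSEQ_unique by blast
qed

lemma weighted_flux_periodic:
  assumes ne: "box p q \<noteq> {}" and v: "smooth_on UNIV v" "box_periodic p q v"
    and \<phi>: "C1_on UNIV \<phi>" "box_periodic p q \<phi>"
  shows "weighted_flux (box p q) v \<phi> = 0"
proof -
  let ?X = "\<lambda>b x. \<phi> x * partial_deriv b v x"
  have X: "C1_on UNIV (?X b)" if "b \<in> Basis" for b by (rule C1_on_weighted_gradient[OF \<phi>(1) v(1) that])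
  have per: "box_periodic p q (?X b)" if "b \<in> Basis" for b
    using \<phi>(2) box_periodic_partial_deriv[OF v that] unfolding box_periodic_def by simp
  have i: "integrable lborel (\<lambda>x. indicator (box p q) x * (gradient (?X b) x \<bullet> b))" if "b \<in> Basis" for b
    by (rule integrable_indicator_bounded_continuous)
       (auto intro!: continuous_intros C1_on_gradient X that)
  have "weighted_flux (box p q) v \<phi> = (\<Sum>b\<in>Basis. LINT x|lborel. indicator (box p q) x * (gradient (?X b) x \<bullet> b))"
    unfolding weighted_flux_def divergence_def sum_distrib_left
    by (rule Bochner_Integration.integral_sum) (rule i)
  also have "\<dots> = 0"
    by (intro sum.neutral ballI integral_gradient_periodic X per ne)
  finally show ?thesis .
qed


section \<open>Green's formula under the boundary conditions\<close>

lemma lebesgue_on_open: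
  fixes f :: "'a::euclidean_space \<Rightarrow> real"
  assumes \<Omega>: "open \<Omega>" and f: "f \<in> borel_measurable borel"
  shows "(LINT x|lebesgue_on \<Omega>. f x) = (LINT x|lborel. indicator \<Omega> x * f x)"
    and "integrable (lebesgue_on \<Omega>) f \<longleftrightarrow> integrable lborel (\<lambda>x. indicator \<Omega> x * f x)"
proof -
  have s: "\<Omega> \<inter> space lebesgue \<in> sets lebesgue" using \<Omega> by simp
  have m: "(\<lambda>x. indicator \<Omega> x * f x) \<in> borel_measurable lborel"
    using f \<Omega> by simp
  show "(LINT x|lebesgue_on \<Omega>. f x) = (LINT x|lborel. indicator \<Omega> x * f x)"
    unfolding integral_restrict_space[OF s] real_scaleR_def by (rule integral_completion[OF m])
  show "integrable (lebesgue_on \<Omega>) f \<longleftrightarrow> integrable lborel (\<lambda>x. indicator \<Omega> x * f x)"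
    unfolding integrable_restrict_space[OF s] real_scaleR_def by (rule integrable_completion[OF m])
qed

lemma L2_continuous:
  fixes f :: "'a::euclidean_space \<Rightarrow> real"
  assumes \<Omega>: "open \<Omega>" "bounded \<Omega>" and f: "continuous_on UNIV f"
  shows "L2 \<Omega> f"
proof -
  have fm: "f \<in> borel_measurable borel" by (rule borel_measurable_continuous_onI[OF f])
  have c2: "continuous_on UNIV (\<lambda>x. (f x)\<^sup>2)" by (intro continuous_intros f)
  have "integrable (lebesgue_on \<Omega>) (\<lambda>x. (f x)\<^sup>2)"
    unfolding lebesgue_on_open(2)[OF \<Omega>(1) borel_measurable_continuous_onI[OF c2]]
    by (rule integrable_indicator_bounded_continuous[OF c2 \<Omega>(2)]) (use \<Omega>(1) in simp)
  moreover have "f \<in> borel_measurable (lebesgue_on \<Omega>)"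
    using fm by (intro measurable_restrict_space1 measurable_completion) simp
  ultimately show ?thesis by (simp add: L2_def)
qed

lemma weak_partial_L2:
  assumes "H1 \<Omega> u" "b \<in> Basis" shows "L2 \<Omega> (weak_partial \<Omega> b u)"
proof -
  have "\<exists>g. L2 \<Omega> g \<and> has_weak_partial \<Omega> b u g" using assms unfolding H1_def by blast
  then show ?thesis unfolding weak_partial_def by (rule someI2_ex) blast
qed

lemma H2_L2:
  assumes "H2 \<Omega> u"
  shows "L2 \<Omega> u" "b \<in> Basis \<Longrightarrow> L2 \<Omega> (weak_partial \<Omega> b u)"
    "b \<in> Basis \<Longrightarrow> L2 \<Omega> (weak_partial \<Omega> b (weak_partial \<Omega> b u))"
proof -
  have 1: "H1 \<Omega> u" and 2: "H1 \<Omega> (weak_partial \<Omega> b u)" if "b \<in> Basis" for b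
    using assms that unfolding H2_def by blast+
  show "L2 \<Omega> u" using assms unfolding H2_def H1_def[of \<Omega> u] by (elim conjE)
  show "b \<in> Basis \<Longrightarrow> L2 \<Omega> (weak_partial \<Omega> b u)" by (rule weak_partial_L2[OF 1])
  show "b \<in> Basis \<Longrightarrow> L2 \<Omega> (weak_partial \<Omega> b (weak_partial \<Omega> b u))" by (rule weak_partial_L2[OF 2])
qed

lemma L2norm_real: "L2norm \<Omega> (f :: 'a::euclidean_space \<Rightarrow> real) = sqrt (LINT x|lebesgue_on \<Omega>. (f x)\<^sup>2)"
  by (simp add: L2norm_def)

lemma smooth_partials_C1:
  assumes "smooth_on UNIV v" "b \<in> Basis"
  shows "C1_on UNIV (partial_deriv b v)" "C1_on UNIV (partial_deriv b (partial_deriv b v))"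
  by (intro smooth_on_C1 smooth_on_partial_deriv assms)+

text \<open>
  By the product rule the flux is the sum of the two integrals that occur in Green's formula.
\<close>
lemma weighted_flux_expand:
  assumes \<Omega>: "open \<Omega>" "bounded \<Omega>" and v: "smooth_on UNIV v" and \<phi>: "C1_on UNIV \<phi>"
  shows "weighted_flux \<Omega> v \<phi> = (\<Sum>b\<in>Basis.
    (LINT x|lebesgue_on \<Omega>. partial_deriv b v x * (gradient \<phi> x \<bullet> b))
    + (LINT x|lebesgue_on \<Omega>. partial_deriv b (partial_deriv b v) x * \<phi> x))"
proof -
  let ?f = "\<lambda>b x. partial_deriv b v x * (gradient \<phi> x \<bullet> b)"
  let ?g = "\<lambda>b x. partial_deriv b (partial_deriv b v) x * \<phi> x"
  have cf: "continuous_on UNIV (?f b)" and cg: "continuous_on UNIV (?g b)" if "b \<in> Basis" for b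
    by (intro continuous_intros C1_on_gradient[OF \<phi>] C1_on_continuous[OF \<phi>]
        C1_on_continuous[OF smooth_partials_C1(1)[OF v that]]
        C1_on_continuous[OF smooth_partials_C1(2)[OF v that]])+
  have b\<Omega>: "\<Omega> \<in> sets borel" using \<Omega>(1) by simp
  have i: "integrable lborel (\<lambda>x. indicator \<Omega> x * ?f b x)" "integrable lborel (\<lambda>x. indicator \<Omega> x * ?g b x)" if "b \<in> Basis" for b
    by (rule integrable_indicator_bounded_continuous[OF cf[OF that] \<Omega>(2) b\<Omega>]
        integrable_indicator_bounded_continuous[OF cg[OF that] \<Omega>(2) b\<Omega>])+
  have d: "divergence (\<lambda>b x. \<phi> x * partial_deriv b v x) x = (\<Sum>b\<in>Basis. ?f b x + ?g b x)" for x
    unfolding divergence_def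
  proof (rule sum.cong[OF refl])
    fix b :: 'a assume b: "b \<in> Basis"
    show "gradient (\<lambda>x. \<phi> x * partial_deriv b v x) x \<bullet> b = ?f b x + ?g b x"
      using gradient_mult[OF \<phi> smooth_partials_C1(1)[OF v b], of x]
      by (simp add: inner_add_left gradient_inner_Basis[OF b, of "partial_deriv b v"] mult.commute)
  qed
  have "weighted_flux \<Omega> v \<phi> = (LINT x|lborel. (\<Sum>b\<in>Basis. indicator \<Omega> x * ?f b x + indicator \<Omega> x * ?g b x))"
    unfolding weighted_flux_def d by (simp only: sum_distrib_left distrib_left)
  also have "\<dots> = (\<Sum>b\<in>Basis. LINT x|lborel. indicator \<Omega> x * ?f b x + indicator \<Omega> x * ?g b x)"
    by (rule Bochner_Integration.integral_sum) (intro Bochner_Integration.integrable_add i)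
  also have "\<dots> = (\<Sum>b\<in>Basis. (LINT x|lebesgue_on \<Omega>. ?f b x) + (LINT x|lebesgue_on \<Omega>. ?g b x))"
  proof (rule sum.cong[OF refl])
    fix b :: 'a assume b: "b \<in> Basis"
    show "(LINT x|lborel. indicator \<Omega> x * ?f b x + indicator \<Omega> x * ?g b x)
        = (LINT x|lebesgue_on \<Omega>. ?f b x) + (LINT x|lebesgue_on \<Omega>. ?g b x)"
      unfolding lebesgue_on_open(1)[OF \<Omega>(1) borel_measurable_continuous_onI[OF cf[OF b]]]
        lebesgue_on_open(1)[OF \<Omega>(1) borel_measurable_continuous_onI[OF cg[OF b]]]
      by (rule Bochner_Integration.integral_add[OF i[OF b]])
  qed
  finally show ?thesis .
qed

lemma weighted_flux_limit:
  fixes u :: "'a::euclidean_space \<Rightarrow> real"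
  assumes \<Omega>: "open \<Omega>" "bounded \<Omega>" and u: "H2 \<Omega> u" and v: "smooth_tendsto_H2 \<Omega> v u" and \<phi>: "C1_on UNIV \<phi>"
  shows "(\<lambda>k. weighted_flux \<Omega> (v k) \<phi>) \<longlonglongrightarrow> (\<Sum>b\<in>Basis.
    (LINT x|lebesgue_on \<Omega>. weak_partial \<Omega> b u x * (gradient \<phi> x \<bullet> b))
    + (LINT x|lebesgue_on \<Omega>. weak_partial \<Omega> b (weak_partial \<Omega> b u) x * \<phi> x))"
proof -
  have sm: "smooth_on UNIV (v k)" for k using v unfolding smooth_tendsto_H2_def by blast
  have sq: "sq_integrable (lebesgue_on \<Omega>) f" if "continuous_on UNIV f" for f :: "'a \<Rightarrow> real"
    using L2_continuous[OF \<Omega> that] by (simp only: L2_iff_sq_integrable)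
  show ?thesis
    unfolding weighted_flux_expand[OF \<Omega> sm \<phi>]
  proof (intro tendsto_sum tendsto_add integral_mult_tendsto)
    fix b :: 'a assume b: "b \<in> Basis"
    show "sq_integrable (lebesgue_on \<Omega>) (partial_deriv b (v k))"
      "sq_integrable (lebesgue_on \<Omega>) (partial_deriv b (partial_deriv b (v k)))" for k
      by (intro sq C1_on_continuous smooth_partials_C1 sm b)+
    show "sq_integrable (lebesgue_on \<Omega>) (weak_partial \<Omega> b u)"
      "sq_integrable (lebesgue_on \<Omega>) (weak_partial \<Omega> b (weak_partial \<Omega> b u))"
      using H2_L2[OF u] b by (simp_all add: L2_iff_sq_integrable)
    show "sq_integrable (lebesgue_on \<Omega>) \<phi>" "sq_integrable (lebesgue_on \<Omega>) (\<lambda>x. gradient \<phi> x \<bullet> b)"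
      by (intro sq C1_on_continuous[OF \<phi>] continuous_intros C1_on_gradient[OF \<phi>])+
    show "(\<lambda>k. sqrt (LINT x|lebesgue_on \<Omega>. (partial_deriv b (v k) x - weak_partial \<Omega> b u x)\<^sup>2)) \<longlonglongrightarrow> 0"
      "(\<lambda>k. sqrt (LINT x|lebesgue_on \<Omega>. (partial_deriv b (partial_deriv b (v k)) x
          - weak_partial \<Omega> b (weak_partial \<Omega> b u) x)\<^sup>2)) \<longlonglongrightarrow> 0"
      using v b unfolding smooth_tendsto_H2_def L2norm_real by blast+
  qed
qed

definition jet_of :: "'a::euclidean_space set \<Rightarrow> ('a \<Rightarrow> real) \<Rightarrow> 'a jet" where
  "jet_of \<Omega> u = (u, weak_gradient \<Omega> u, weak_laplacian \<Omega> u)"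

lemma sq_integrable_sum:
  fixes f :: "'i \<Rightarrow> 'a \<Rightarrow> 'b::euclidean_space"
  assumes "finite I" "\<And>i. i \<in> I \<Longrightarrow> sq_integrable M (f i)"
  shows "sq_integrable M (\<lambda>x. \<Sum>i\<in>I. f i x)"
  using assms
proof (induction I rule: finite_induct)
  case empty
  then show ?case by (simp add: sq_integrable_def)
next
  case (insert i I)
  then show ?case
    using sq_integrable_combination[of M "f i" "\<lambda>x. \<Sum>i\<in>I. f i x" 1 1] by simp
qed

lemma weak_gradient_inner:
  "weak_gradient \<Omega> u x \<bullet> weak_gradient \<Omega> w x = (\<Sum>b\<in>Basis. weak_partial \<Omega> b u x * weak_partial \<Omega> b w x)"
proof -
  have "weak_gradient \<Omega> f x \<bullet> b = weak_partial \<Omega> b f x" if "b \<in> Basis" for b f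
    using that by (simp add: weak_gradient_def inner_sum_left inner_Basis if_distrib cong: if_cong)
  then show ?thesis by (subst euclidean_inner) simp
qed

lemma regular_jet_of:
  assumes "H2 \<Omega> u" shows "regular_jet (lebesgue_on \<Omega>) (jet_of \<Omega> u)"
proof -
  have p: "sq_integrable (lebesgue_on \<Omega>) (weak_partial \<Omega> b u)"
    "sq_integrable (lebesgue_on \<Omega>) (weak_partial \<Omega> b (weak_partial \<Omega> b u))" if "b \<in> Basis" for b
    using H2_L2[OF assms] that by (simp_all add: L2_iff_sq_integrable)
  have "sq_integrable (lebesgue_on \<Omega>) (weak_laplacian \<Omega> u)"
    unfolding weak_laplacian_def[abs_def] by (rule sq_integrable_sum) (use p in auto)
  moreover have "sq_integrable (lebesgue_on \<Omega>) (\<lambda>x. weak_partial \<Omega> b u x *\<^sub>R b)" if "b \<in> Basis" for b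
    using p(1)[OF that] that unfolding sq_integrable_def
    by (auto simp: power_mult_distrib intro!: borel_measurable_scaleR)
  then have "sq_integrable (lebesgue_on \<Omega>) (weak_gradient \<Omega> u)"
    unfolding weak_gradient_def[abs_def] by (intro sq_integrable_sum) auto
  ultimately show ?thesis
    using H2_L2(1)[OF assms] by (simp add: regular_jet_def jet_of_def L2_iff_sq_integrable)
qed

text \<open>
  The limits are taken one after the other: first the approximation \<open>v\<close> of \<open>u\<close> with a smooth
  approximation \<open>z m\<close> of \<open>w\<close> held fixed, then that of \<open>w\<close>. With \<open>z m\<close> fixed, smallness of the normal
  derivatives of \<open>v\<close> is enough for the flux to vanish in the limit.
\<close>
lemma green_family_of_flux:
  fixes F :: "('a::euclidean_space \<Rightarrow> real) set"
  assumes \<Omega>: "open \<Omega>" "bounded \<Omega>" and H2: "\<And>u. u \<in> F \<Longrightarrow> H2 \<Omega> u"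
    and approx: "\<And>u. u \<in> F \<Longrightarrow> \<exists>v. smooth_tendsto_H2 \<Omega> v u \<and> A v"
    and flux: "\<And>v z m. A v \<Longrightarrow> (\<And>k. smooth_on UNIV (v k)) \<Longrightarrow> A z \<Longrightarrow> (\<And>k. smooth_on UNIV (z k)) \<Longrightarrow>
      (\<lambda>k::nat. weighted_flux \<Omega> (v k) (z (m::nat))) \<longlonglongrightarrow> 0"
    and flux1: "\<And>v. A v \<Longrightarrow> (\<And>k. smooth_on UNIV (v k)) \<Longrightarrow> (\<lambda>k. weighted_flux \<Omega> (v k) (\<lambda>x. 1)) \<longlonglongrightarrow> 0"
  shows "green_family (lebesgue_on \<Omega>) (jet_of \<Omega> ` F)"
proof -
  let ?M = "lebesgue_on \<Omega>"
  have smooth: "smooth_on UNIV (v k)" if "smooth_tendsto_H2 \<Omega> v u" for v u k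
    using that unfolding smooth_tendsto_H2_def by blast
  have sqp: "sq_integrable ?M u" "b \<in> Basis \<Longrightarrow> sq_integrable ?M (weak_partial \<Omega> b u)"
    "b \<in> Basis \<Longrightarrow> sq_integrable ?M (weak_partial \<Omega> b (weak_partial \<Omega> b u))" if "u \<in> F" for u b
    using H2_L2[OF H2[OF that]] by (simp_all add: L2_iff_sq_integrable)
  have sqc: "sq_integrable ?M f" if "continuous_on UNIV f" for f :: "'a \<Rightarrow> real"
    using L2_continuous[OF \<Omega> that] by (simp only: L2_iff_sq_integrable)
  have lap0: "(LINT x|?M. weak_laplacian \<Omega> u x) = 0" if u: "u \<in> F" for u
  proof -
    obtain v where v: "smooth_tendsto_H2 \<Omega> v u" "A v" using approx[OF u] by blast
    have c1: "C1_on UNIV (\<lambda>x. 1 :: real)" by simp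
    have g1: "gradient (\<lambda>x. 1 :: real) x = 0" for x :: 'a by (rule gradient_eqI) simp
    have i: "integrable ?M (weak_partial \<Omega> b (weak_partial \<Omega> b u))" if "b \<in> Basis" for b
      using sq_integrable_mult[OF sqp(3)[OF u that] sqc[of "\<lambda>x. 1"]] by simp
    have "(\<Sum>b\<in>Basis. (LINT x|?M. weak_partial \<Omega> b u x * (gradient (\<lambda>x. 1) x \<bullet> b))
        + (LINT x|?M. weak_partial \<Omega> b (weak_partial \<Omega> b u) x * 1)) = 0"
      by (rule LIMSEQ_unique[OF weighted_flux_limit[OF \<Omega> H2[OF u] v(1) c1] flux1[OF v(2) smooth[OF v(1)]]])
    then show ?thesis
      unfolding weak_laplacian_def using i by (simp add: g1)
  qed
  have gp: "green_pair ?M (jet_of \<Omega> u) (jet_of \<Omega> w)" if u: "u \<in> F" and w: "w \<in> F" for u w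
  proof -
    obtain v where v: "smooth_tendsto_H2 \<Omega> v u" "A v" using approx[OF u] by blast
    obtain z where z: "smooth_tendsto_H2 \<Omega> z w" "A z" using approx[OF w] by blast
    have zC1: "C1_on UNIV (z m)" for m by (rule smooth_on_C1[OF smooth[OF z(1)]])
    let ?l = "\<lambda>\<phi> \<psi>. \<Sum>b\<in>Basis. (LINT x|?M. weak_partial \<Omega> b u x * \<psi> b x)
        + (LINT x|?M. weak_partial \<Omega> b (weak_partial \<Omega> b u) x * \<phi> x)"
    have m: "?l (z m) (\<lambda>b. partial_deriv b (z m)) = 0" for m
    proof -
      have "?l (z m) (\<lambda>b x. gradient (z m) x \<bullet> b) = 0"
        by (rule LIMSEQ_unique[OF weighted_flux_limit[OF \<Omega> H2[OF u] v(1) zC1]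
            flux[OF v(2) smooth[OF v(1)] z(2) smooth[OF z(1)]]])
      then show ?thesis by (simp add: gradient_inner_Basis)
    qed
    have lim: "(\<lambda>m. ?l (z m) (\<lambda>b. partial_deriv b (z m))) \<longlonglongrightarrow> ?l w (\<lambda>b. weak_partial \<Omega> b w)"
    proof (intro tendsto_sum tendsto_add)
      fix b :: 'a assume b: "b \<in> Basis"
      have "(\<lambda>m. LINT x|?M. partial_deriv b (z m) x * weak_partial \<Omega> b u x)
          \<longlonglongrightarrow> (LINT x|?M. weak_partial \<Omega> b w x * weak_partial \<Omega> b u x)"
      proof (rule integral_mult_tendsto[OF _ sqp(2)[OF w b] sqp(2)[OF u b]])
        show "sq_integrable ?M (partial_deriv b (z m))" for m
          by (intro sqc C1_on_continuous smooth_partials_C1 smooth[OF z(1)] b)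
        show "(\<lambda>m. sqrt (LINT x|?M. (partial_deriv b (z m) x - weak_partial \<Omega> b w x)\<^sup>2)) \<longlonglongrightarrow> 0"
          using z(1) b unfolding smooth_tendsto_H2_def L2norm_real by blast
      qed
      then show "(\<lambda>m. LINT x|?M. weak_partial \<Omega> b u x * partial_deriv b (z m) x)
          \<longlonglongrightarrow> (LINT x|?M. weak_partial \<Omega> b u x * weak_partial \<Omega> b w x)"
        by (simp only: mult.commute)
      have "(\<lambda>m. LINT x|?M. z m x * weak_partial \<Omega> b (weak_partial \<Omega> b u) x)
          \<longlonglongrightarrow> (LINT x|?M. w x * weak_partial \<Omega> b (weak_partial \<Omega> b u) x)"
      proof (rule integral_mult_tendsto[OF _ sqp(1)[OF w] sqp(3)[OF u b]])
        show "sq_integrable ?M (z m)" for m by (intro sqc C1_on_continuous zC1)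
        show "(\<lambda>m. sqrt (LINT x|?M. (z m x - w x)\<^sup>2)) \<longlonglongrightarrow> 0"
          using z(1) unfolding smooth_tendsto_H2_def L2norm_real by blast
      qed
      then show "(\<lambda>m. LINT x|?M. weak_partial \<Omega> b (weak_partial \<Omega> b u) x * z m x)
          \<longlonglongrightarrow> (LINT x|?M. weak_partial \<Omega> b (weak_partial \<Omega> b u) x * w x)"
        by (simp only: mult.commute)
    qed
    have zero: "?l w (\<lambda>b. weak_partial \<Omega> b w) = 0"
      using lim unfolding m by (simp only: LIMSEQ_const_iff)
    have "(LINT x|?M. weak_laplacian \<Omega> u x * w x)
        = (\<Sum>b\<in>Basis. LINT x|?M. weak_partial \<Omega> b (weak_partial \<Omega> b u) x * w x)"
      unfolding weak_laplacian_def sum_distrib_right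
      by (rule Bochner_Integration.integral_sum) (intro sq_integrable_mult sqp u w)
    moreover have "(LINT x|?M. weak_gradient \<Omega> u x \<bullet> weak_gradient \<Omega> w x)
        = (\<Sum>b\<in>Basis. LINT x|?M. weak_partial \<Omega> b u x * weak_partial \<Omega> b w x)"
      unfolding weak_gradient_inner
      by (rule Bochner_Integration.integral_sum) (intro sq_integrable_mult sqp u w)
    ultimately show ?thesis
      using zero unfolding green_pair_def jet_of_def sum.distrib by simp
  qed
  show ?thesis
    unfolding green_family_def using regular_jet_of[OF H2] lap0 gp by (auto simp: jet_of_def)
qed

lemma green_family_periodic:
  assumes ne: "box p q \<noteq> {}" and F: "\<And>u. u \<in> F \<Longrightarrow> H2 (box p q) u \<and> periodic_bc p q u"
  shows "green_family (lebesgue_on (box p q)) (jet_of (box p q) ` F)"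
proof (rule green_family_of_flux[where A = "\<lambda>v. \<forall>k. box_periodic p q (v k)"])
  show "H2 (box p q) u" "\<exists>v. smooth_tendsto_H2 (box p q) v u \<and> (\<forall>k. box_periodic p q (v k))" if "u \<in> F" for u
    using F[OF that] unfolding periodic_bc_def by blast+
  fix v :: "nat \<Rightarrow> 'a \<Rightarrow> real" assume v: "\<forall>k. box_periodic p q (v k)" "\<And>k. smooth_on UNIV (v k)"
  have "weighted_flux (box p q) (v k) (\<lambda>x. 1) = 0" for k
    by (rule weighted_flux_periodic[OF ne v(2)]) (use v(1) in \<open>auto simp: box_periodic_def\<close>)
  then show "(\<lambda>k. weighted_flux (box p q) (v k) (\<lambda>x. 1)) \<longlonglongrightarrow> 0" by simp
  fix z :: "nat \<Rightarrow> 'a \<Rightarrow> real" and m assume z: "\<forall>k. box_periodic p q (z k)" "\<And>k. smooth_on UNIV (z k)"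
  have "weighted_flux (box p q) (v k) (z m) = 0" for k
    by (rule weighted_flux_periodic[OF ne v(2) _ smooth_on_C1[OF z(2)]]) (use v(1) z(1) in blast)+
  then show "(\<lambda>k. weighted_flux (box p q) (v k) (z m)) \<longlonglongrightarrow> 0" by simp
qed auto

lemma green_family_neumann:
  fixes \<Omega> :: "'a::euclidean_space set"
  assumes dim: "DIM('a) \<ge> 2" and \<Omega>: "smooth_bounded_domain \<Omega>"
    and F: "\<And>u. u \<in> F \<Longrightarrow> H2 \<Omega> u \<and> neumann_bc \<Omega> u"
  shows "green_family (lebesgue_on \<Omega>) (jet_of \<Omega> ` F)"
proof (rule green_family_of_flux[where A = "\<lambda>v. (\<lambda>k. normal_flux_sq \<Omega> (v k)) \<longlonglongrightarrow> 0"])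
  show "open \<Omega>" "bounded \<Omega>" using \<Omega> unfolding smooth_bounded_domain_def by blast+
  show "H2 \<Omega> u" "\<exists>v. smooth_tendsto_H2 \<Omega> v u \<and> (\<lambda>k. normal_flux_sq \<Omega> (v k)) \<longlonglongrightarrow> 0" if "u \<in> F" for u
    using F[OF that] unfolding neumann_bc_def has_normal_derivative_def normal_flux_sq_def diff_0_right by blast+
  fix v :: "nat \<Rightarrow> 'a \<Rightarrow> real"
  assume v: "(\<lambda>k. normal_flux_sq \<Omega> (v k)) \<longlonglongrightarrow> 0" "\<And>k. smooth_on UNIV (v k)"
  show "(\<lambda>k. weighted_flux \<Omega> (v k) (\<lambda>x. 1)) \<longlonglongrightarrow> 0"
    by (rule weighted_flux_tendsto_0[OF dim \<Omega> v(2,1) C1_on_const])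
  fix z :: "nat \<Rightarrow> 'a \<Rightarrow> real" and m assume "\<And>k. smooth_on UNIV (z k)"
  then show "(\<lambda>k. weighted_flux \<Omega> (v k) (z m)) \<longlonglongrightarrow> 0"
    by (intro weighted_flux_tendsto_0[OF dim \<Omega> v(2,1)] smooth_on_C1)
qed


section \<open>Energy balance of the scheme\<close>

definition dirichlet :: "'a::euclidean_space measure \<Rightarrow> 'a jet \<Rightarrow> 'a jet \<Rightarrow> real" where
  "dirichlet M s t = (LINT x|M. jgrad s x \<bullet> jgrad t x)"

lemma dirichlet_commute: "dirichlet M s t = dirichlet M t s"
  by (simp add: dirichlet_def inner_commute)

lemma dirichlet_self_nonneg: "0 \<le> dirichlet M t t"
  by (simp add: dirichlet_def)

lemma dirichlet_jcomb:
  assumes "regular_jet M s" "regular_jet M t" "regular_jet M r"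
  shows "dirichlet M r (jcomb a s b t) = a * dirichlet M r s + b * dirichlet M r t"
proof -
  have "integrable M (\<lambda>x. jgrad r x \<bullet> jgrad s x)" "integrable M (\<lambda>x. jgrad r x \<bullet> jgrad t x)"
    using assms unfolding regular_jet_def by (blast intro: sq_integrable_inner)+
  then show ?thesis by (simp add: dirichlet_def jcomb_def inner_add_right)
qed

lemma dirichlet_zero_imp:
  assumes "regular_jet M t" "dirichlet M t t = 0"
  shows "AE x in M. jgrad t x = 0"
proof -
  have "integrable M (\<lambda>x. jgrad t x \<bullet> jgrad t x)"
    using assms(1) unfolding regular_jet_def by (blast intro: sq_integrable_inner)
  then have "AE x in M. jgrad t x \<bullet> jgrad t x = 0"
    using assms(2) integral_nonneg_eq_0_iff_AE[of M "\<lambda>x. jgrad t x \<bullet> jgrad t x"]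
    by (simp add: dirichlet_def)
  then show ?thesis by simp
qed

text \<open>
  The coercivity assumption is applied pointwise to the gradients scaled by \<open>a\<close>.
\<close>
lemma weighted_dirichlet_coercive:
  fixes a :: "3 \<Rightarrow> real" and t :: "3 \<Rightarrow> 'a::euclidean_space jet"
  assumes coercive: "\<And>\<xi> :: 3 \<Rightarrow> 'a. \<xi> 1 + \<xi> 2 + \<xi> 3 = 0 \<Longrightarrow>
         \<Sigma> 1 * (norm (\<xi> 1))\<^sup>2 + \<Sigma> 2 * (norm (\<xi> 2))\<^sup>2 + \<Sigma> 3 * (norm (\<xi> 3))\<^sup>2
           \<ge> \<Sigma>low * ((norm (\<xi> 1))\<^sup>2 + (norm (\<xi> 2))\<^sup>2 + (norm (\<xi> 3))\<^sup>2)"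
    and t: "\<And>i. regular_jet M (t i)"
    and sum0: "AE x in M. a 1 *\<^sub>R jgrad (t 1) x + a 2 *\<^sub>R jgrad (t 2) x + a 3 *\<^sub>R jgrad (t 3) x = 0"
  shows "\<Sigma>low * (\<Sum>i\<in>UNIV. (a i)\<^sup>2 * dirichlet M (t i) (t i))
    \<le> (\<Sum>i\<in>UNIV. \<Sigma> i * (a i)\<^sup>2 * dirichlet M (t i) (t i))"
proof -
  have i: "integrable M (\<lambda>x. jgrad (t i) x \<bullet> jgrad (t i) x)" for i
    using t[of i] unfolding regular_jet_def by (blast intro: sq_integrable_inner)
  have n: "(norm (a i *\<^sub>R jgrad (t i) x))\<^sup>2 = (a i)\<^sup>2 * (jgrad (t i) x \<bullet> jgrad (t i) x)" for i x
    by (simp add: power_mult_distrib power2_norm_eq_inner)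
  have "(LINT x|M. \<Sigma>low * (\<Sum>i\<in>UNIV. (a i)\<^sup>2 * (jgrad (t i) x \<bullet> jgrad (t i) x)))
      \<le> (LINT x|M. (\<Sum>i\<in>UNIV. \<Sigma> i * ((a i)\<^sup>2 * (jgrad (t i) x \<bullet> jgrad (t i) x))))"
  proof (rule integral_mono_AE)
    show "AE x in M. \<Sigma>low * (\<Sum>i\<in>UNIV. (a i)\<^sup>2 * (jgrad (t i) x \<bullet> jgrad (t i) x))
        \<le> (\<Sum>i\<in>UNIV. \<Sigma> i * ((a i)\<^sup>2 * (jgrad (t i) x \<bullet> jgrad (t i) x)))"
      using sum0
    proof (rule AE_mp, intro AE_I2 impI)
      fix x assume "a 1 *\<^sub>R jgrad (t 1) x + a 2 *\<^sub>R jgrad (t 2) x + a 3 *\<^sub>R jgrad (t 3) x = 0"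
      from coercive[of "\<lambda>i. a i *\<^sub>R jgrad (t i) x", OF this]
      show "\<Sigma>low * (\<Sum>i\<in>UNIV. (a i)\<^sup>2 * (jgrad (t i) x \<bullet> jgrad (t i) x))
        \<le> (\<Sum>i\<in>UNIV. \<Sigma> i * ((a i)\<^sup>2 * (jgrad (t i) x \<bullet> jgrad (t i) x)))"
        unfolding n by (simp only: sum_3)
    qed
  qed (intro integrable_mult_right Bochner_Integration.integrable_sum i)+
  then show ?thesis unfolding dirichlet_def using i by (simp add: mult.assoc)
qed

text \<open>
  The scheme on an abstract measure space, where Green's formula is the only property of the
  differential operators that enters.
\<close>
lemma three_phase_energy_decay:
  fixes M :: "'a::euclidean_space measure" and co cn m :: "3 \<Rightarrow> 'a jet"
    and \<Sigma> :: "3 \<Rightarrow> real" and h :: "3 \<Rightarrow> 'a \<Rightarrow> real" and U0 U \<beta> :: "'a \<Rightarrow> real"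
  assumes fin: "finite_measure M"
    and green: "green_family M (range co \<union> range cn \<union> range m)"
    and U: "sq_integrable M U0" "sq_integrable M U"
    and pos: "\<epsilon> > 0" "M\<^sub>0 > 0" "\<delta>t > 0" "\<Sigma>low > 0"
    and \<Sigma>: "\<And>i. \<Sigma> i \<noteq> 0"
    and coercive: "\<And>\<xi> :: 3 \<Rightarrow> 'a. \<xi> 1 + \<xi> 2 + \<xi> 3 = 0 \<Longrightarrow>
         \<Sigma> 1 * (norm (\<xi> 1))\<^sup>2 + \<Sigma> 2 * (norm (\<xi> 2))\<^sup>2 + \<Sigma> 3 * (norm (\<xi> 3))\<^sup>2
           \<ge> \<Sigma>low * ((norm (\<xi> 1))\<^sup>2 + (norm (\<xi> 2))\<^sup>2 + (norm (\<xi> 3))\<^sup>2)"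
    and sum_old: "AE x in M. jval (co 1) x + jval (co 2) x + jval (co 3) x = 1"
    and scheme_c: "\<And>i. AE x in M. (jval (cn i) x - jval (co i) x) / \<delta>t = M\<^sub>0 / \<Sigma> i * jlap (m i) x"
    and scheme_\<mu>: "\<And>i. AE x in M. jval (m i) x
        = - (3 / 4) * \<epsilon> * \<Sigma> i * jlap (cn i) x + 24 / \<epsilon> * h i x * U x + \<beta> x"
    and \<beta>: "\<And>x. 24 / \<epsilon> * (h 1 x / \<Sigma> 1 + h 2 x / \<Sigma> 2 + h 3 x / \<Sigma> 3) * U x
        + (1 / \<Sigma> 1 + 1 / \<Sigma> 2 + 1 / \<Sigma> 3) * \<beta> x = 0"
    and scheme_U: "AE x in M. U x - U0 x = h 1 x * (jval (cn 1) x - jval (co 1) x)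
        + h 2 x * (jval (cn 2) x - jval (co 2) x) + h 3 x * (jval (cn 3) x - jval (co 3) x)"
  shows "1 / \<delta>t * ((\<Sum>i\<in>UNIV. 3 / 8 * \<Sigma> i * \<epsilon> * (dirichlet M (cn i) (cn i) - dirichlet M (co i) (co i)))
        + 12 / \<epsilon> * ((LINT x|M. (U x)\<^sup>2) - (LINT x|M. (U0 x)\<^sup>2)))
      \<le> - M\<^sub>0 * \<Sigma>low * (\<Sum>i\<in>UNIV. dirichlet M (m i) (m i) / (\<Sigma> i)\<^sup>2)"
proof -
  let ?T = "range co \<union> range cn \<union> range m"
  have fam: "green_family M (jspan ?T)" by (rule green_family_jspan[OF fin green])
  have reg: "regular_jet M t" and lap0: "(LINT x|M. jlap t x) = 0" if "t \<in> jspan ?T" for t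
    using fam that unfolding green_family_def by blast+
  have gr: "(LINT x|M. jlap s x * jval t x) = - dirichlet M s t" if "s \<in> jspan ?T" "t \<in> jspan ?T" for s t
    using fam that unfolding green_family_def green_pair_def dirichlet_def by blast
  have sp: "co i \<in> jspan ?T" "cn i \<in> jspan ?T" "m i \<in> jspan ?T" for i
    by (blast intro: jspan.base)+
  define d where "d i = jcomb 1 (cn i) (-1) (co i)" for i
  define S where "S = jcomb 1 (jcomb 1 (cn 1) 1 (cn 2)) 1 (cn 3)"
  define S0 where "S0 = jcomb 1 (jcomb 1 (co 1) 1 (co 2)) 1 (co 3)"
  define D where "D = jcomb 1 S (-1) S0"
  define \<Theta> where "\<Theta> = jcomb 1 (jcomb (1 / \<Sigma> 1) (m 1) (1 / \<Sigma> 2) (m 2)) (1 / \<Sigma> 3) (m 3)"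
  have sp': "d i \<in> jspan ?T" "S \<in> jspan ?T" "S0 \<in> jspan ?T" "D \<in> jspan ?T" "\<Theta> \<in> jspan ?T" for i
    unfolding d_def S_def S0_def D_def \<Theta>_def by (intro jspan.comb sp)+
  have val_d: "jval (d i) x = jval (cn i) x - jval (co i) x" for i x
    by (simp add: d_def jcomb_def)
  have val_D: "jval D x = jval (d 1) x + jval (d 2) x + jval (d 3) x"
    and grad_D: "jgrad D x = jgrad (d 1) x + jgrad (d 2) x + jgrad (d 3) x" for x
    by (simp_all add: D_def S_def S0_def d_def jcomb_def)
  have val_\<Theta>: "jval \<Theta> x = jval (m 1) x / \<Sigma> 1 + jval (m 2) x / \<Sigma> 2 + jval (m 3) x / \<Sigma> 3"
    and lap_\<Theta>: "jlap \<Theta> x = jlap (m 1) x / \<Sigma> 1 + jlap (m 2) x / \<Sigma> 2 + jlap (m 3) x / \<Sigma> 3"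
    and grad_\<Theta>: "jgrad \<Theta> x = (1 / \<Sigma> 1) *\<^sub>R jgrad (m 1) x + (1 / \<Sigma> 2) *\<^sub>R jgrad (m 2) x + (1 / \<Sigma> 3) *\<^sub>R jgrad (m 3) x" for x
    by (simp_all add: \<Theta>_def jcomb_def)
  have lap_S: "jlap S x = jlap (cn 1) x + jlap (cn 2) x + jlap (cn 3) x" for x
    by (simp add: S_def jcomb_def)
  have val_S0: "jval S0 x = jval (co 1) x + jval (co 2) x + jval (co 3) x" for x
    by (simp add: S0_def jcomb_def)
  have sqi: "sq_integrable M (jval t)" "sq_integrable M (jlap t)" "sq_integrable M (jgrad t)"
    if "t \<in> jspan ?T" for t
    using reg[OF that] unfolding regular_jet_def by blast+
  have meas: "jval t \<in> borel_measurable M" "jlap t \<in> borel_measurable M" if "t \<in> jspan ?T" for t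
    using sqi[OF that] unfolding sq_integrable_def by blast+

  note ms = borel_measurable_times meas[OF sp(2)] meas[OF sp(3)] meas[OF sp'(1)]
    meas[OF sp'(2)] meas[OF sp'(3)] meas[OF sp'(4)] meas[OF sp'(5)]
  have S0_one: "AE x in M. jval S0 x = 1" using sum_old by (simp only: val_S0)
  have step_d: "AE x in M. jval (d i) x = \<delta>t * M\<^sub>0 / \<Sigma> i * jlap (m i) x" for i
    using scheme_c[of i]
  proof (rule AE_mp, intro AE_I2 impI)
    fix x assume "(jval (cn i) x - jval (co i) x) / \<delta>t = M\<^sub>0 / \<Sigma> i * jlap (m i) x"
    then have "jval (cn i) x - jval (co i) x = M\<^sub>0 / \<Sigma> i * jlap (m i) x * \<delta>t"
      using pos(3) by (simp add: divide_eq_eq)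
    then show "jval (d i) x = \<delta>t * M\<^sub>0 / \<Sigma> i * jlap (m i) x" by (simp add: val_d)
  qed
  have D_lap: "AE x in M. jval D x = \<delta>t * M\<^sub>0 * jlap \<Theta> x"
    using step_d[of 1] step_d[of 2] step_d[of 3]
    by eventually_elim (simp add: val_D lap_\<Theta> algebra_simps)
  have \<Theta>_lap: "AE x in M. jval \<Theta> x = - (3 / 4) * \<epsilon> * jlap S x"
    using scheme_\<mu>[of 1] scheme_\<mu>[of 2] scheme_\<mu>[of 3]
  proof eventually_elim
    case (elim x)
    have q: "(- (3 / 4) * \<epsilon> * s * l + 24 / \<epsilon> * k * u + b) / s
        = - (3 / 4) * \<epsilon> * l + 24 / \<epsilon> * (k / s) * u + 1 / s * b" if "s \<noteq> 0" for s l k u b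
      using that by (simp add: add_divide_distrib diff_divide_distrib)
    have "jval \<Theta> x = - (3 / 4) * \<epsilon> * jlap S x
        + (24 / \<epsilon> * (h 1 x / \<Sigma> 1 + h 2 x / \<Sigma> 2 + h 3 x / \<Sigma> 3) * U x
        + (1 / \<Sigma> 1 + 1 / \<Sigma> 2 + 1 / \<Sigma> 3) * \<beta> x)"
      unfolding val_\<Theta> elim q[OF \<Sigma>] lap_S by (simp only: algebra_simps)
    then show ?case unfolding \<beta> by simp
  qed

  \<comment> \<open>The product of \<open>D\<close> and \<open>\<Theta>\<close> is computed twice, once from each of the summed equations.\<close>
  have D\<Theta>1: "(LINT x|M. jval D x * jval \<Theta> x) = - (\<delta>t * M\<^sub>0 * dirichlet M \<Theta> \<Theta>)"
  proof -
    have "(LINT x|M. jval D x * jval \<Theta> x) = (LINT x|M. \<delta>t * M\<^sub>0 * (jlap \<Theta> x * jval \<Theta> x))"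
      by (rule integral_cong_AE) (use D_lap ms in auto)
    also have "\<dots> = \<delta>t * M\<^sub>0 * - dirichlet M \<Theta> \<Theta>"
      unfolding gr[OF sp'(5,5), symmetric] by simp
    finally show ?thesis by simp
  qed
  have SD: "dirichlet M S D = dirichlet M D D"
  proof -
    \<comment> \<open>The old total concentration is constant, so its product with the Laplacian of \<open>D\<close> has integral zero.\<close>
    have one: "dirichlet M D S0 = 0"
    proof -
      have "- dirichlet M D S0 = (LINT x|M. jlap D x * jval S0 x)" by (simp add: gr[OF sp'(4,3)])
      also have "\<dots> = (LINT x|M. jlap D x)"
        by (rule integral_cong_AE) (use S0_one ms in auto)
      also have "\<dots> = 0" by (rule lap0[OF sp'(4)])
      finally show ?thesis by simp
    qed
    have "dirichlet M D D = 1 * dirichlet M D S + (-1) * dirichlet M D S0"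
      unfolding D_def by (rule dirichlet_jcomb) (use reg sp' in \<open>simp_all add: D_def[symmetric]\<close>)
    then show ?thesis using one by (simp add: dirichlet_commute)
  qed
  have D\<Theta>2: "(LINT x|M. jval D x * jval \<Theta> x) = 3 / 4 * \<epsilon> * dirichlet M D D"
  proof -
    have "(LINT x|M. jval D x * jval \<Theta> x) = (LINT x|M. - (3 / 4) * \<epsilon> * (jlap S x * jval D x))"
      by (rule integral_cong_AE) (use \<Theta>_lap ms in auto)
    also have "\<dots> = - (3 / 4) * \<epsilon> * - dirichlet M S D"
      unfolding gr[OF sp'(2,4), symmetric] by (rule integral_mult_right_zero)
    finally show ?thesis by (simp add: SD)
  qed
  have zero: "dirichlet M D D = 0" "dirichlet M \<Theta> \<Theta> = 0"
  proof -
    have "3 / 4 * \<epsilon> * dirichlet M D D + \<delta>t * M\<^sub>0 * dirichlet M \<Theta> \<Theta> = 0"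
      using D\<Theta>1 D\<Theta>2 by simp
    moreover have "0 \<le> 3 / 4 * \<epsilon> * dirichlet M D D" "0 \<le> \<delta>t * M\<^sub>0 * dirichlet M \<Theta> \<Theta>"
      using pos by (simp_all add: dirichlet_self_nonneg)
    ultimately have "3 / 4 * \<epsilon> * dirichlet M D D = 0" "\<delta>t * M\<^sub>0 * dirichlet M \<Theta> \<Theta> = 0" by linarith+
    then show "dirichlet M D D = 0" "dirichlet M \<Theta> \<Theta> = 0" using pos by simp_all
  qed
  have gradD0: "AE x in M. jgrad D x = 0" by (rule dirichlet_zero_imp[OF reg[OF sp'(4)] zero(1)])
  have grad\<Theta>0: "AE x in M. jgrad \<Theta> x = 0" by (rule dirichlet_zero_imp[OF reg[OF sp'(5)] zero(2)])
  have D0: "AE x in M. jval D x = 0"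
  proof -
    have "(LINT x|M. jval D x * jval D x) = (LINT x|M. \<delta>t * M\<^sub>0 * (jlap \<Theta> x * jval D x))"
      by (rule integral_cong_AE) (use D_lap ms in auto)
    also have "\<dots> = \<delta>t * M\<^sub>0 * - dirichlet M \<Theta> D"
      unfolding gr[OF sp'(5,4), symmetric] by simp
    also have "dirichlet M \<Theta> D = 0"
      unfolding dirichlet_def by (rule integral_eq_zero_AE) (use gradD0 in auto)
    finally have "(LINT x|M. jval D x * jval D x) = 0" by simp
    then have "AE x in M. jval D x * jval D x = 0"
      using integral_nonneg_eq_0_iff_AE[of M "\<lambda>x. jval D x * jval D x"] sq_integrable_mult[OF sqi(1,1)] sp'(4)
      by simp
    then show ?thesis by simp
  qed

  \<comment> \<open>\<open>R i\<close> is the part of the potential with \<open>h\<close> and \<open>\<beta>\<close>. Unlike its two summands it is known to be square integrable.\<close>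
  define R where "R i x = jval (m i) x + 3 / 4 * \<epsilon> * \<Sigma> i * jlap (cn i) x" for i x
  have sqR: "sq_integrable M (R i)" for i
    unfolding R_def
    using sq_integrable_real_combination[OF sqi(1)[OF sp(3)] sqi(2)[OF sp(2)], of 1 i "3 / 4 * \<epsilon> * \<Sigma> i" i]
    by (simp only: mult_1)
  have R_eq: "AE x in M. R i x = 24 / \<epsilon> * h i x * U x + \<beta> x" for i
    using scheme_\<mu>[of i] by eventually_elim (simp add: R_def)
  have iRd: "integrable M (\<lambda>x. R i x * jval (d i) x)" for i
    by (rule sq_integrable_mult[OF sqR sqi(1)[OF sp'(1)]])
  have iU: "integrable M (\<lambda>x. (U x)\<^sup>2)" "integrable M (\<lambda>x. (U0 x)\<^sup>2)"
    using U unfolding sq_integrable_def by simp_all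
  have U_part: "12 / \<epsilon> * ((LINT x|M. (U x)\<^sup>2) - (LINT x|M. (U0 x)\<^sup>2)) \<le> (\<Sum>i\<in>UNIV. LINT x|M. R i x * jval (d i) x)"
  proof -
    have "12 / \<epsilon> * ((LINT x|M. (U x)\<^sup>2) - (LINT x|M. (U0 x)\<^sup>2)) = (LINT x|M. 12 / \<epsilon> * ((U x)\<^sup>2 - (U0 x)\<^sup>2))"
      using iU by simp
    also have "\<dots> \<le> (LINT x|M. (\<Sum>i\<in>UNIV. R i x * jval (d i) x))"
    proof (rule integral_mono_AE)
      show "integrable M (\<lambda>x. 12 / \<epsilon> * ((U x)\<^sup>2 - (U0 x)\<^sup>2))" using iU by simp
      show "integrable M (\<lambda>x. \<Sum>i\<in>UNIV. R i x * jval (d i) x)"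
        by (intro Bochner_Integration.integrable_sum iRd)
      show "AE x in M. 12 / \<epsilon> * ((U x)\<^sup>2 - (U0 x)\<^sup>2) \<le> (\<Sum>i\<in>UNIV. R i x * jval (d i) x)"
        using R_eq[of 1] R_eq[of 2] R_eq[of 3] scheme_U D0
      proof eventually_elim
        case (elim x)
        have "(\<Sum>i\<in>UNIV. R i x * jval (d i) x)
            = 24 / \<epsilon> * U x * (h 1 x * jval (d 1) x + h 2 x * jval (d 2) x + h 3 x * jval (d 3) x)
              + \<beta> x * jval D x"
          unfolding sum_3 elim(1-3) val_D by (simp only: algebra_simps)
        also have "\<dots> = 24 / \<epsilon> * U x * (U x - U0 x)" using elim(4,5) by (simp add: val_d)
        also have "\<dots> = 12 / \<epsilon> * ((U x)\<^sup>2 - (U0 x)\<^sup>2 + (U x - U0 x)\<^sup>2)"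
        proof -
          have "2 * (U x * (U x - U0 x)) = (U x)\<^sup>2 - (U0 x)\<^sup>2 + (U x - U0 x)\<^sup>2"
            by (simp add: power2_eq_square algebra_simps)
          moreover have "24 / \<epsilon> * U x * (U x - U0 x) = 12 / \<epsilon> * (2 * (U x * (U x - U0 x)))" by simp
          ultimately show ?thesis by (simp only:)
        qed
        finally show ?case using pos(1) by (simp add: distrib_left)
      qed
    qed
    also have "\<dots> = (\<Sum>i\<in>UNIV. LINT x|M. R i x * jval (d i) x)"
      by (rule Bochner_Integration.integral_sum) (rule iRd)
    finally show ?thesis .
  qed

  \<comment> \<open>The two ways of testing: with the mass balance, and with the equation for the potential.\<close>
  have md1: "(LINT x|M. jval (m i) x * jval (d i) x) = - (\<delta>t * M\<^sub>0 * (dirichlet M (m i) (m i) / \<Sigma> i))" for i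
  proof -
    have "(LINT x|M. jval (m i) x * jval (d i) x) = (LINT x|M. \<delta>t * M\<^sub>0 / \<Sigma> i * (jlap (m i) x * jval (m i) x))"
      by (rule integral_cong_AE) (use step_d[of i] ms in auto)
    also have "\<dots> = \<delta>t * M\<^sub>0 / \<Sigma> i * - dirichlet M (m i) (m i)"
      unfolding gr[OF sp(3,3), symmetric] by (rule integral_mult_right_zero)
    finally show ?thesis by simp
  qed
  have md2: "(LINT x|M. jval (m i) x * jval (d i) x)
      = 3 / 4 * \<epsilon> * \<Sigma> i * dirichlet M (cn i) (d i) + (LINT x|M. R i x * jval (d i) x)" for i
  proof -
    have i: "integrable M (\<lambda>x. jlap (cn i) x * jval (d i) x)"
      by (rule sq_integrable_mult[OF sqi(2)[OF sp(2)] sqi(1)[OF sp'(1)]])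
    have "(LINT x|M. jval (m i) x * jval (d i) x)
        = (LINT x|M. R i x * jval (d i) x - 3 / 4 * \<epsilon> * \<Sigma> i * (jlap (cn i) x * jval (d i) x))"
      by (rule Bochner_Integration.integral_cong) (simp_all add: R_def algebra_simps)
    also have "\<dots> = (LINT x|M. R i x * jval (d i) x) - 3 / 4 * \<epsilon> * \<Sigma> i * (LINT x|M. jlap (cn i) x * jval (d i) x)"
      using i iRd[of i] by simp
    finally show ?thesis unfolding gr[OF sp(2) sp'(1)] by simp
  qed
  have polar: "2 * dirichlet M (cn i) (d i)
      = dirichlet M (cn i) (cn i) - dirichlet M (co i) (co i) + dirichlet M (d i) (d i)" for i
  proof -
    have r: "regular_jet M (cn i)" "regular_jet M (co i)" "regular_jet M (d i)" using reg sp sp' by blast+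
    have 1: "dirichlet M (cn i) (d i) = dirichlet M (cn i) (cn i) - dirichlet M (cn i) (co i)"
      unfolding d_def using dirichlet_jcomb[OF r(1,2,1), of 1 "-1"] by simp
    have 2: "dirichlet M (co i) (d i) = dirichlet M (co i) (cn i) - dirichlet M (co i) (co i)"
      unfolding d_def using dirichlet_jcomb[OF r(1,2,2), of 1 "-1"] by simp
    have "dirichlet M (d i) (d i) = dirichlet M (d i) (cn i) - dirichlet M (d i) (co i)"
      using dirichlet_jcomb[OF r(1,2,3), of 1 "-1"] by (simp add: d_def[symmetric])
    then show ?thesis
      using 1 2 dirichlet_commute[of M "d i" "cn i"] dirichlet_commute[of M "d i" "co i"]
        dirichlet_commute[of M "cn i" "co i"] by linarith
  qed
  have d_nonneg: "0 \<le> (\<Sum>i\<in>UNIV. \<Sigma> i * dirichlet M (d i) (d i))"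
  proof -
    have "\<Sigma>low * (\<Sum>i\<in>UNIV. 1\<^sup>2 * dirichlet M (d i) (d i)) \<le> (\<Sum>i\<in>UNIV. \<Sigma> i * 1\<^sup>2 * dirichlet M (d i) (d i))"
      by (rule weighted_dirichlet_coercive[OF coercive]) (use gradD0 reg sp' in \<open>auto simp: grad_D\<close>)
    moreover have "0 \<le> \<Sigma>low * (\<Sum>i\<in>UNIV. 1\<^sup>2 * dirichlet M (d i) (d i))"
      using pos(4) by (intro mult_nonneg_nonneg sum_nonneg) (auto simp: dirichlet_self_nonneg)
    ultimately show ?thesis by simp
  qed
  have diss: "\<Sigma>low * (\<Sum>i\<in>UNIV. dirichlet M (m i) (m i) / (\<Sigma> i)\<^sup>2) \<le> (\<Sum>i\<in>UNIV. dirichlet M (m i) (m i) / \<Sigma> i)"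
  proof -
    have "\<Sigma>low * (\<Sum>i\<in>UNIV. (1 / \<Sigma> i)\<^sup>2 * dirichlet M (m i) (m i))
        \<le> (\<Sum>i\<in>UNIV. \<Sigma> i * (1 / \<Sigma> i)\<^sup>2 * dirichlet M (m i) (m i))"
      by (rule weighted_dirichlet_coercive[OF coercive, where a = "\<lambda>i. 1 / \<Sigma> i"])
         (use grad\<Theta>0 reg sp in \<open>auto simp: grad_\<Theta>\<close>)
    moreover have "\<Sigma> i * (1 / \<Sigma> i)\<^sup>2 * x = x / \<Sigma> i" for i x
      using \<Sigma>[of i] by (simp add: power2_eq_square)
    moreover have "(1 / \<Sigma> i)\<^sup>2 * x = x / (\<Sigma> i)\<^sup>2" for i x by (simp add: power_divide)
    ultimately show ?thesis by (simp only:)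
  qed
  have "(\<Sum>i\<in>UNIV. 3 / 8 * \<Sigma> i * \<epsilon> * (dirichlet M (cn i) (cn i) - dirichlet M (co i) (co i)))
      = (\<Sum>i\<in>UNIV. 3 / 4 * \<epsilon> * \<Sigma> i * dirichlet M (cn i) (d i) - 3 / 8 * \<epsilon> * (\<Sigma> i * dirichlet M (d i) (d i)))"
  proof (rule sum.cong[OF refl])
    fix i :: 3
    have "dirichlet M (cn i) (cn i) - dirichlet M (co i) (co i)
        = 2 * dirichlet M (cn i) (d i) - dirichlet M (d i) (d i)" using polar[of i] by simp
    moreover have "3 / 8 * s * \<epsilon> * (2 * a - b) = 3 / 4 * \<epsilon> * s * a - 3 / 8 * \<epsilon> * (s * b)" for s a b
      by (simp add: field_simps)
    ultimately show "3 / 8 * \<Sigma> i * \<epsilon> * (dirichlet M (cn i) (cn i) - dirichlet M (co i) (co i))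
      = 3 / 4 * \<epsilon> * \<Sigma> i * dirichlet M (cn i) (d i) - 3 / 8 * \<epsilon> * (\<Sigma> i * dirichlet M (d i) (d i))"
      by (simp only:)
  qed
  also have "\<dots> = (\<Sum>i\<in>UNIV. 3 / 4 * \<epsilon> * \<Sigma> i * dirichlet M (cn i) (d i))
      - 3 / 8 * \<epsilon> * (\<Sum>i\<in>UNIV. \<Sigma> i * dirichlet M (d i) (d i))"
    by (simp only: sum_subtractf sum_distrib_left)
  also have "\<dots> \<le> (\<Sum>i\<in>UNIV. 3 / 4 * \<epsilon> * \<Sigma> i * dirichlet M (cn i) (d i))"
    using d_nonneg pos(1) by simp
  finally have "(\<Sum>i\<in>UNIV. 3 / 8 * \<Sigma> i * \<epsilon> * (dirichlet M (cn i) (cn i) - dirichlet M (co i) (co i)))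
        + 12 / \<epsilon> * ((LINT x|M. (U x)\<^sup>2) - (LINT x|M. (U0 x)\<^sup>2))
      \<le> (\<Sum>i\<in>UNIV. 3 / 4 * \<epsilon> * \<Sigma> i * dirichlet M (cn i) (d i)) + (\<Sum>i\<in>UNIV. LINT x|M. R i x * jval (d i) x)"
    using U_part by linarith
  also have "\<dots> = (\<Sum>i\<in>UNIV. LINT x|M. jval (m i) x * jval (d i) x)"
    by (simp only: md2 sum.distrib)
  also have "\<dots> = - (\<delta>t * M\<^sub>0 * (\<Sum>i\<in>UNIV. dirichlet M (m i) (m i) / \<Sigma> i))"
    by (simp only: md1 sum_negf sum_distrib_left)
  also have "\<dots> \<le> - (\<delta>t * M\<^sub>0 * (\<Sigma>low * (\<Sum>i\<in>UNIV. dirichlet M (m i) (m i) / (\<Sigma> i)\<^sup>2)))"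
    using diss pos by (intro le_imp_neg_le mult_left_mono) auto
  finally have main: "(\<Sum>i\<in>UNIV. 3 / 8 * \<Sigma> i * \<epsilon> * (dirichlet M (cn i) (cn i) - dirichlet M (co i) (co i)))
        + 12 / \<epsilon> * ((LINT x|M. (U x)\<^sup>2) - (LINT x|M. (U0 x)\<^sup>2))
      \<le> - (\<delta>t * M\<^sub>0 * (\<Sigma>low * (\<Sum>i\<in>UNIV. dirichlet M (m i) (m i) / (\<Sigma> i)\<^sup>2)))" .
  have "1 / \<delta>t * E \<le> - M\<^sub>0 * \<Sigma>low * Q" if "E \<le> - (\<delta>t * M\<^sub>0 * (\<Sigma>low * Q))" for E Q
  proof -
    have "1 / \<delta>t * E \<le> 1 / \<delta>t * - (\<delta>t * M\<^sub>0 * (\<Sigma>low * Q))"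
      using that pos(3) by (intro mult_left_mono) auto
    also have "\<dots> = - M\<^sub>0 * \<Sigma>low * Q" using pos(3) by simp
    finally show ?thesis .
  qed
  from this[OF main] show ?thesis .
qed


section \<open>Unconditional energy stability\<close>

theorem theorem3p3:
  fixes \<Omega> :: "'a::euclidean_space set"
    and \<epsilon> M\<^sub>0 \<Lambda> B \<delta>t \<Sigma>low :: real
    and \<sigma> :: "3 \<Rightarrow> 3 \<Rightarrow> real"
    and \<Sigma> :: "3 \<Rightarrow> real"
    and c_old c_new \<mu>_new :: "3 \<Rightarrow> 'a \<Rightarrow> real"
    and U_old U_new :: "'a \<Rightarrow> real"
    and H :: "3 \<Rightarrow> 'a \<Rightarrow> real"
  assumes dim: "DIM('a) = 2 \<or> DIM('a) = 3"
    and params: "\<epsilon> > 0" "M\<^sub>0 > 0" "\<Lambda> \<ge> 0"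
    and tension: "\<And>i j. i \<noteq> j \<Longrightarrow> \<sigma> i j > 0" "\<And>i j. \<sigma> i j = \<sigma> j i"
    and \<Sigma>_eq: "\<And>i. \<Sigma> i = \<sigma> i (i + 1) + \<sigma> i (i + 2) - \<sigma> (i + 1) (i + 2)"
    and \<Sigma>_nonzero: "\<And>i. \<Sigma> i \<noteq> 0" "1 / \<Sigma> 1 + 1 / \<Sigma> 2 + 1 / \<Sigma> 3 \<noteq> 0"
    and \<Sigma>_pos: "\<Sigma> 1 * \<Sigma> 2 + \<Sigma> 1 * \<Sigma> 3 + \<Sigma> 2 * \<Sigma> 3 > 0"
               "\<And>i j. i \<noteq> j \<Longrightarrow> \<Sigma> i + \<Sigma> j > 0"
    and \<Sigma>low: "\<Sigma>low > 0"
      "\<And>\<xi> :: 3 \<Rightarrow> 'a. \<xi> 1 + \<xi> 2 + \<xi> 3 = 0 \<Longrightarrow>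
         \<Sigma> 1 * (norm (\<xi> 1))\<^sup>2 + \<Sigma> 2 * (norm (\<xi> 2))\<^sup>2 + \<Sigma> 3 * (norm (\<xi> 3))\<^sup>2
           \<ge> \<Sigma>low * ((norm (\<xi> 1))\<^sup>2 + (norm (\<xi> 2))\<^sup>2 + (norm (\<xi> 3))\<^sup>2)"
    and B: "\<And>c. c 1 + c 2 + c 3 = 1 \<Longrightarrow> potential \<Sigma> \<Lambda> c + B > 0"
    and regularity: "\<And>i. H2 \<Omega> (c_old i)" "\<And>i. H2 \<Omega> (c_new i)" "\<And>i. H2 \<Omega> (\<mu>_new i)"
      "L2 \<Omega> U_old" "L2 \<Omega> U_new"
    and domain_bc:
      "(\<exists>p q. box p q \<noteq> {} \<and> \<Omega> = box p q \<and>
         (\<forall>i. periodic_bc p q (c_old i) \<and> periodic_bc p q (c_new i) \<and>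
              periodic_bc p q (\<mu>_new i)))
       \<or> (smooth_bounded_domain \<Omega> \<and>
         (\<forall>i. neumann_bc \<Omega> (c_old i) \<and> neumann_bc \<Omega> (c_new i) \<and>
              neumann_bc \<Omega> (\<mu>_new i)))"
    and sum_old: "AE x in lebesgue_on \<Omega>. c_old 1 x + c_old 2 x + c_old 3 x = 1"
    and H_eq: "\<And>i x. H i x = Hfun \<Sigma> \<Lambda> B i (\<lambda>j. c_old j x)"
    and step: "\<delta>t > 0"
    and scheme_c: "\<And>i. AE x in lebesgue_on \<Omega>.
        (c_new i x - c_old i x) / \<delta>t = M\<^sub>0 / \<Sigma> i * weak_laplacian \<Omega> (\<mu>_new i) x"
    and scheme_\<mu>: "\<And>i. AE x in lebesgue_on \<Omega>.
        \<mu>_new i x = - (3 / 4) * \<epsilon> * \<Sigma> i * weak_laplacian \<Omega> (c_new i) x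
                    + 24 / \<epsilon> * H i x * U_new x
                    + beta \<Sigma> \<epsilon> (\<lambda>j. H j x) (U_new x)"
    and scheme_U: "AE x in lebesgue_on \<Omega>.
        U_new x - U_old x = H 1 x * (c_new 1 x - c_old 1 x) + H 2 x * (c_new 2 x - c_old 2 x)
                            + H 3 x * (c_new 3 x - c_old 3 x)"
  shows "1 / \<delta>t * (energy_1st \<Omega> \<Sigma> \<epsilon> B c_new U_new - energy_1st \<Omega> \<Sigma> \<epsilon> B c_old U_old)
         \<le> - M\<^sub>0 * \<Sigma>low * (\<Sum>i\<in>UNIV. (L2norm \<Omega> (weak_gradient \<Omega> (\<mu>_new i)))\<^sup>2 / (\<Sigma> i)\<^sup>2)"
proof -
  let ?M = "lebesgue_on \<Omega>"
  let ?F = "range c_old \<union> range c_new \<union> range \<mu>_new"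
  have dim2: "DIM('a) \<ge> 2" using dim by linarith
  have H2F: "H2 \<Omega> u" if "u \<in> ?F" for u using that regularity(1-3) by blast
  have "open \<Omega> \<and> bounded \<Omega> \<and> green_family ?M (jet_of \<Omega> ` ?F)"
    using domain_bc
  proof (elim disjE exE conjE)
    fix p q
    assume pq: "box p q \<noteq> {}" "\<Omega> = box p q"
      and bc: "\<forall>i. periodic_bc p q (c_old i) \<and> periodic_bc p q (c_new i) \<and> periodic_bc p q (\<mu>_new i)"
    have "periodic_bc p q u" if "u \<in> ?F" for u using that bc by blast
    then show ?thesis using green_family_periodic[OF pq(1), of ?F] H2F unfolding pq(2) by (simp add: open_box)
  next
    assume \<Omega>: "smooth_bounded_domain \<Omega>"
      and bc: "\<forall>i. neumann_bc \<Omega> (c_old i) \<and> neumann_bc \<Omega> (c_new i) \<and> neumann_bc \<Omega> (\<mu>_new i)"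
    have "neumann_bc \<Omega> u" if "u \<in> ?F" for u using that bc by blast
    then have "green_family ?M (jet_of \<Omega> ` ?F)" by (intro green_family_neumann[OF dim2 \<Omega>] conjI H2F)
    then show ?thesis using \<Omega> unfolding smooth_bounded_domain_def by blast
  qed
  then have \<Omega>: "open \<Omega>" "bounded \<Omega>" and fam: "green_family ?M (jet_of \<Omega> ` ?F)" by blast+
  have fin: "finite_measure ?M"
    using \<Omega> by (intro finite_measure_lebesgue_on bounded_set_imp_lmeasurable) auto
  have "jet_of \<Omega> ` ?F = range (\<lambda>i. jet_of \<Omega> (c_old i)) \<union> range (\<lambda>i. jet_of \<Omega> (c_new i))
      \<union> range (\<lambda>i. jet_of \<Omega> (\<mu>_new i))"
    by (simp only: image_Un image_image)
  with fam have green: "green_family ?M (range (\<lambda>i. jet_of \<Omega> (c_old i)) \<union> range (\<lambda>i. jet_of \<Omega> (c_new i))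
      \<union> range (\<lambda>i. jet_of \<Omega> (\<mu>_new i)))" by simp
  have U: "sq_integrable ?M U_old" "sq_integrable ?M U_new"
    using regularity(4,5) by (simp_all only: L2_iff_sq_integrable)
  have \<beta>: "24 / \<epsilon> * (H 1 x / \<Sigma> 1 + H 2 x / \<Sigma> 2 + H 3 x / \<Sigma> 3) * U_new x
      + (1 / \<Sigma> 1 + 1 / \<Sigma> 2 + 1 / \<Sigma> 3) * beta \<Sigma> \<epsilon> (\<lambda>j. H j x) (U_new x) = 0" for x
  proof -
    have "24 / \<epsilon> * k * u + s * (- (8 / \<epsilon>) * (3 / s) * k * u) = 0" if "s \<noteq> 0" for k u s :: real
      using that by simp
    from this[OF \<Sigma>_nonzero(2)] show ?thesis unfolding beta_def Sigma_T_def .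
  qed
  have energy: "1 / \<delta>t * ((\<Sum>i\<in>UNIV. 3 / 8 * \<Sigma> i * \<epsilon> * (dirichlet ?M (jet_of \<Omega> (c_new i)) (jet_of \<Omega> (c_new i))
          - dirichlet ?M (jet_of \<Omega> (c_old i)) (jet_of \<Omega> (c_old i))))
        + 12 / \<epsilon> * ((LINT x|?M. (U_new x)\<^sup>2) - (LINT x|?M. (U_old x)\<^sup>2)))
      \<le> - M\<^sub>0 * \<Sigma>low * (\<Sum>i\<in>UNIV. dirichlet ?M (jet_of \<Omega> (\<mu>_new i)) (jet_of \<Omega> (\<mu>_new i)) / (\<Sigma> i)\<^sup>2)"
    using sum_old scheme_c scheme_\<mu> scheme_U
    by (intro three_phase_energy_decay[OF fin green U params(1,2) step \<Sigma>low(1) \<Sigma>_nonzero(1) \<Sigma>low(2) _ _ _ \<beta>])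
       (simp_all only: jet_of_def fst_conv snd_conv)
  have grad: "dirichlet ?M (jet_of \<Omega> u) (jet_of \<Omega> u) = (L2norm \<Omega> (weak_gradient \<Omega> u))\<^sup>2" for u
    by (simp add: dirichlet_def jet_of_def L2norm_def power2_norm_eq_inner[symmetric])
  have val: "(LINT x|?M. (u x)\<^sup>2) = (L2norm \<Omega> u)\<^sup>2" for u :: "'a \<Rightarrow> real"
    by (simp add: L2norm_def)
  have "energy_1st \<Omega> \<Sigma> \<epsilon> B c_new U_new - energy_1st \<Omega> \<Sigma> \<epsilon> B c_old U_old
      = (\<Sum>i\<in>UNIV. 3 / 8 * \<Sigma> i * \<epsilon> * ((L2norm \<Omega> (weak_gradient \<Omega> (c_new i)))\<^sup>2
          - (L2norm \<Omega> (weak_gradient \<Omega> (c_old i)))\<^sup>2))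
        + 12 / \<epsilon> * ((L2norm \<Omega> U_new)\<^sup>2 - (L2norm \<Omega> U_old)\<^sup>2)"
    unfolding energy_1st_def right_diff_distrib sum_subtractf by simp
  then show ?thesis using energy unfolding grad val by (simp only:)
qed

end
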